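(* Let $A$ be a separable stable C*-algebra, i.e. $\mathcal{K}\otimes A\cong A$ where $\mathcal{K}$ is the algebra of compact operators on a separable infinite-dimensional Hilbert space. Let $\overline{\mathrm{Inn}(A)}$ be the closure in $\mathrm{Aut}(A)$ (point-norm topology) of the inner automorphisms of $A$. Then the orbit equivalence relation of the conjugation action of $\mathrm{Aut}(A)$ on $\overline{\mathrm{Inn}(A)}$ is not classifiable by countable structures.
   Context: The point-norm topology on $\mathrm{Aut}(A)$ is the topology of pointwise norm convergence, making $\mathrm{Aut}(A)$ a Polish group; inner automorphisms of a nonunital algebra are those implemented by unitaries of the multiplier algebra. The conjugation action is $(\gamma,\alpha)\mapsto\gamma\circ\alpha\circ\gamma^{-1}$. An equivalence relation $E$ on a Polish space $X$ is classifiable by countable structures if there are a countable first-order language $L$ and a Borel map $\theta$ from $X$ to the Polish space of $L$-structures with universe $\mathbb{N}$ such that $xEy$ iff $\theta(x)\cong\theta(y)$.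
   Formalization: The algebra A is additionally assumed to be nonzero: the zero algebra is separable and stable, but its automorphism group is trivial, so the conjugacy relation is then classifiable and the claim fails. *)

theory Defs
  imports "HOL-Analysis.Analysis"
begin

definition cstar_alg :: "(complex \<Rightarrow> 'a::{banach,real_normed_algebra} \<Rightarrow> 'a) \<Rightarrow> ('a \<Rightarrow> 'a) \<Rightarrow> bool" where
  "cstar_alg sc st \<longleftrightarrow>
     (\<forall>r x. sc (complex_of_real r) x = scaleR r x) \<and>
     (\<forall>c x y. sc c (x + y) = sc c x + sc c y) \<and>
     (\<forall>c d x. sc (c + d) x = sc c x + sc d x) \<and>
     (\<forall>c d x. sc (c * d) x = sc c (sc d x)) \<and>
     (\<forall>c x. norm (sc c x) = cmod c * norm x) \<and>
     (\<forall>c x y. sc c (x * y) = sc c x * y \<and> sc c (x * y) = x * sc c y) \<and>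
     (\<forall>x y. st (x + y) = st x + st y) \<and>
     (\<forall>c x. st (sc c x) = sc (cnj c) (st x)) \<and>
     (\<forall>x. st (st x) = x) \<and>
     (\<forall>x y. st (x * y) = st y * st x) \<and>
     (\<forall>x. norm (st x * x) = (norm x)\<^sup>2)"

definition separable_space :: "'a::topological_space itself \<Rightarrow> bool" where
  "separable_space _ \<longleftrightarrow> (\<exists>D::'a set. countable D \<and> closure D = UNIV)"

definition cstar_aut :: "(complex \<Rightarrow> 'a::{banach,real_normed_algebra} \<Rightarrow> 'a) \<Rightarrow> ('a \<Rightarrow> 'a) \<Rightarrow> ('a \<Rightarrow> 'a) \<Rightarrow> bool" where
  "cstar_aut sc st \<alpha> \<longleftrightarrow> bij \<alpha> \<and>
     (\<forall>x y. \<alpha> (x + y) = \<alpha> x + \<alpha> y) \<and>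
     (\<forall>c x. \<alpha> (sc c x) = sc c (\<alpha> x)) \<and>
     (\<forall>x y. \<alpha> (x * y) = \<alpha> x * \<alpha> y) \<and>
     (\<forall>x. \<alpha> (st x) = st (\<alpha> x))"

definition Aut :: "(complex \<Rightarrow> 'a::{banach,real_normed_algebra} \<Rightarrow> 'a) \<Rightarrow> ('a \<Rightarrow> 'a) \<Rightarrow> ('a \<Rightarrow> 'a) set" where
  "Aut sc st = {\<alpha>. cstar_aut sc st \<alpha>}"

text \<open>Multiplier algebra via double centralizers (L,R): x * L y = R x * y.
A multiplier u = (L,R) acts by u x = L x, x u = R x; its adjoint is
(x \<mapsto> st (R (st x)), x \<mapsto> st (L (st x))).  u is unitary iff u*u = uu* = 1,
i.e. the left parts of u*u and uu* are the identity.\<close>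

definition double_centralizer :: "('a::real_normed_algebra \<Rightarrow> 'a) \<Rightarrow> ('a \<Rightarrow> 'a) \<Rightarrow> bool" where
  "double_centralizer L R \<longleftrightarrow> (\<forall>x y. x * L y = R x * y)"

definition unitary_multiplier :: "('a::real_normed_algebra \<Rightarrow> 'a) \<Rightarrow> ('a \<Rightarrow> 'a) \<Rightarrow> bool" where
  "unitary_multiplier st L \<longleftrightarrow> (\<exists>R. double_centralizer L R \<and>
      (\<forall>x. st (R (st (L x))) = x) \<and> (\<forall>x. L (st (R (st x))) = x))"

text \<open>Inner automorphism Ad u : x \<mapsto> u x u*  =  L (st (L (st x))).\<close>

definition Inn :: "(complex \<Rightarrow> 'a::{banach,real_normed_algebra} \<Rightarrow> 'a) \<Rightarrow> ('a \<Rightarrow> 'a) \<Rightarrow> ('a \<Rightarrow> 'a) set" where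
  "Inn sc st = {(\<lambda>x. L (st (L (st x)))) | L. unitary_multiplier st L}"

text \<open>K \<otimes> A is realised concretely as the norm closure of the finitely supported
N\<times>N matrices over A, acting on the standard Hilbert A-module
H_A = {\<xi>. \<Sum> \<xi>_i^* \<xi>_i converges}, elements being recorded by their matrix entries.\<close>

definition HA :: "('a::{banach,real_normed_algebra} \<Rightarrow> 'a) \<Rightarrow> (nat \<Rightarrow> 'a) set" where
  "HA st = {\<xi>. summable (\<lambda>i. st (\<xi> i) * \<xi> i)}"

definition hnorm :: "('a::{banach,real_normed_algebra} \<Rightarrow> 'a) \<Rightarrow> (nat \<Rightarrow> 'a) \<Rightarrow> real" where
  "hnorm st \<xi> = sqrt (norm (\<Sum>i. st (\<xi> i) * \<xi> i))"

definition matvec :: "(nat \<Rightarrow> nat \<Rightarrow> 'a::{banach,real_normed_algebra}) \<Rightarrow> (nat \<Rightarrow> 'a) \<Rightarrow> nat \<Rightarrow> 'a" where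
  "matvec m \<xi> = (\<lambda>i. \<Sum>j. m i j * \<xi> j)"

definition finmat :: "(nat \<Rightarrow> nat \<Rightarrow> 'a::zero) \<Rightarrow> bool" where
  "finmat m \<longleftrightarrow> (\<exists>N. \<forall>i j. N \<le> i \<or> N \<le> j \<longrightarrow> m i j = 0)"

definition matnorm :: "('a::{banach,real_normed_algebra} \<Rightarrow> 'a) \<Rightarrow> (nat \<Rightarrow> nat \<Rightarrow> 'a) \<Rightarrow> real" where
  "matnorm st m = Sup {hnorm st (matvec m \<xi>) | \<xi>. \<xi> \<in> HA st \<and> hnorm st \<xi> \<le> 1}"

definition stab_model :: "('a::{banach,real_normed_algebra} \<Rightarrow> 'a) \<Rightarrow> (nat \<Rightarrow> nat \<Rightarrow> 'a) set" where
  "stab_model st = {m. \<exists>ms. (\<forall>k. finmat (ms k)) \<and>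
       (\<forall>e>0. \<exists>K. \<forall>k\<ge>K. \<forall>l\<ge>K. matnorm st (\<lambda>i j. ms k i j - ms l i j) < e) \<and>
       (\<forall>i j. (\<lambda>k. ms k i j) \<longlonglongrightarrow> m i j)}"

definition matmul :: "(nat \<Rightarrow> nat \<Rightarrow> 'a::{banach,real_normed_algebra}) \<Rightarrow> (nat \<Rightarrow> nat \<Rightarrow> 'a) \<Rightarrow> nat \<Rightarrow> nat \<Rightarrow> 'a" where
  "matmul m n = (\<lambda>i k. \<Sum>j. m i j * n j k)"

definition matstar :: "('a \<Rightarrow> 'a) \<Rightarrow> (nat \<Rightarrow> nat \<Rightarrow> 'a) \<Rightarrow> nat \<Rightarrow> nat \<Rightarrow> 'a" where
  "matstar st m = (\<lambda>i j. st (m j i))"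

definition stable :: "(complex \<Rightarrow> 'a::{banach,real_normed_algebra} \<Rightarrow> 'a) \<Rightarrow> ('a \<Rightarrow> 'a) \<Rightarrow> bool" where
  "stable sc st \<longleftrightarrow> (\<exists>\<phi>. bij_betw \<phi> UNIV (stab_model st) \<and>
     (\<forall>x y. \<phi> (x + y) = (\<lambda>i j. \<phi> x i j + \<phi> y i j)) \<and>
     (\<forall>c x. \<phi> (sc c x) = (\<lambda>i j. sc c (\<phi> x i j))) \<and>
     (\<forall>x y. \<phi> (x * y) = matmul (\<phi> x) (\<phi> y)) \<and>
     (\<forall>x. \<phi> (st x) = matstar st (\<phi> x)))"

text \<open>A countable first-order language: relation symbols Rs, function symbols Fs
(constants = 0-ary functions), arities ar.  An L-structure with universe N is a
pair (relations, functions), normalised outside the language.\<close>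

type_synonym lstruct = "(nat \<Rightarrow> nat list \<Rightarrow> bool) \<times> (nat \<Rightarrow> nat list \<Rightarrow> nat)"

definition Mod :: "nat set \<Rightarrow> nat set \<Rightarrow> (nat \<Rightarrow> nat) \<Rightarrow> lstruct set" where
  "Mod Rs Fs ar = {(R, F). (\<forall>r t. R r t \<longrightarrow> r \<in> Rs \<and> length t = ar r) \<and>
       (\<forall>f t. f \<notin> Fs \<or> length t \<noteq> ar f \<longrightarrow> F f t = 0)}"

text \<open>Subbasic open (clopen) cylinder sets of the Polish space Mod(L); they
generate its Borel sigma-algebra.\<close>

definition cyl_gens :: "nat set \<Rightarrow> nat set \<Rightarrow> (nat \<Rightarrow> nat) \<Rightarrow> lstruct set set" where
  "cyl_gens Rs Fs ar =
     {{M \<in> Mod Rs Fs ar. fst M r t} | r t. r \<in> Rs \<and> length t = ar r} \<union>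
     {{M \<in> Mod Rs Fs ar. snd M f t = k} | f t k. f \<in> Fs \<and> length t = ar f}"

definition struct_iso :: "nat set \<Rightarrow> nat set \<Rightarrow> (nat \<Rightarrow> nat) \<Rightarrow> lstruct \<Rightarrow> lstruct \<Rightarrow> bool" where
  "struct_iso Rs Fs ar M N \<longleftrightarrow> (\<exists>\<pi>. bij \<pi> \<and>
     (\<forall>r\<in>Rs. \<forall>t. length t = ar r \<longrightarrow> (fst M r t \<longleftrightarrow> fst N r (map \<pi> t))) \<and>
     (\<forall>f\<in>Fs. \<forall>t. length t = ar f \<longrightarrow> \<pi> (snd M f t) = snd N f (map \<pi> t)))"

definition classifiable_ctbl :: "'b::topological_space set \<Rightarrow> ('b \<Rightarrow> 'b \<Rightarrow> bool) \<Rightarrow> bool" where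
  "classifiable_ctbl X E \<longleftrightarrow> (\<exists>Rs Fs ar (\<theta>::'b \<Rightarrow> lstruct).
     (\<forall>x\<in>X. \<theta> x \<in> Mod Rs Fs ar) \<and>
     (\<forall>S\<in>cyl_gens Rs Fs ar. {x \<in> X. \<theta> x \<in> S} \<in> sigma_sets X {X \<inter> U | U. open U}) \<and>
     (\<forall>x\<in>X. \<forall>y\<in>X. E x y \<longleftrightarrow> struct_iso Rs Fs ar (\<theta> x) (\<theta> y)))"

end

theory Submission
  imports Defs
begin

text \<open>
Let the group of all \<open>g \<subseteq> \<nat>\<close> with \<open>\<Sum>n\<in>g. t n < \<infinity>\<close>, where \<open>t n \<longlonglongrightarrow> 0\<close>, act on Cantor space by
flipping the coordinates in \<open>g\<close>. Every Borel assignment of countable structures to the points of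
Cantor space that is isomorphism invariant on orbits takes isomorphic values on a comeager set
(Hjorth's turbulence theorem in this case): generically, flipping one coordinate of small weight is
realised by an isomorphism which fixes any prescribed finite set, so that flipping coordinates one at
a time brings two generic points together while the composed isomorphisms converge.

By stability \<open>A\<close> consists of matrices over \<open>A\<close> indexed by binary expansions, so that scalar unitaries on
an infinite tensor product of planes act as multipliers. To a point \<open>x\<close> one assigns the inner limit
\<open>\<alpha>\<^sub>x = Ad (\<Otimes> w\<^sub>n)\<close>, where \<open>w\<^sub>n\<close> has eigenvalues \<open>1, \<lambda>\<^sub>n\<close> and the reference vector is an eigenvector of \<open>w\<^sub>n\<close>
if and only if \<open>x n\<close> is false; otherwise the eigenbasis is turned by the angle \<open>t n\<close>. Points in the same
orbit give automorphisms conjugate by a norm convergent product of rotations. For suitable \<open>\<lambda>\<^sub>n\<close> and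
powers \<open>k\<^sub>a\<close>, the automorphisms \<open>\<alpha>\<^sub>x\<^bsup>k\<^sub>a\<^esup>\<close> converge pointwise to the identity along those \<open>a\<close> for which \<open>x\<close> is
false on the block \<open>{a..2*a}\<close>, and stay away from it along those \<open>a\<close> for which \<open>x\<close> is true there. As
automorphisms are isometric, \<open>\<alpha>\<^sub>x\<close> and \<open>\<alpha>\<^sub>y\<close> are not conjugate for generic \<open>x\<close> and \<open>y\<close>.
\<close>

section \<open>Baire category\<close>

text \<open>Two rates must fit together. Since sin(2 * \<open>tt n\<close>)^2 = 1/(n+2), the angles
  \<open>tt n\<close> are of order n^(-1/2). Points of one orbit differ by summable angles, as norm
  convergence of the conjugating product of rotations demands. Displacement by a power sees products
  of squared cosines instead, that is sums of squared angles, and over a block from a to 2a these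
  stay bounded away from 0 uniformly in a. The conjugating automorphism is arbitrary, so only data
  kept by every isometric automorphism can separate classes; how far a sequence of powers moves a
  fixed element is of this kind.

  On the side of structures, an isomorphism is merely asserted to exist. That is an analytic
  condition, whence the Suslin operation, and category must pin down finitely many of its values
  before two isomorphisms compose to one with fixed points. On the side of algebras, stability
  provides a purely algebraic *-isomorphism: the norm of a matrix has to be recovered from the
  C*-identity before limits of finite matrices make sense.\<close>

definition meager :: "'b::topological_space set \<Rightarrow> bool" where
  "meager S \<longleftrightarrow> (\<exists>F::nat \<Rightarrow> 'b set. (\<forall>n. closed (F n) \<and> interior (F n) = {}) \<and> S \<subseteq> (\<Union>n. F n))"

lemma meager_subset: "meager T \<Longrightarrow> S \<subseteq> T \<Longrightarrow> meager S"
  unfolding meager_def by (meson order_trans)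

lemma meager_closed: "closed F \<Longrightarrow> interior F = {} \<Longrightarrow> meager F"
  unfolding meager_def by (rule exI[of _ "\<lambda>_. F"]) auto

lemma meager_empty [simp]: "meager {}"
  by (rule meager_closed) auto

lemma meager_UN_nat:
  fixes S :: "nat \<Rightarrow> 'b::topological_space set"
  assumes "\<And>n. meager (S n)"
  shows "meager (\<Union>n. S n)"
proof -
  have "\<forall>n. \<exists>F. (\<forall>m. closed (F m) \<and> interior (F m) = {}) \<and> S n \<subseteq> (\<Union>m::nat. F m)"
    using assms unfolding meager_def by blast
  then obtain F where F: "\<And>n m. closed (F n m) \<and> interior (F n m) = {}" "\<And>n. S n \<subseteq> (\<Union>m::nat. F n m)"
    by metis
  show ?thesis
    unfolding meager_def
  proof (intro exI conjI allI)
    fix k show "closed ((\<lambda>k. case prod_decode k of (n, m) \<Rightarrow> F n m) k)"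
      "interior ((\<lambda>k. case prod_decode k of (n, m) \<Rightarrow> F n m) k) = {}"
      using F(1) by (auto split: prod.splits)
  next
    show "(\<Union>n. S n) \<subseteq> (\<Union>k. (\<lambda>k. case prod_decode k of (n, m) \<Rightarrow> F n m) k)"
    proof
      fix x assume "x \<in> (\<Union>n. S n)"
      then obtain n m where "x \<in> F n m" using F(2) by blast
      then have "x \<in> (case prod_decode (prod_encode (n, m)) of (n, m) \<Rightarrow> F n m)" by simp
      then show "x \<in> (\<Union>k. (\<lambda>k. case prod_decode k of (n, m) \<Rightarrow> F n m) k)"
        by (intro UN_I[of "prod_encode (n, m)"]) auto
    qed
  qed
qed

lemma meager_UN:
  assumes "countable I" "\<And>i. i \<in> I \<Longrightarrow> meager (S i)"
  shows "meager (\<Union>i\<in>I. S i)"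
proof (cases "I = {}")
  case False
  have "(\<Union>i\<in>I. S i) = (\<Union>n. S (from_nat_into I n))"
    using range_from_nat_into[OF False assms(1)] by (metis image_image)
  then show ?thesis
    using meager_UN_nat[of "\<lambda>n. S (from_nat_into I n)"] assms(2) from_nat_into[OF False] by auto
qed auto

lemma meager_Un: "meager S \<Longrightarrow> meager T \<Longrightarrow> meager (S \<union> T)"
  using meager_UN[of "UNIV::bool set" "\<lambda>b. if b then S else T"] by (auto simp: UNIV_bool Un_commute)

text \<open>The homeomorphisms used below are involutions or compositions of involutions. The
  preimage of an open set under \<open>h\<close> is also its image, so an interior point of a
  preimage yields one of the set itself.\<close>

lemma meager_vimage_involution:
  assumes c: "continuous_on UNIV h" and inv: "\<And>x. h (h x) = x" and m: "meager S"
  shows "meager (h -` S)"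
proof -
  obtain F where F: "\<forall>n. closed (F n) \<and> interior (F n) = {}" "S \<subseteq> (\<Union>n::nat. F n)"
    using m unfolding meager_def by blast
  show ?thesis unfolding meager_def
  proof (intro exI[of _ "\<lambda>n. h -` F n"] conjI allI)
    fix n
    show "closed (h -` F n)" using F(1) c by (simp add: closed_vimage)
    have "h -` interior (h -` F n) \<subseteq> F n"
    proof
      fix y assume "y \<in> h -` interior (h -` F n)"
      then have "h (h y) \<in> F n" using interior_subset[of "h -` F n"] by blast
      then show "y \<in> F n" by (simp add: inv)
    qed
    then have "h -` interior (h -` F n) \<subseteq> interior (F n)"
      using c by (intro interior_maximal) (auto simp: open_vimage)
    then have "h -` interior (h -` F n) = {}" using F(1) by blast
    then have "h x \<notin> interior (h -` F n)" for x by blast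
    from this[of "h _"] show "interior (h -` F n) = {}" by (auto simp: inv)
  next
    show "h -` S \<subseteq> (\<Union>n. h -` F n)" using F(2) by blast
  qed
qed

section \<open>The property of Baire\<close>

definition baire_prop :: "'b::topological_space set \<Rightarrow> bool" where
  "baire_prop S \<longleftrightarrow> (\<exists>U. open U \<and> meager ((S - U) \<union> (U - S)))"

lemma baire_prop_open: "open U \<Longrightarrow> baire_prop U"
  unfolding baire_prop_def by (rule exI[of _ U]) auto

lemma meager_boundary: "closed F \<Longrightarrow> meager (F - interior F)"
  using closure_subset[of "interior F"] by (intro meager_closed) (auto simp: closed_Diff interior_diff interior_interior)

lemma baire_prop_compl:
  assumes "baire_prop S" shows "baire_prop (- S)"
proof -
  obtain U where U: "open U" "meager ((S - U) \<union> (U - S))" using assms baire_prop_def by blast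
  have "(- S - interior (- U)) \<union> (interior (- U) - - S)
      \<subseteq> ((S - U) \<union> (U - S)) \<union> (- U - interior (- U))"
    using interior_subset[of "- U"] by auto
  moreover have "meager (- U - interior (- U))" using U(1) by (intro meager_boundary) auto
  ultimately show ?thesis unfolding baire_prop_def using U(2) meager_Un meager_subset open_interior by metis
qed

lemma baire_prop_UN:
  assumes "countable I" "\<And>i. i \<in> I \<Longrightarrow> baire_prop (S i)"
  shows "baire_prop (\<Union>i\<in>I. S i)"
proof -
  obtain U where U: "\<And>i. i \<in> I \<Longrightarrow> open (U i)" "\<And>i. i \<in> I \<Longrightarrow> meager ((S i - U i) \<union> (U i - S i))"
    using assms(2) unfolding baire_prop_def by metis
  have "meager (\<Union>i\<in>I. (S i - U i) \<union> (U i - S i))" using assms(1) U(2) by (rule meager_UN)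
  then have "meager (((\<Union>i\<in>I. S i) - (\<Union>i\<in>I. U i)) \<union> ((\<Union>i\<in>I. U i) - (\<Union>i\<in>I. S i)))"
    by (rule meager_subset) auto
  then show ?thesis unfolding baire_prop_def using U(1) by blast
qed

lemma baire_prop_INT:
  assumes "countable I" "\<And>i. i \<in> I \<Longrightarrow> baire_prop (S i)"
  shows "baire_prop (\<Inter>i\<in>I. S i)"
proof -
  have "baire_prop (- (\<Union>i\<in>I. - S i))" using assms by (intro baire_prop_compl baire_prop_UN)
  then show ?thesis by simp
qed

lemma baire_prop_borel:
  assumes "S \<in> sets borel" shows "baire_prop S"
proof -
  have "S \<in> sigma_sets UNIV {U. open U}" using assms by (simp add: borel_def)
  then show ?thesis
  proof induction
    case (Compl a) then show ?case using baire_prop_compl by (metis Compl_eq_Diff_UNIV)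
  next
    case (Union a) then show ?case using baire_prop_UN[of UNIV a] by auto
  qed (auto intro: baire_prop_open)
qed

text \<open>The largest open set on every nonempty open part of which \<open>A\<close> is nonmeager.\<close>

definition nonmeager_hull :: "'b::topological_space set \<Rightarrow> 'b set" where
  "nonmeager_hull A = interior {x. \<forall>U. open U \<and> x \<in> U \<longrightarrow> \<not> meager (A \<inter> U)}"

lemma open_nonmeager_hull [simp]: "open (nonmeager_hull A)" by (simp add: nonmeager_hull_def)

lemma nonmeager_hull_Int:
  assumes "open U" "U \<inter> nonmeager_hull A \<noteq> {}" shows "\<not> meager (A \<inter> U)"
  using assms interior_subset unfolding nonmeager_hull_def by blast

text \<open>The points near which \<open>A\<close> is meager are covered by countably many basic
  sets, each meeting \<open>A\<close> in a meager set. Passing from the closed set \<open>D\<close>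
  to its interior loses only a meager boundary.\<close>

lemma meager_Diff_hull:
  fixes A :: "'b::second_countable_topology set"
  shows "meager (A - nonmeager_hull A)"
proof -
  define D where "D = {x. \<forall>U. open U \<and> x \<in> U \<longrightarrow> \<not> meager (A \<inter> U)}"
  obtain B :: "'b set set" where B: "countable B" "topological_basis B"
    using ex_countable_basis by blast
  have "- D = \<Union>{U. open U \<and> meager (A \<inter> U)}" unfolding D_def by auto
  then have "open (- D)" by auto
  then have "closed D" by (simp add: closed_def)
  then have 1: "meager (D - interior D)" by (rule meager_boundary)
  have "meager (\<Union>U\<in>{U\<in>B. meager (A \<inter> U)}. A \<inter> U)"
    using B(1) by (intro meager_UN) auto
  moreover have "A - D \<subseteq> (\<Union>U\<in>{U\<in>B. meager (A \<inter> U)}. A \<inter> U)"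
  proof
    fix x assume x: "x \<in> A - D"
    then obtain U where U: "open U" "x \<in> U" "meager (A \<inter> U)" unfolding D_def by blast
    obtain V where V: "V \<in> B" "x \<in> V" "V \<subseteq> U" using topological_basisE[OF B(2) U(1,2)] by blast
    have "meager (A \<inter> V)" by (rule meager_subset[OF U(3)]) (use V in auto)
    then show "x \<in> (\<Union>U\<in>{U\<in>B. meager (A \<inter> U)}. A \<inter> U)" using x V by auto
  qed
  ultimately have "meager (A - D)" by (rule meager_subset)
  then have "meager ((A - D) \<union> (D - interior D))" using 1 by (rule meager_Un)
  then show ?thesis by (rule meager_subset) (auto simp: nonmeager_hull_def D_def)
qed

text \<open>Hulls are open, so an open set in which the difference is dense would miss every hull of
  a \<open>B k\<close>. There \<open>A\<close> would be covered by the meager sets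
  \<open>B k - nonmeager_hull (B k)\<close>, against the meaning of its own hull.\<close>

lemma meager_hull_Diff_UN:
  fixes A :: "'b::second_countable_topology set" and B :: "nat \<Rightarrow> 'b set"
  assumes "A \<subseteq> (\<Union>k. B k)"
  shows "meager (nonmeager_hull A - (\<Union>k. nonmeager_hull (B k)))"
proof -
  define S where "S = nonmeager_hull A - (\<Union>k. nonmeager_hull (B k))"
  have "interior (closure S) = {}"
  proof (rule ccontr)
    define V where "V = interior (closure S)"
    assume "interior (closure S) \<noteq> {}"
    have meets: "T \<inter> S \<noteq> {}" if "open T" "T \<subseteq> V" "T \<noteq> {}" for T
      using that interior_subset[of "closure S"] open_Int_closure_eq_empty[of T S] unfolding V_def by blast
    have "open V" "V \<noteq> {}" using \<open>interior (closure S) \<noteq> {}\<close> by (auto simp: V_def)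
    then have "V \<inter> S \<noteq> {}" using meets by blast
    then have ne: "V \<inter> nonmeager_hull A \<noteq> {}" unfolding S_def by blast
    have disj: "V \<inter> nonmeager_hull (B k) = {}" for k
      using meets[of "V \<inter> nonmeager_hull (B k)"] \<open>open V\<close> open_nonmeager_hull[of "B k"] unfolding S_def by blast
    have "meager (\<Union>k. B k - nonmeager_hull (B k))" by (intro meager_UN_nat meager_Diff_hull)
    moreover have "A \<inter> V \<subseteq> (\<Union>k. B k - nonmeager_hull (B k))" using assms disj by blast
    ultimately have "meager (A \<inter> V)" by (rule meager_subset)
    then show False using nonmeager_hull_Int[OF \<open>open V\<close> ne] by blast
  qed
  then have "meager (closure S)" by (intro meager_closed) auto
  then show ?thesis using closure_subset meager_subset unfolding S_def by blast
qed

text \<open>Up to a meager set the complement of \<open>F\<close> is an open set \<open>U\<close>.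
  It meets \<open>A\<close> in a meager set and therefore misses the hull of
  \<open>A\<close>.\<close>

lemma meager_hull_Diff_bp:
  assumes "A \<subseteq> F" "baire_prop F"
  shows "meager (nonmeager_hull A - F)"
proof -
  obtain U where U: "open U" "meager ((- F - U) \<union> (U - - F))"
    using baire_prop_compl[OF assms(2)] unfolding baire_prop_def by blast
  have "meager (A \<inter> U)" by (rule meager_subset[OF U(2)]) (use assms(1) in auto)
  then have "U \<inter> nonmeager_hull A = {}" using nonmeager_hull_Int U(1) by blast
  then show ?thesis using U(2) by (intro meager_subset[OF U(2)]) auto
qed

text \<open>This is the theorem that the Suslin operation preserves the property of Baire.\<close>

lemma suslin_scheme_hull:
  fixes A F :: "nat list \<Rightarrow> 'b::second_countable_topology set"
  assumes A: "\<And>s. A s \<subseteq> (\<Union>k. A (s @ [k]))" and AF: "\<And>s. A s \<subseteq> F s" and F: "\<And>s. baire_prop (F s)"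
  shows "meager (nonmeager_hull (A []) - {x. \<exists>f. \<forall>n. x \<in> F (map f [0..<n])})"
proof -
  \<comment> \<open>\<open>M\<close> collects the failures at the countably many nodes. Outside
    \<open>M\<close>, membership in the hull of a node passes to some child and forces membership in
    \<open>F\<close> of the node, so a branch grows from the root.\<close>
  define M where "M = (\<Union>s. (nonmeager_hull (A s) - (\<Union>k. nonmeager_hull (A (s @ [k])))) \<union> (nonmeager_hull (A s) - F s))"
  have "meager ((nonmeager_hull (A s) - (\<Union>k. nonmeager_hull (A (s @ [k])))) \<union> (nonmeager_hull (A s) - F s))" for s
    by (rule meager_Un[OF meager_hull_Diff_UN[OF A] meager_hull_Diff_bp[OF AF F]])
  then have "meager M" unfolding M_def by (intro meager_UN) auto
  moreover have "nonmeager_hull (A []) - {x. \<exists>f. \<forall>n. x \<in> F (map f [0..<n])} \<subseteq> M"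
  proof (rule ccontr)
    assume "\<not> ?thesis"
    then obtain x where x: "x \<in> nonmeager_hull (A [])" "\<nexists>f. \<forall>n. x \<in> F (map f [0..<n])" "x \<notin> M" by blast
    have step: "\<exists>k. x \<in> nonmeager_hull (A (s @ [k]))" if "x \<in> nonmeager_hull (A s)" for s
      using that x(3) unfolding M_def by blast
    define nxt where "nxt s = (SOME k. x \<in> nonmeager_hull (A (s @ [k])))" for s
    define S where "S = rec_nat [] (\<lambda>_ s. s @ [nxt s])"
    have S0: "S 0 = []" and SS: "\<And>n. S (Suc n) = S n @ [nxt (S n)]" by (auto simp: S_def)
    have "x \<in> nonmeager_hull (A (S n))" for n
    proof (induction n)
      case (Suc n) then show ?case unfolding SS nxt_def using someI_ex[OF step] by blast
    qed (simp add: S0 x)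
    then have "x \<in> F (S n)" for n using x(3) unfolding M_def by blast
    moreover have "map (\<lambda>n. nxt (S n)) [0..<n] = S n" for n by (induction n) (auto simp: S0 SS)
    ultimately show False using x(2) by metis
  qed
  ultimately show ?thesis by (rule meager_subset)
qed

section \<open>Isomorphisms of relational structures on the natural numbers\<close>

definition isoR :: "(nat \<Rightarrow> nat) \<Rightarrow> (nat \<Rightarrow> nat list \<Rightarrow> bool) \<Rightarrow> (nat \<Rightarrow> nat list \<Rightarrow> bool) \<Rightarrow> bool" where
  "isoR \<pi> R S \<longleftrightarrow> bij \<pi> \<and> (\<forall>r u. R r u \<longleftrightarrow> S r (map \<pi> u))"

lemma isoR_comp: "isoR \<pi> R S \<Longrightarrow> isoR \<rho> S T \<Longrightarrow> isoR (\<rho> \<circ> \<pi>) R T"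
  unfolding isoR_def by (auto simp: bij_comp)

lemma isoR_inv: assumes "isoR \<pi> R S" shows "isoR (inv \<pi>) S R"
proof -
  have b: "bij \<pi>" using assms isoR_def by blast
  have "map \<pi> (map (inv \<pi>) u) = u" for u
    using b by (simp add: bij_is_surj surj_f_inv_f map_idI)
  then show ?thesis using assms unfolding isoR_def by (metis bij_imp_bij_inv)
qed

lemma isoR_id: "isoR id R R" by (simp add: isoR_def)

text \<open>A bijection \<open>\<pi>\<close> is coded by the branch \<open>\<pi> 0, \<pi>\<^sup>-\<^sup>1 0, \<pi> 1, \<pi>\<^sup>-\<^sup>1 1, \<dots>\<close>.\<close>

lemma meager_hull_Diff_isoR:
  fixes R S :: "'b::second_countable_topology \<Rightarrow> nat \<Rightarrow> nat list \<Rightarrow> bool"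
    and k :: nat and p :: "nat \<Rightarrow> nat"
  assumes R: "\<And>r u. baire_prop {y. R y r u}" and S: "\<And>r u. baire_prop {y. S y r u}"
  defines "A \<equiv> {y. \<exists>\<pi>. isoR \<pi> (R y) (S y) \<and> (\<forall>i<k. \<pi> (p i) = i)}"
  shows "meager (nonmeager_hull A - A)"
proof -
  define code where "code \<pi> m = (if even m then \<pi> (m div 2) else inv \<pi> (m div 2))" for \<pi> :: "nat \<Rightarrow> nat" and m
  define B where "B s = {y. \<exists>\<pi>. isoR \<pi> (R y) (S y) \<and> (\<forall>i<k. \<pi> (p i) = i) \<and>
      (\<forall>m<length s. s ! m = code \<pi> m)}" for s
  \<comment> \<open>The part of the condition that does not involve \<open>y\<close>: the recorded
    values of the map and of its inverse agree, and the inverse takes the prescribed values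
    \<open>p i\<close>.\<close>
  define stat where "stat s \<longleftrightarrow> (\<forall>i j. 2*i < length s \<and> 2*j+1 < length s \<longrightarrow> (s ! (2*i) = j \<longleftrightarrow> s ! (2*j+1) = i)) \<and>
      (\<forall>i<k. 2*i+1 < length s \<longrightarrow> s ! (2*i+1) = p i)" for s :: "nat list"
  define F where "F s = (if stat s then \<Inter>(r,u)\<in>UNIV \<times> lists {i. 2*i < length s}.
      {y. R y r u \<longleftrightarrow> S y r (map (\<lambda>i. s ! (2*i)) u)} else {})" for s
  have eq: "baire_prop {y. R y r u \<longleftrightarrow> S y r v}" for r u v
  proof -
    have "{y. R y r u \<longleftrightarrow> S y r v} = (\<Union>b\<in>(UNIV::bool set). \<Inter>c\<in>(UNIV::bool set).
       (if b then (if c then {y. R y r u} else {y. S y r v}) else (if c then - {y. R y r u} else - {y. S y r v})))"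
      by (auto simp: UNIV_bool)
    also have "baire_prop \<dots>" using R S by (intro baire_prop_UN baire_prop_INT) (auto intro: baire_prop_compl)
    finally show ?thesis .
  qed
  have "baire_prop (F s)" for s
    unfolding F_def using eq baire_prop_open[of "{}"] by (auto intro!: baire_prop_INT split: prod.splits)
  moreover have "B s \<subseteq> (\<Union>c. B (s @ [c]))" for s
  proof
    fix y assume "y \<in> B s"
    then obtain \<pi> where "isoR \<pi> (R y) (S y) \<and> (\<forall>i<k. \<pi> (p i) = i) \<and> (\<forall>m<length s. s ! m = code \<pi> m)"
      unfolding B_def by blast
    then have "y \<in> B (s @ [code \<pi> (length s)])" unfolding B_def
      by (auto intro!: exI[of _ \<pi>] simp: nth_append less_Suc_eq)
    then show "y \<in> (\<Union>c. B (s @ [c]))" by blast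
  qed
  moreover have "B s \<subseteq> F s" for s
  proof
    fix y assume "y \<in> B s"
    then obtain \<pi> where \<pi>: "isoR \<pi> (R y) (S y)" "\<And>i. i<k \<Longrightarrow> \<pi> (p i) = i" "\<And>m. m<length s \<Longrightarrow> s ! m = code \<pi> m"
      unfolding B_def by blast
    have b: "bij \<pi>" using \<pi>(1) isoR_def by blast
    have ev: "s ! (2*i) = \<pi> i" if "2*i < length s" for i using \<pi>(3)[OF that] by (simp add: code_def)
    have od: "s ! (2*i+1) = inv \<pi> i" if "2*i+1 < length s" for i using \<pi>(3)[OF that] by (simp add: code_def)
    have "map (\<lambda>i. s ! (2*i)) u = map \<pi> u" if "u \<in> lists {i. 2*i < length s}" for u
      using that ev by auto
    then have "R y r u \<longleftrightarrow> S y r (map (\<lambda>i. s ! (2*i)) u)" if "u \<in> lists {i. 2*i < length s}" for r u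
      using \<pi>(1) that unfolding isoR_def by metis
    moreover have "stat s" unfolding stat_def
    proof (intro conjI allI impI)
      fix i j assume "2*i < length s \<and> 2*j+1 < length s"
      then show "s ! (2*i) = j \<longleftrightarrow> s ! (2*j+1) = i" using ev[of i] od[of j] b
        by (metis bij_inv_eq_iff)
    next
      fix i assume "i < k" "2*i+1 < length s"
      then show "s ! (2*i+1) = p i" using od[of i] \<pi>(2)[of i] b by (metis bij_inv_eq_iff)
    qed
    ultimately show "y \<in> F s" unfolding F_def by simp
  qed
  ultimately have "meager (nonmeager_hull (B []) - {y. \<exists>f. \<forall>n. y \<in> F (map f [0..<n])})"
    by (intro suslin_scheme_hull) auto
  moreover have "B [] = A" by (simp add: B_def A_def)
  moreover have "{y. \<exists>f. \<forall>n. y \<in> F (map f [0..<n])} \<subseteq> A"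
  proof clarify
    fix y f assume f: "\<forall>n. y \<in> F (map f [0..<n])"
    have st: "stat (map f [0..<n])" for n using f unfolding F_def by (metis empty_iff)
    have st1: "f (2*i) = j \<longleftrightarrow> f (2*j+1) = i" if "2*i < n" "2*j+1 < n" for i j n
      using st[of n] that unfolding stat_def by auto
    have st2: "f (2*i+1) = p i" if "i < k" "2*i+1 < n" for i n
      using st[of n] that unfolding stat_def by auto
    define \<pi> where "\<pi> i = f (2*i)" for i
    \<comment> \<open>Consistency of even and odd entries at all lengths is bijectivity, the odd
      entries listing the inverse.\<close>
    have inv: "\<pi> i = j \<longleftrightarrow> f (2*j+1) = i" for i j
      using st1[of i "2*i+2*j+2" j] unfolding \<pi>_def by simp
    have "bij \<pi>" by (metis bijI' inv)
    moreover have "R y r u \<longleftrightarrow> S y r (map \<pi> u)" for r u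
    proof -
      define n where "n = 2 * Max (insert 0 (set u)) + 1"
      have n: "2*i < n" if "i \<in> set u" for i using that Max_ge[of "insert 0 (set u)" i] unfolding n_def
        by (metis List.finite_set finite_insert insertCI less_Suc_eq_le mult_le_mono2 Suc_eq_plus1)
      then have "u \<in> lists {i. 2*i < length (map f [0..<n])}" by auto
      then have "R y r u \<longleftrightarrow> S y r (map (\<lambda>i. map f [0..<n] ! (2*i)) u)"
        using spec[OF f, of n] st[of n] unfolding F_def by auto
      also have "map (\<lambda>i. map f [0..<n] ! (2*i)) u = map \<pi> u" using n by (auto simp: \<pi>_def)
      finally show ?thesis .
    qed
    moreover have "\<pi> (p i) = i" if "i < k" for i
      using st2[of i "2*i+2"] that inv by simp
    ultimately show "y \<in> A" unfolding A_def isoR_def by blast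
  qed
  ultimately show ?thesis by (elim meager_subset) auto
qed

text \<open>If the fibre over \<open>y\<close> contains \<open>B\<close>, the Baire property of the
  fibre space makes one of the closed sets \<open>F n\<close> contain some
  \<open>{y} \<times> V\<close> with \<open>V\<close> basic. For fixed \<open>V\<close> and
  \<open>n\<close> the set of such \<open>y\<close> is closed, and an interior point of it would
  give \<open>F n\<close> an interior point.\<close>

lemma kuratowski_ulam_box:
  fixes N :: "('x::topological_space \<times> 'z::second_countable_topology) set"
  assumes baire: "\<And>B::'z set. open B \<Longrightarrow> B \<noteq> {} \<Longrightarrow> \<not> meager B"
    and N: "meager N" and B: "open B" "B \<noteq> {}"
  shows "meager {y. {y} \<times> B \<subseteq> N}"
proof -
  obtain F where F: "\<And>n. closed (F n)" "\<And>n. interior (F n) = {}" "N \<subseteq> (\<Union>n::nat. F n)"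
    using N unfolding meager_def by blast
  obtain \<B> :: "'z set set" where \<B>: "countable \<B>" "topological_basis \<B>"
    using ex_countable_basis by blast
  have 1: "meager {y. {y} \<times> V \<subseteq> F n}" if "V \<in> \<B>" "V \<noteq> {}" for V n
  proof (rule meager_closed)
    have "{y. {y} \<times> V \<subseteq> F n} = (\<Inter>z\<in>V. (\<lambda>y. (y, z)) -` F n)" by auto
    moreover have "closed ((\<lambda>y. (y, z)) -` F n)" for z
      by (intro closed_vimage F continuous_intros)
    ultimately show "closed {y. {y} \<times> V \<subseteq> F n}" by auto
    have "interior {y. {y} \<times> V \<subseteq> F n} \<times> V \<subseteq> interior (F n)"
    proof (rule interior_maximal)
      show "interior {y. {y} \<times> V \<subseteq> F n} \<times> V \<subseteq> F n"
        using interior_subset[of "{y. {y} \<times> V \<subseteq> F n}"] by auto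
      show "open (interior {y. {y} \<times> V \<subseteq> F n} \<times> V)"
        using topological_basis_open[OF \<B>(2) that(1)] by (intro open_Times) auto
    qed
    then show "interior {y. {y} \<times> V \<subseteq> F n} = {}" using F(2) that(2) by blast
  qed
  have "meager (\<Union>(V,n)\<in>{V\<in>\<B>. V \<noteq> {}} \<times> UNIV. {y. {y} \<times> V \<subseteq> F n})"
    using \<B>(1) 1 by (intro meager_UN) (auto intro: countable_subset)
  moreover have "{y. {y} \<times> B \<subseteq> N} \<subseteq> (\<Union>(V,n)\<in>{V\<in>\<B>. V \<noteq> {}} \<times> UNIV. {y. {y} \<times> V \<subseteq> F n})"
  proof (rule ccontr)
    assume "\<not> ?thesis"
    then obtain y where "{y} \<times> B \<subseteq> N" "y \<notin> (\<Union>(V,n)\<in>{V\<in>\<B>. V \<noteq> {}} \<times> UNIV. {y. {y} \<times> V \<subseteq> F n})"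
      by blast
    then have y: "{y} \<times> B \<subseteq> N" "\<And>V n. V \<in> \<B> \<Longrightarrow> V \<noteq> {} \<Longrightarrow> \<not> {y} \<times> V \<subseteq> F n" by blast+
    have "meager (\<Union>n. Pair y -` F n)"
    proof (intro meager_UN_nat meager_closed)
      fix n
      show "closed (Pair y -` F n)" by (intro closed_vimage F continuous_intros)
      show "interior (Pair y -` F n) = {}"
      proof (rule ccontr)
        assume "interior (Pair y -` F n) \<noteq> {}"
        then obtain z where "z \<in> interior (Pair y -` F n)" by blast
        then obtain V where "V \<in> \<B>" "z \<in> V" "V \<subseteq> interior (Pair y -` F n)"
          by (rule topological_basisE[OF \<B>(2) open_interior])
        then show False using y(2)[of V n] interior_subset[of "Pair y -` F n"] by blast
      qed
    qed
    moreover have "B \<subseteq> (\<Union>n. Pair y -` F n)"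
    proof
      fix z assume "z \<in> B"
      then have "(y, z) \<in> (\<Union>n. F n)" using y(1) F(3) by blast
      then show "z \<in> (\<Union>n. Pair y -` F n)" by blast
    qed
    ultimately have "meager B" by (rule meager_subset)
    then show False using baire[OF B] by blast
  qed
  ultimately show ?thesis by (rule meager_subset)
qed

lemma not_meager_open_fun:
  fixes U :: "(nat \<Rightarrow> 'd::discrete_topology) set"
  assumes "open U" "U \<noteq> {}" shows "\<not> meager U"
proof
  assume "meager U"
  then obtain F where F: "\<And>n. closed (F n) \<and> interior (F n) = {}" "U \<subseteq> (\<Union>n::nat. F n)"
    unfolding meager_def by blast
  have "(euclidean :: 'd topology) = discrete_topology UNIV"
    by (rule topology_eq[THEN iffD2]) (auto simp: open_discrete)
  then have "completely_metrizable_space (product_topology (\<lambda>_::nat. (euclidean :: 'd topology)) UNIV)"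
    by (simp add: completely_metrizable_space_product_topology completely_metrizable_space_discrete_topology)
  then have c: "completely_metrizable_space (euclidean :: (nat \<Rightarrow> 'd) topology)"
    by (simp add: euclidean_product_topology)
  have "euclidean interior_of (\<Union>(range F)) = {}"
    by (rule Baire_category_alt) (use c F(1) in auto)
  then have "interior (\<Union>(range F)) = {}" by simp
  then show False using F(2) assms interior_maximal by blast
qed

text \<open>A box \<open>V \<times> B\<close> inside a meager \<open>U\<close> has all its fibres
  over \<open>V\<close> in \<open>U\<close>, so \<open>V\<close> would be meager.\<close>

lemma not_meager_open_prod:
  fixes U :: "((nat \<Rightarrow> 'd::discrete_topology) \<times> (nat \<Rightarrow> 'e::{discrete_topology, second_countable_topology})) set"
  assumes "open U" "U \<noteq> {}" shows "\<not> meager U"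
proof
  assume m: "meager U"
  obtain x z where "(x, z) \<in> U" using assms(2) by auto
  then obtain V B where V: "open V" "open B" "x \<in> V" "z \<in> B" "V \<times> B \<subseteq> U"
    using open_prod_elim[OF assms(1)] by (metis mem_Sigma_iff)
  then have "meager {y. {y} \<times> B \<subseteq> U}"
    by (intro kuratowski_ulam_box m not_meager_open_fun) auto
  then have "meager V" by (rule meager_subset) (use V in auto)
  then show False using V not_meager_open_fun by blast
qed

instance bool :: second_countable_topology
proof
  show "\<exists>B::bool set set. countable B \<and> open = generate_topology B"
    by (rule exI[of _ UNIV]) (auto intro!: ext generate_topology.Basis simp: open_discrete)
qed

definition cyl :: "(nat \<Rightarrow> 'd) \<Rightarrow> nat \<Rightarrow> (nat \<Rightarrow> 'd) set" where
  "cyl x N = {y. \<forall>n<N. y n = x n}"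

lemma open_cyl: "open (cyl (x :: nat \<Rightarrow> 'd::discrete_topology) N)"
proof -
  have "cyl x N = (\<Inter>n\<in>{..<N}. (\<lambda>y. y n) -` {x n})" by (auto simp: cyl_def)
  also have "open \<dots>"
    by (intro open_INT) (auto intro!: open_vimage continuous_on_product_coordinates simp: open_discrete)
  finally show ?thesis .
qed

lemma cyl_self [simp]: "x \<in> cyl x N" by (simp add: cyl_def)

lemma open_contains_cyl:
  fixes U :: "(nat \<Rightarrow> 'd::discrete_topology) set"
  assumes "open U" "x \<in> U" shows "\<exists>N. cyl x N \<subseteq> U"
proof -
  have "openin (product_topology (\<lambda>_::nat. euclidean) UNIV) U" using assms(1) by (simp add: open_fun_def)
  then obtain X where X: "x \<in> Pi\<^sub>E UNIV X" "finite {i. X i \<noteq> UNIV}" "Pi\<^sub>E UNIV X \<subseteq> U"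
    using product_topology_open_contains_basis[of "\<lambda>_. euclidean" UNIV U x] assms(2) by auto
  define N where "N = Suc (Max (insert 0 {i. X i \<noteq> UNIV}))"
  have "X i = UNIV" if "N \<le> i" for i
  proof (rule ccontr)
    assume "X i \<noteq> UNIV" then have "i \<le> Max (insert 0 {i. X i \<noteq> UNIV})" using X(2) by (intro Max_ge) auto
    then show False using that by (simp add: N_def)
  qed
  then have "y i \<in> X i" if "y \<in> cyl x N" for y i
    using that X(1) by (cases "i < N") (auto simp: cyl_def PiE_iff)
  then have "cyl x N \<subseteq> Pi\<^sub>E UNIV X" by (auto simp: PiE_iff)
  then show ?thesis using X(3) by blast
qed

section \<open>Generic ergodicity\<close>

definition flip :: "nat \<Rightarrow> (nat \<Rightarrow> bool) \<Rightarrow> nat \<Rightarrow> bool" where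
  "flip n x = x(n := \<not> x n)"

lemma flip_flip [simp]: "flip n (flip n x) = x" by (auto simp: flip_def)

lemma continuous_locally_constant:
  fixes h :: "'b::topological_space \<Rightarrow> nat \<Rightarrow> 'd::topological_space"
  assumes "\<And>x n. \<exists>U. open U \<and> x \<in> U \<and> (\<forall>y\<in>U. h y n = h x n)"
  shows "continuous_on UNIV h"
proof (rule continuous_on_coordinatewise_then_product)
  fix n
  have "open ((\<lambda>x. h x n) -` B)" for B
  proof (subst open_subopen, intro ballI)
    fix x assume x: "x \<in> (\<lambda>x. h x n) -` B"
    obtain U where U: "open U" "x \<in> U" "\<forall>y\<in>U. h y n = h x n" using assms by blast
    have "U \<subseteq> (\<lambda>x. h x n) -` B"
    proof
      fix y assume "y \<in> U"
      then have "h y n = h x n" using U(3) by blast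
      then show "y \<in> (\<lambda>x. h x n) -` B" using x by simp
    qed
    then show "\<exists>T. open T \<and> x \<in> T \<and> T \<subseteq> (\<lambda>x. h x n) -` B" using U(1,2) by blast
  qed
  then show "continuous_on UNIV (\<lambda>x. h x n)" by (simp add: continuous_on_open_vimage)
qed

lemma continuous_flip: "continuous_on UNIV (flip n)"
proof (rule continuous_locally_constant)
  fix x :: "nat \<Rightarrow> bool" and m
  show "\<exists>U. open U \<and> x \<in> U \<and> (\<forall>y\<in>U. flip n y m = flip n x m)"
    by (intro exI[of _ "cyl x (Suc (max n m))"] conjI open_cyl cyl_self) (auto simp: cyl_def flip_def)
qed

text \<open>\<open>P x\<close> is the relational structure attached to \<open>x\<close>;
  \<open>r\<close> names a relation and \<open>u\<close> is a tuple of any length.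
  \<open>P_inv\<close> is invariance under the group of sets of summable weight.\<close>

locale generic_ergodicity =
  fixes t :: "nat \<Rightarrow> real" and P :: "(nat \<Rightarrow> bool) \<Rightarrow> nat \<Rightarrow> nat list \<Rightarrow> bool"
  assumes t_pos: "0 < t n" and t_lim: "t \<longlonglongrightarrow> 0"
    and P_borel: "{x. P x r u} \<in> sets borel"
    and P_inv: "summable (\<lambda>n. if x n \<noteq> y n then t n else 0) \<Longrightarrow> \<exists>\<pi>. isoR \<pi> (P x) (P y)"
begin

text \<open>The permutations fixing every \<open>i<k\<close> form a basic neighbourhood of the
  identity in the group of all permutations.\<close>

definition iso :: "nat \<Rightarrow> (nat \<Rightarrow> bool) \<Rightarrow> (nat \<Rightarrow> bool) \<Rightarrow> bool" where
  "iso k x y \<longleftrightarrow> (\<exists>\<pi>. isoR \<pi> (P x) (P y) \<and> (\<forall>i<k. \<pi> i = i))"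

lemma iso_refl: "iso k x x"
  unfolding iso_def using isoR_id by (metis id_apply)

lemma iso_trans: assumes "iso k x y" "iso k y z" shows "iso k x z"
proof -
  obtain \<pi> \<rho> where "isoR \<pi> (P x) (P y)" "\<forall>i<k. \<pi> i = i" "isoR \<rho> (P y) (P z)" "\<forall>i<k. \<rho> i = i"
    using assms unfolding iso_def by blast
  then show ?thesis unfolding iso_def by (intro exI[of _ "\<rho> \<circ> \<pi>"]) (simp add: isoR_comp)
qed

text \<open>The sequence \<open>z\<close> codes the group element which flips every coordinate \<open>z k \<noteq> 0\<close> whose weight
  is at most \<open>2\<^sup>-\<^sup>k\<close>.\<close>

definition hits :: "(nat \<Rightarrow> nat) \<Rightarrow> nat \<Rightarrow> nat set" where
  "hits z n = {k. z k = n \<and> 0 < n \<and> t n \<le> (1/2)^k}"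

text \<open>Several \<open>k\<close> may name the same coordinate, so parity decides; this also
  makes \<open>act z\<close> an involution. The entry 0 stands for no flip.\<close>

definition act :: "(nat \<Rightarrow> nat) \<Rightarrow> (nat \<Rightarrow> bool) \<Rightarrow> nat \<Rightarrow> bool" where
  "act z x n = (x n \<noteq> odd (card (hits z n)))"

lemma act_act [simp]: "act z (act z x) = x"
  by (auto simp: act_def)

text \<open>As \<open>t n\<close> is positive, only boundedly many \<open>(1/2)^k\<close> reach it.
  The bound is uniform in \<open>z\<close>, so one coordinate of \<open>act z x\<close> depends on
  finitely many entries of \<open>z\<close>.\<close>

lemma hits_bound: "\<exists>m. \<forall>z. hits z n \<subseteq> {..<m}"
proof -
  obtain m where m: "(1/2::real)^m < t n" using real_arch_pow_inv[OF t_pos, of "1/2"] by auto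
  have "k < m" if "t n \<le> (1/2)^k" for k
  proof (rule ccontr)
    assume "\<not> k < m"
    then have "(1/2::real)^k \<le> (1/2)^m" by (intro power_decreasing) auto
    then show False using that m by linarith
  qed
  then show ?thesis unfolding hits_def by (intro exI[of _ m]) auto
qed

lemma finite_hits: "finite (hits z n)"
  using hits_bound by (metis finite_lessThan finite_subset)

lemma continuous_act: "continuous_on UNIV (\<lambda>(x, z). act z x)"
proof (rule continuous_locally_constant)
  fix p :: "(nat \<Rightarrow> bool) \<times> (nat \<Rightarrow> nat)" and n
  obtain x z where p: "p = (x, z)" by fastforce
  obtain m where m: "\<And>z. hits z n \<subseteq> {..<m}" using hits_bound by blast
  have h: "hits z' n = hits z n" if "z' \<in> cyl z m" for z'
    using m[of z] m[of z'] that unfolding hits_def cyl_def by fastforce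
  have a: "act z' x' n = act z x n" if "x' \<in> cyl x (Suc n)" "z' \<in> cyl z m" for x' z'
    unfolding act_def h[OF that(2)] using that(1) by (simp add: cyl_def)
  show "\<exists>U. open U \<and> p \<in> U \<and> (\<forall>q\<in>U. (\<lambda>(x, z). act z x) q n = (\<lambda>(x, z). act z x) p n)"
  proof (intro exI[of _ "cyl x (Suc n) \<times> cyl z m"] conjI open_Times open_cyl ballI)
    fix q assume "q \<in> cyl x (Suc n) \<times> cyl z m"
    then obtain x' z' where "q = (x', z')" "x' \<in> cyl x (Suc n)" "z' \<in> cyl z m" by blast
    then show "(\<lambda>(x, z). act z x) q n = (\<lambda>(x, z). act z x) p n" using a[of x' z'] p by simp
  qed (simp add: p)
qed

text \<open>Choosing for each changed coordinate one index that hits it is injective, so the changed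
  weights sum to at most the sum of all \<open>(1/2)^k\<close>, which is 2.\<close>

lemma iso_act: "\<exists>\<pi>. isoR \<pi> (P x) (P (act z x))"
proof (rule P_inv, rule summableI_nonneg_bounded[where x = 2])
  fix N
  define D where "D = {n\<in>{..<N}. x n \<noteq> act z x n}"
  have "hits z n \<noteq> {}" if "n \<in> D" for n using that unfolding D_def act_def by auto
  then have "\<forall>n\<in>D. \<exists>k. k \<in> hits z n" by blast
  then obtain \<kappa> where \<kappa>: "\<And>n. n \<in> D \<Longrightarrow> \<kappa> n \<in> hits z n" by metis
  then have "z (\<kappa> n) = n" if "n \<in> D" for n using that unfolding hits_def by blast
  then have inj: "inj_on \<kappa> D" by (rule inj_on_inverseI)
  have "(\<Sum>n<N. if x n \<noteq> act z x n then t n else 0) = (\<Sum>n\<in>D. t n)"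
    unfolding D_def by (rule sum.inter_filter[symmetric]) auto
  also have "\<dots> \<le> (\<Sum>n\<in>D. (1/2)^\<kappa> n)" using \<kappa> unfolding hits_def by (intro sum_mono) auto
  also have "\<dots> = (\<Sum>k\<in>\<kappa> ` D. (1/2)^k)" by (simp add: sum.reindex[OF inj])
  also have "\<dots> \<le> (\<Sum>k. (1/2::real)^k)"
    by (intro sum_le_suminf summable_geometric) (auto simp: D_def)
  also have "\<dots> = 2" by (simp add: suminf_geometric)
  finally show "(\<Sum>n<N. if x n \<noteq> act z x n then t n else 0) \<le> 2" .
qed (auto intro: less_imp_le t_pos)

lemma act_upd:
  assumes "z l = 0" "0 < n" "t n \<le> (1/2)^l"
  shows "act (z(l := n)) x = flip n (act z x)"
proof
  fix m
  have "hits (z(l := n)) n = insert l (hits z n)" "l \<notin> hits z n"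
    using assms unfolding hits_def by auto
  then have "card (hits (z(l := n)) n) = Suc (card (hits z n))" using finite_hits by simp
  moreover have "hits (z(l := n)) m = hits z m" if "m \<noteq> n" using that assms unfolding hits_def by auto
  ultimately show "act (z(l := n)) x m = flip n (act z x) m" by (auto simp: act_def flip_def)
qed

lemma baire_prop_vimage:
  fixes h :: "'b::topological_space \<Rightarrow> nat \<Rightarrow> bool"
  assumes "continuous_on UNIV h" shows "baire_prop {y. P (h y) r u}"
proof (rule baire_prop_borel)
  have "h -` {x. P x r u} \<inter> space borel \<in> sets borel"
    by (rule measurable_sets[OF borel_measurable_continuous_onI[OF assms] P_borel])
  then show "{y. P (h y) r u} \<in> sets borel" by (simp add: vimage_def)
qed

text \<open>Each pair \<open>(x, z)\<close> has an isomorphism from \<open>P x\<close> to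
  \<open>P (act z x)\<close>; the preimages \<open>p\<close> of the numbers below \<open>k\<close>
  take countably many values, so one \<open>p\<close> serves on a nonmeager set, hence generically
  on a box. Two isomorphisms out of the same \<open>P x\<close> with the same \<open>p\<close>
  differ by one that fixes every \<open>i<k\<close>. Comparing \<open>z\<close> with
  \<open>z\<close> after one further flip applies this to \<open>act z x\<close> and its flip, and
  Kuratowski-Ulam passes from pairs to single points.\<close>

lemma locally_iso_flip:
  assumes "open U0" "U0 \<noteq> {}"
  shows "\<exists>U N M. open U \<and> U \<noteq> {} \<and> U \<subseteq> U0 \<and> meager M \<and> (\<forall>y\<in>U - M. \<forall>n\<ge>N. iso k y (flip n y))"
proof -
  define A where "A p = {q. \<exists>\<pi>. isoR \<pi> (P (fst q)) (P (act (snd q) (fst q))) \<and> (\<forall>i<k. \<pi> (p ! i) = i)}" for p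
  define O0 where "O0 = (\<lambda>(x, z). act z x) -` U0"
  have O0: "open O0" unfolding O0_def by (intro open_vimage continuous_act assms)
  obtain x0 where "x0 \<in> U0" using assms by blast
  then have "(act (\<lambda>_. 0) x0, \<lambda>_. 0) \<in> O0" by (simp add: O0_def)
  then have "\<not> meager O0" using O0 not_meager_open_prod by blast
  moreover have "O0 \<subseteq> (\<Union>p. A p \<inter> O0)"
  proof
    fix q assume "q \<in> O0"
    obtain \<pi> where \<pi>: "isoR \<pi> (P (fst q)) (P (act (snd q) (fst q)))" using iso_act by blast
    then have "surj \<pi>" by (simp add: isoR_def bij_is_surj)
    then have "q \<in> A (map (inv \<pi>) [0..<k])" using \<pi> unfolding A_def by (auto simp: surj_f_inv_f)
    then show "q \<in> (\<Union>p. A p \<inter> O0)" using \<open>q \<in> O0\<close> by blast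
  qed
  ultimately obtain p where p: "\<not> meager (A p \<inter> O0)"
    using meager_UN[of UNIV "\<lambda>p. A p \<inter> O0"] meager_subset by (metis countableI_type)
  have "O0 \<inter> nonmeager_hull (A p) \<noteq> {}"
    using p meager_Diff_hull[of "A p"] meager_subset[of "A p - nonmeager_hull (A p)" "A p \<inter> O0"] by blast
  then obtain x1 z1 where "(x1, z1) \<in> O0 \<inter> nonmeager_hull (A p)" by auto
  then obtain U1 B1 where U1: "open U1" "open B1" "x1 \<in> U1" "z1 \<in> B1" "U1 \<times> B1 \<subseteq> O0 \<inter> nonmeager_hull (A p)"
    using open_prod_elim[of "O0 \<inter> nonmeager_hull (A p)"] O0 by (metis mem_Sigma_iff open_Int open_nonmeager_hull)
  \<comment> \<open>The box restricts only the entries of \<open>z\<close> below \<open>l\<close>,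
    so entry \<open>l\<close> is free to carry one further flip.\<close>
  obtain l where l: "cyl z1 l \<subseteq> B1" using open_contains_cyl U1(2,4) by blast
  define M1 where "M1 = nonmeager_hull (A p) - A p"
  have M1: "meager M1" unfolding M1_def A_def
  proof (rule meager_hull_Diff_isoR)
    fix r u
    show "baire_prop {y. P (fst y) r u}" by (intro baire_prop_vimage continuous_intros)
    show "baire_prop {y::(nat \<Rightarrow> bool) \<times> (nat \<Rightarrow> nat). P (act (snd y) (fst y)) r u}"
      using baire_prop_vimage[OF continuous_act, of r u] by (simp add: case_prod_beta)
  qed
  \<comment> \<open>A transposition rather than an assignment: this makes \<open>sw n\<close> an
    involution, and it still sends the idle value 0 at place \<open>l\<close> to
    \<open>n\<close>.\<close>
  define sw where "sw n q = (fst q, (snd q)(l := Transposition.transpose 0 n (snd q l)))"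
    for n and q :: "(nat \<Rightarrow> bool) \<times> (nat \<Rightarrow> nat)"
  have sw_inv: "sw n (sw n q) = q" for n q by (simp add: sw_def)
  have "continuous_on UNIV (\<lambda>z::nat \<Rightarrow> nat. z(l := Transposition.transpose 0 n (z l)))" for n
  proof (rule continuous_locally_constant)
    fix z :: "nat \<Rightarrow> nat" and m
    show "\<exists>U. open U \<and> z \<in> U \<and> (\<forall>y\<in>U. (y(l := Transposition.transpose 0 n (y l))) m = (z(l := Transposition.transpose 0 n (z l))) m)"
      by (intro exI[of _ "cyl z (Suc (max l m))"] conjI open_cyl cyl_self) (auto simp: cyl_def)
  qed
  note upd_cont = this
  have "continuous_on UNIV (\<lambda>q::(nat \<Rightarrow> bool) \<times> (nat \<Rightarrow> nat). (snd q)(l := Transposition.transpose 0 n (snd q l)))" for n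
    by (rule continuous_on_compose2[OF upd_cont continuous_on_snd[OF continuous_on_id]]) auto
  then have sw_cont: "continuous_on UNIV (sw n)" for n unfolding sw_def
    by (intro continuous_on_Pair[OF continuous_on_fst[OF continuous_on_id]])
  define M2 where "M2 = M1 \<union> (\<Union>n. sw n -` M1)"
  have M2: "meager M2" unfolding M2_def
    by (intro meager_Un M1 meager_UN_nat meager_vimage_involution sw_cont sw_inv)
  \<comment> \<open>Change of variables from the base point \<open>x\<close> to the moved point
    \<open>y = act z x\<close>, about which the conclusion speaks.\<close>
  define \<Psi> where "\<Psi> q = (act (snd q) (fst q), snd q)" for q
  have \<Psi>_cont: "continuous_on UNIV \<Psi>" unfolding \<Psi>_def
    using continuous_act by (intro continuous_on_Pair continuous_on_snd continuous_on_id) (simp add: case_prod_beta)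
  have \<Psi>_inv: "\<Psi> (\<Psi> q) = q" for q by (simp add: \<Psi>_def)
  define V0 where "V0 = U1 \<times> (cyl z1 l \<inter> (\<lambda>z. z l) -` {0})"
  have "open V0" unfolding V0_def using U1
    by (intro open_Times open_Int open_cyl open_vimage continuous_on_product_coordinates) (auto simp: open_discrete)
  then have V1: "open (\<Psi> -` V0)" by (intro open_vimage \<Psi>_cont)
  have "(x1, z1(l := 0)) \<in> V0" unfolding V0_def using U1 by (auto simp: cyl_def)
  then have "\<Psi> (x1, z1(l := 0)) \<in> \<Psi> -` V0" by (simp add: \<Psi>_inv)
  then obtain y0 z0 where "(y0, z0) \<in> \<Psi> -` V0" by (metis surj_pair)
  then obtain U B where U: "open U" "open B" "y0 \<in> U" "z0 \<in> B" "U \<times> B \<subseteq> \<Psi> -` V0"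
    using open_prod_elim[OF V1] by (metis mem_Sigma_iff)
  define M where "M = {y. {y} \<times> B \<subseteq> \<Psi> -` M2}"
  have M: "meager M" unfolding M_def
    using U by (intro kuratowski_ulam_box meager_vimage_involution M2 \<Psi>_cont \<Psi>_inv not_meager_open_fun) auto
  have "eventually (\<lambda>n. t n < (1/2)^l) sequentially"
    using t_lim by (rule order_tendstoD) simp
  then obtain N0 where N0: "\<And>n. N0 \<le> n \<Longrightarrow> t n < (1/2)^l" by (auto simp: eventually_sequentially)
  \<comment> \<open>The successor excludes \<open>n = 0\<close>, which codes no flip.\<close>
  define N where "N = Suc N0"
  have key: "iso k y (flip n y)" if "y \<in> U - M" "N \<le> n" for y n
  proof -
    obtain z where z: "z \<in> B" "(y, z) \<notin> \<Psi> -` M2" using \<open>y \<in> U - M\<close> unfolding M_def by blast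
    define x where "x = act z y"
    have y: "y = act z x" by (simp add: x_def)
    have "(x, z) \<in> V0" using U(5) z(1) that(1) unfolding \<Psi>_def x_def by auto
    then have xz: "x \<in> U1" "z \<in> cyl z1 l" "z l = 0" by (auto simp: V0_def)
    have "(x, z) \<notin> M2" using z(2) by (simp add: \<Psi>_def x_def)
    then have "(x, z) \<notin> M1" "sw n (x, z) \<notin> M1" unfolding M2_def by auto
    moreover have "sw n (x, z) = (x, z(l := n))" using xz(3) by (simp add: sw_def)
    moreover have "z(l := n) \<in> cyl z1 l" using xz(2) by (auto simp: cyl_def)
    ultimately have "(x, z) \<in> A p" "(x, z(l := n)) \<in> A p"
      using U1(5) l xz unfolding M1_def by auto
    then obtain \<pi> \<rho> where \<pi>: "isoR \<pi> (P x) (P (act z x))" "\<forall>i<k. \<pi> (p ! i) = i"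
      and \<rho>: "isoR \<rho> (P x) (P (act (z(l := n)) x))" "\<forall>i<k. \<rho> (p ! i) = i"
      unfolding A_def by auto
    have "act (z(l := n)) x = flip n y"
      unfolding y using that(2) N0[of n] xz(3) by (intro act_upd) (auto simp: N_def)
    then have "isoR (\<rho> \<circ> inv \<pi>) (P y) (P (flip n y))"
      using isoR_comp[OF isoR_inv[OF \<pi>(1)] \<rho>(1)] y by simp
    moreover have "(\<rho> \<circ> inv \<pi>) i = i" if "i < k" for i
      using \<pi> \<rho>(2) that unfolding isoR_def by (metis bij_inv_eq_iff comp_apply)
    ultimately show ?thesis unfolding iso_def by blast
  qed
  have sub: "U - M \<subseteq> U0"
  proof
    fix y assume "y \<in> U - M"
    then obtain z where "(y, z) \<in> \<Psi> -` V0" using U by blast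
    then have "(act z y, z) \<in> O0" using U1 l unfolding V0_def \<Psi>_def by auto
    then show "y \<in> U0" by (simp add: O0_def)
  qed
  have "U - M \<noteq> {}" using not_meager_open_fun[of U] U M meager_subset by blast
  then have "U \<inter> U0 \<noteq> {}" using sub by blast
  then show ?thesis using U(1) assms(1) M key by (intro exI[of _ "U \<inter> U0"] exI[of _ N] exI[of _ M]) auto
qed

lemma fold_flip_homeo: "continuous_on UNIV (fold flip ns)" "meager S \<Longrightarrow> meager (fold flip ns -` S)"
proof (induction ns)
  case (Cons n ns)
  have eq: "fold flip (n # ns) = fold flip ns \<circ> flip n" by auto
  { case 1 show ?case unfolding eq
      by (rule continuous_on_compose[OF continuous_flip]) (use Cons.IH(1) in \<open>auto intro: continuous_on_subset\<close>) }
  { case 2 then show ?case unfolding eq vimage_comp[symmetric]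
      by (intro meager_vimage_involution continuous_flip Cons.IH(2) flip_flip) }
qed auto

text \<open>The points among which the back-and-forth moves. Flip invariance keeps every finite
  stage in \<open>C\<close>; the open sets \<open>W m\<close> let the limit be kept in
  \<open>C\<close>; the sets \<open>V\<close> make each relation relatively clopen, so that
  relations converge along with points; the last clause is local control of flips.\<close>

lemma good_comeager:
  obtains C :: "(nat \<Rightarrow> bool) set" and W where "meager (- C)" "C = (\<Inter>m. W m)" "\<And>m::nat. open (W m)"
    "\<And>x n. x \<in> C \<Longrightarrow> flip n x \<in> C"
    "\<And>r u b. \<exists>V. open V \<and> (\<forall>x\<in>C. (P x r u = b) \<longleftrightarrow> x \<in> V)"
    "\<And>x k. x \<in> C \<Longrightarrow> \<exists>N. \<forall>y\<in>C \<inter> cyl x N. \<forall>n\<ge>N. iso k y (flip n y)"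
proof -
  have "baire_prop {x. P x r u = b}" for r u b
    using baire_prop_vimage[OF continuous_on_id, of r u] baire_prop_compl[of "{x. P x r u}"] by (cases b) (auto simp: Collect_neg_eq)
  then have "\<forall>r u b. \<exists>V. open V \<and> meager (({x. P x r u = b} - V) \<union> (V - {x. P x r u = b}))"
    unfolding baire_prop_def by blast
  then obtain V where V: "\<And>r u b. open (V r u b)"
    "\<And>r u b. meager (({x. P x r u = b} - V r u b) \<union> (V r u b - {x. P x r u = b}))" by metis
  define Mc where "Mc = (\<Union>(r,u,b). ({x. P x r u = b} - V r u b) \<union> (V r u b - {x. P x r u = b}))"
  have Mc: "meager Mc" unfolding Mc_def using V(2) by (intro meager_UN) auto
  obtain \<B> :: "(nat \<Rightarrow> bool) set set" where \<B>: "countable \<B>" "topological_basis \<B>"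
    using ex_countable_basis by blast
  define ok where "ok k U N M \<longleftrightarrow> meager M \<and> (\<forall>y\<in>U - M. \<forall>n\<ge>N. iso k y (flip n y))" for k U N M
  define G where "G k = {U\<in>\<B>. \<exists>N M. ok k U N M}" for k
  have "\<forall>k. \<forall>U\<in>G k. \<exists>N M. ok k U N M" unfolding G_def by blast
  then obtain N M where ok: "\<And>k U. U \<in> G k \<Longrightarrow> ok k U (N k U) (M k U)" by metis
  have openG: "open (\<Union>(G k))" for k
    using topological_basis_open[OF \<B>(2)] unfolding G_def by auto
  have "interior (- \<Union>(G k)) = {}" for k
  proof (rule ccontr)
    assume "interior (- \<Union>(G k)) \<noteq> {}"
    then obtain U N' M' where U: "open U" "U \<noteq> {}" "U \<subseteq> interior (- \<Union>(G k))" "ok k U N' M'"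
      using locally_iso_flip[of "interior (- \<Union>(G k))" k] unfolding ok_def by auto
    then obtain x where "x \<in> U" by blast
    then obtain B where B: "B \<in> \<B>" "x \<in> B" "B \<subseteq> U" using topological_basisE[OF \<B>(2) U(1)] by metis
    then have "ok k B N' M'" using U(4) unfolding ok_def by blast
    then have "B \<in> G k" using B unfolding G_def by blast
    then show False using B U(3) interior_subset[of "- \<Union>(G k)"] by blast
  qed
  then have "meager (- \<Union>(G k))" for k using openG by (intro meager_closed) auto
  moreover have "meager (\<Union>U\<in>G k. M k U)" for k
    using \<B>(1) ok unfolding ok_def by (intro meager_UN) (auto simp: G_def)
  ultimately have "meager (Mc \<union> (\<Union>k. - \<Union>(G k) \<union> (\<Union>U\<in>G k. M k U)))"
    by (intro meager_Un Mc meager_UN_nat)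
  then obtain F where F: "\<And>n. closed (F n)" "\<And>n. interior (F n) = {}"
    "Mc \<union> (\<Union>k. - \<Union>(G k) \<union> (\<Union>U\<in>G k. M k U)) \<subseteq> (\<Union>n::nat. F n)"
    unfolding meager_def by blast
  \<comment> \<open>Running through all finite sequences of flips as well as all \<open>F n\<close>
    makes the intersection invariant.\<close>
  define W where "W m = - (fold flip (from_nat (fst (prod_decode m))) -` F (snd (prod_decode m)))" for m
  define C where "C = (\<Inter>m. W m)"
  have C_iff: "x \<in> C \<longleftrightarrow> (\<forall>ns m. fold flip ns x \<notin> F m)" for x
  proof
    assume x: "x \<in> C"
    show "\<forall>ns m. fold flip ns x \<notin> F m"
    proof (intro allI)
      fix ns :: "nat list" and m
      have "x \<in> W (prod_encode (to_nat ns, m))" using x unfolding C_def by blast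
      then show "fold flip ns x \<notin> F m" by (simp add: W_def)
    qed
  qed (auto simp: C_def W_def)
  have CM: "x \<notin> Mc" "x \<in> \<Union>(G k)" "U \<in> G k \<Longrightarrow> x \<notin> M k U" if "x \<in> C" for x k U
  proof -
    have "fold flip [] x \<notin> F m" for m using that C_iff by blast
    then have "x \<notin> (\<Union>n. F n)" by simp
    then have *: "x \<notin> Mc \<union> (\<Union>k. - \<Union>(G k) \<union> (\<Union>U\<in>G k. M k U))" using F(3) by (rule contra_subsetD[rotated])
    show "x \<notin> Mc" "x \<in> \<Union>(G k)" "U \<in> G k \<Longrightarrow> x \<notin> M k U" using * by blast+
  qed
  show ?thesis
  proof (rule that)
    have "- C = (\<Union>m. - W m)" unfolding C_def by auto
    moreover have "meager (- W m)" for m unfolding W_def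
      using fold_flip_homeo(2)[OF meager_closed] F by simp
    ultimately show "meager (- C)" using meager_UN_nat by metis
    show "C = (\<Inter>m. W m)" by (fact C_def)
    show "open (W m)" for m unfolding W_def
      using closed_vimage[OF F(1) fold_flip_homeo(1)] by (simp add: open_Compl)
    show "flip n x \<in> C" if "x \<in> C" for n x
      unfolding C_iff
    proof (intro allI)
      fix ns :: "nat list" and m show "fold flip ns (flip n x) \<notin> F m" using that C_iff[of x] by (metis fold_simps(2))
    qed
    show "\<exists>V. open V \<and> (\<forall>x\<in>C. (P x r u = b) \<longleftrightarrow> x \<in> V)" for r u b
    proof (intro exI[of _ "V r u b"] conjI V(1) ballI)
      fix x assume "x \<in> C"
      then have "x \<notin> Mc" by (rule CM)
      then show "(P x r u = b) \<longleftrightarrow> x \<in> V r u b" unfolding Mc_def by blast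
    qed
    show "\<exists>N. \<forall>y\<in>C \<inter> cyl x N. \<forall>n\<ge>N. iso k y (flip n y)" if xC: "x \<in> C" for x k
    proof -
      obtain U where U: "U \<in> G k" "x \<in> U" using CM(2)[OF xC, of k] by blast
      have "open U" using U(1) topological_basis_open[OF \<B>(2)] unfolding G_def by auto
      then obtain N1 where N1: "cyl x N1 \<subseteq> U" using open_contains_cyl U(2) by blast
      have "iso k y (flip n y)" if "y \<in> C \<inter> cyl x (max N1 (N k U))" "max N1 (N k U) \<le> n" for y n
      proof -
        have "y \<in> cyl x N1" using that(1) unfolding cyl_def by auto
        then have "y \<in> U - M k U" using N1 CM(3)[OF _ U(1)] that(1) by blast
        then show ?thesis using ok[OF U(1)] that(2) unfolding ok_def by auto
      qed
      then show ?thesis by blast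
    qed
  qed
qed

text \<open>The correction \<open>\<tau> j\<close> fixes all \<open>i \<le> j\<close> and their
  images under \<open>a j\<close>. The second makes each value \<open>a j i\<close> stabilise; the
  first makes each preimage stabilise, and so the limit is onto.\<close>

lemma limit_isoR:
  assumes iso: "\<And>j. isoR (a j) R (S j)" and a: "\<And>j. a (Suc j) = \<tau> j \<circ> a j"
    and \<tau>: "\<And>j i. i < K j \<Longrightarrow> \<tau> j i = i" and K: "\<And>i j. i \<le> j \<Longrightarrow> i < K j" "\<And>i j. i \<le> j \<Longrightarrow> a j i < K j"
    and lim: "\<And>r u. \<exists>J. \<forall>j\<ge>J. S j r u \<longleftrightarrow> T r u"
  shows "\<exists>\<pi>. isoR \<pi> R T"
proof -
  have bij: "bij (a j)" for j using iso isoR_def by blast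
  have stab: "a j i = a i i" if "i \<le> j" for i j
    using that
  proof (induction j rule: dec_induct)
    case (step j) then show ?case using a[of j] \<tau>[OF K(2)[of i j]] by simp
  qed simp
  define \<pi> where "\<pi> i = a i i" for i
  have \<pi>: "a j i = \<pi> i" if "i \<le> j" for i j using stab[OF that] by (simp add: \<pi>_def)
  have "inj \<pi>"
  proof (rule injI)
    fix i i' assume "\<pi> i = \<pi> i'"
    then have "a (max i i') i = a (max i i') i'" using \<pi> by simp
    then show "i = i'" using bij by (metis bij_pointE)
  qed
  moreover have "surj \<pi>"
  proof (rule surjI[of _ "\<lambda>i. inv (a i) i"])
    fix i
    define v where "v = inv (a i) i"
    have "a j v = i" if "i \<le> j" for j
      using that
    proof (induction j rule: dec_induct)
      case base then show ?case unfolding v_def using bij by (simp add: bij_is_surj surj_f_inv_f)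
    next
      case (step j) then show ?case using a[of j] \<tau>[OF K(1)[of i j]] by simp
    qed
    then have "a (max i v) v = i" by simp
    then show "\<pi> v = i" using \<pi>[of v "max i v"] by simp
  qed
  moreover have "R r u \<longleftrightarrow> T r (map \<pi> u)" for r u
  proof -
    obtain J where J: "\<forall>j\<ge>J. S j r (map \<pi> u) \<longleftrightarrow> T r (map \<pi> u)" using lim by blast
    define j where "j = Max (insert J (set u))"
    have "map (a j) u = map \<pi> u" using \<pi> by (auto simp: j_def)
    moreover have "J \<le> j" by (simp add: j_def)
    ultimately show ?thesis using iso[of j] J unfolding isoR_def by metis
  qed
  ultimately show ?thesis unfolding isoR_def bij_def by blast
qed

theorem generically_ergodic:
  obtains C :: "(nat \<Rightarrow> bool) set" where "meager (- C)" "\<And>x y. x \<in> C \<Longrightarrow> y \<in> C \<Longrightarrow> \<exists>\<pi>. isoR \<pi> (P x) (P y)"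
proof -
  obtain C W where C: "meager (- C)" "C = (\<Inter>m. W m)" and W: "\<And>m::nat. open (W m)"
    and C_flip: "\<And>x n. x \<in> C \<Longrightarrow> flip n x \<in> C"
    and C_cont: "\<And>r u b. \<exists>V. open V \<and> (\<forall>x\<in>C. (P x r u = b) \<longleftrightarrow> x \<in> V)"
    and C_good: "\<And>x k. x \<in> C \<Longrightarrow> \<exists>N. \<forall>y\<in>C \<inter> cyl x N. \<forall>n\<ge>N. iso k y (flip n y)"
    using good_comeager by blast
  define good where "good x N k \<longleftrightarrow> (\<forall>y\<in>C \<inter> cyl x N. \<forall>n\<ge>N. iso k y (flip n y))" for x N k
  have good_mono: "good x N' k" if "good x N k" "N \<le> N'" for x N N' k
    using that unfolding good_def cyl_def by auto
  \<comment> \<open>Coordinates from \<open>N\<close> on are corrected in increasing order.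
    Intermediate points agree with \<open>x\<close> below \<open>N\<close>, so goodness of
    \<open>x\<close> covers every flip.\<close>
  have move: "\<exists>x'\<in>C \<inter> cyl y N'. iso k x x'" if "x \<in> C" "y \<in> cyl x N" "good x N k" "N \<le> N'" for x y N N' k
    using that(4)
  proof (induction N' rule: dec_induct)
    case base
    have "x \<in> cyl y N" using that(2) by (auto simp: cyl_def)
    then show ?case using that(1) iso_refl by blast
  next
    case (step N')
    then obtain x' where x': "x' \<in> C" "x' \<in> cyl y N'" "iso k x x'" by blast
    show ?case
    proof (cases "x' N' = y N'")
      case True
      then have "x' \<in> cyl y (Suc N')" using x'(2) by (auto simp: cyl_def less_Suc_eq)
      then show ?thesis using x' by blast
    next
      case False
      then have "flip N' x' \<in> cyl y (Suc N')" using x'(2) by (auto simp: cyl_def flip_def less_Suc_eq)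
      moreover have "x' \<in> cyl x N" using x'(2) that(2) step(1) by (auto simp: cyl_def)
      then have "iso k x' (flip N' x')" using that(3) x'(1) step(1) unfolding good_def by blast
      ultimately show ?thesis using x' C_flip iso_trans by blast
    qed
  qed
  have main: "\<exists>\<pi>. isoR \<pi> (P x) (P y)" if xy: "x \<in> C" "y \<in> C" for x y
  proof -
    define bs where "bs m = (if even m then x else y)" for m :: nat
    \<comment> \<open>In a state, \<open>p\<close> is the point to be moved next and
      \<open>q\<close> the other one, reached by \<open>\<rho>\<close> and \<open>\<sigma>\<close>
      from their starting points \<open>bs m\<close> and \<open>bs (Suc m)\<close>. They agree below
      \<open>N\<close>, and the coming move of \<open>p\<close> will fix everything below
      \<open>K\<close>.\<close>
    define I where "I m s = (case s of (p, q, \<rho>, \<sigma>, N, K) \<Rightarrow> p \<in> C \<and> q \<in> C \<and> isoR \<rho> (P (bs m)) (P p) \<and>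
        isoR \<sigma> (P (bs (Suc m))) (P q) \<and> q \<in> cyl p N \<and> good p N K \<and> cyl p N \<subseteq> W m \<and> m \<le> N \<and>
        (\<forall>i\<le>m. i < K \<and> \<rho> i < K))"
      for m and s :: "(nat \<Rightarrow> bool) \<times> (nat \<Rightarrow> bool) \<times> (nat \<Rightarrow> nat) \<times> (nat \<Rightarrow> nat) \<times> nat \<times> nat"
    define Rl where "Rl s s' = (case s of (p, q, \<rho>, \<sigma>, N, K) \<Rightarrow> case s' of (p', q', \<rho>', \<sigma>', N', K') \<Rightarrow>
        p' = q \<and> \<rho>' = \<sigma> \<and> N \<le> N' \<and> (\<exists>\<tau>. (\<forall>i<K. \<tau> i = i) \<and> \<sigma>' = \<tau> \<circ> \<rho>))"
      for s s' :: "(nat \<Rightarrow> bool) \<times> (nat \<Rightarrow> bool) \<times> (nat \<Rightarrow> nat) \<times> (nat \<Rightarrow> nat) \<times> nat \<times> nat"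
    have start: "\<exists>s. I 0 s"
    proof -
      obtain N1 where N1: "good x N1 1" using C_good xy(1) unfolding good_def by blast
      have "x \<in> W 0" using xy C by blast
      then obtain N2 where N2: "cyl x N2 \<subseteq> W 0" using open_contains_cyl W by blast
      define N where "N = max N1 N2"
      have "cyl x N \<subseteq> cyl x N2" by (auto simp: N_def cyl_def)
      then have N: "good x N 1" "cyl x N \<subseteq> W 0" using good_mono N1 N2 by (auto simp: N_def)
      \<comment> \<open>For \<open>k = 0\<close> nothing has to be fixed, so invariance under a
        single flip is enough to bring \<open>y\<close> near \<open>x\<close>.\<close>
      have "good y 0 0" unfolding good_def
      proof (intro ballI allI impI)
        fix y' n
        have "summable (\<lambda>m. if y' m \<noteq> flip n y' m then t m else 0)"
          by (rule summable_finite[of "{n}"]) (auto simp: flip_def)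
        then show "iso 0 y' (flip n y')" using P_inv unfolding iso_def by simp
      qed
      then obtain q where q: "q \<in> C" "q \<in> cyl x N" "iso 0 y q"
        using move[of y x 0 0 N] xy by (auto simp: cyl_def)
      then obtain \<sigma> where "isoR \<sigma> (P y) (P q)" unfolding iso_def by blast
      then have "I 0 (x, q, id, \<sigma>, N, 1)" unfolding I_def using xy q N isoR_id by (simp add: bs_def)
      then show ?thesis by blast
    qed
    have step: "\<exists>s'. I (Suc m) s' \<and> Rl s s'" if "I m s" for m s
    proof -
      obtain p q \<rho> \<sigma> N K where s: "s = (p, q, \<rho>, \<sigma>, N, K)" using prod_cases6 by blast
      have h: "p \<in> C" "q \<in> C" "isoR \<rho> (P (bs m)) (P p)" "isoR \<sigma> (P (bs (Suc m))) (P q)" "q \<in> cyl p N"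
        "good p N K" "m \<le> N" using that unfolding s I_def by auto
      \<comment> \<open>\<open>q\<close> moves next, so the bound is taken over the arguments and
        values of \<open>\<sigma>\<close>, the isomorphism that the next correction must not
        disturb.\<close>
      define K' where "K' = Suc (Max ({..Suc m} \<union> \<sigma> ` {..Suc m}))"
      have K': "i < K' \<and> \<sigma> i < K'" if "i \<le> Suc m" for i
        using that unfolding K'_def less_Suc_eq_le by (auto intro!: Max_ge)
      obtain N1 where N1: "good q N1 K'" using C_good h(2) unfolding good_def by blast
      have "q \<in> W (Suc m)" using h C by blast
      then obtain N2 where N2: "cyl q N2 \<subseteq> W (Suc m)" using open_contains_cyl W by blast
      define N' where "N' = max (Suc N) (max N1 N2)"
      have "cyl q N' \<subseteq> cyl q N2" by (auto simp: N'_def cyl_def)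
      then have N': "good q N' K'" "cyl q N' \<subseteq> W (Suc m)" "Suc N \<le> N'"
        using good_mono[OF N1] N2 by (auto simp: N'_def)
      obtain p' where p': "p' \<in> C" "p' \<in> cyl q N'" "iso K p p'"
        using move[OF h(1,5,6), of N'] N'(3) by auto
      then obtain \<tau> where \<tau>: "isoR \<tau> (P p) (P p')" "\<forall>i<K. \<tau> i = i" unfolding iso_def by blast
      have "bs (Suc (Suc m)) = bs m" by (simp add: bs_def)
      then have "isoR (\<tau> \<circ> \<rho>) (P (bs (Suc (Suc m)))) (P p')" using isoR_comp[OF h(3) \<tau>(1)] by simp
      then have "I (Suc m) (q, p', \<sigma>, \<tau> \<circ> \<rho>, N', K')" unfolding I_def using h p' N' K' by auto
      moreover have "Rl s (q, p', \<sigma>, \<tau> \<circ> \<rho>, N', K')" unfolding Rl_def s using \<tau>(2) N'(3) by auto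
      ultimately show ?thesis by blast
    qed
    obtain s where s: "\<And>m. I m (s m)" "\<And>m. Rl (s m) (s (Suc m))"
      using dependent_nat_choice[of I "\<lambda>_. Rl", OF start step] by blast
    define p where "p m = fst (s m)" for m
    define q where "q m = fst (snd (s m))" for m
    define \<rho> where "\<rho> m = fst (snd (snd (s m)))" for m
    define \<sigma> where "\<sigma> m = fst (snd (snd (snd (s m))))" for m
    define N where "N m = fst (snd (snd (snd (snd (s m)))))" for m
    define K where "K m = snd (snd (snd (snd (snd (s m)))))" for m
    have sm: "s m = (p m, q m, \<rho> m, \<sigma> m, N m, K m)" for m
      by (simp add: p_def q_def \<rho>_def \<sigma>_def N_def K_def)
    have i: "p m \<in> C" "isoR (\<rho> m) (P (bs m)) (P (p m))" "q m \<in> cyl (p m) (N m)" "cyl (p m) (N m) \<subseteq> W m"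
        "m \<le> N m" "\<And>i. i \<le> m \<Longrightarrow> i < K m" "\<And>i. i \<le> m \<Longrightarrow> \<rho> m i < K m" for m
      using s(1)[of m] unfolding I_def sm by auto
    have r: "p (Suc m) = q m" "\<rho> (Suc m) = \<sigma> m" "N m \<le> N (Suc m)"
        "\<exists>\<tau>. (\<forall>i<K m. \<tau> i = i) \<and> \<sigma> (Suc m) = \<tau> \<circ> \<rho> m" for m
      using s(2)[of m] unfolding Rl_def sm by auto
    have "\<exists>\<tau>. (\<forall>i<K m. \<tau> i = i) \<and> \<rho> (Suc (Suc m)) = \<tau> \<circ> \<rho> m" for m
      using r(2)[of "Suc m"] r(4)[of m] by simp
    then obtain \<tau> where \<tau>: "\<And>m i. i < K m \<Longrightarrow> \<tau> m i = i" "\<And>m. \<rho> (Suc (Suc m)) = \<tau> m \<circ> \<rho> m" by metis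
    have Nmono: "N m \<le> N m'" if "m \<le> m'" for m m' using r(3) that by (rule lift_Suc_mono_le)
    have agree: "p m' \<in> cyl (p m) (N m)" if "m \<le> m'" for m m'
      using that
    proof (induction m' rule: dec_induct)
      case (step m')
      have "p (Suc m') \<in> cyl (p m') (N m')" using i(3)[of m'] r(1)[of m'] by simp
      then show ?case using step Nmono[of m m'] by (auto simp: cyl_def)
    qed simp
    \<comment> \<open>Since \<open>N m\<close> is at least \<open>m\<close>, coordinate
      \<open>n\<close> is settled from stage \<open>Suc n\<close> on.\<close>
    define z where "z n = p (Suc n) n" for n
    have zp: "z \<in> cyl (p m) (N m)" for m unfolding cyl_def
    proof clarify
      fix n assume n: "n < N m"
      have "p (max m (Suc n)) n = p m n" using agree[of m "max m (Suc n)"] n by (auto simp: cyl_def)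
      moreover have "p (max m (Suc n)) n = p (Suc n) n"
        using agree[of "Suc n" "max m (Suc n)"] i(5)[of "Suc n"] by (auto simp: cyl_def)
      ultimately show "z n = p m n" by (simp add: z_def)
    qed
    have zC: "z \<in> C" using zp i(4) C(2) by blast
    have lim: "\<exists>J. \<forall>j\<ge>J. P (p j) r u \<longleftrightarrow> P z r u" for r u
    proof -
      obtain V where V: "open V" "\<And>x. x \<in> C \<Longrightarrow> (P x r u = P z r u) \<longleftrightarrow> x \<in> V"
        using C_cont[of r u "P z r u"] by blast
      have "z \<in> V" using V(2)[OF zC] by simp
      then obtain J where J: "cyl z J \<subseteq> V" using open_contains_cyl V(1) by blast
      have "p j \<in> cyl z J" if "J \<le> j" for j
        using zp[of j] i(5)[of j] that by (auto simp: cyl_def)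
      then show ?thesis using J V(2)[OF i(1)] by blast
    qed
    have "\<exists>\<pi>. isoR \<pi> (P (bs b)) (P z)" if "b < 2" for b
    proof (rule limit_isoR[of "\<lambda>j. \<rho> (2*j+b)" _ "\<lambda>j. P (p (2*j+b))" "\<lambda>j. \<tau> (2*j+b)" "\<lambda>j. K (2*j+b)"])
      show "isoR (\<rho> (2*j+b)) (P (bs b)) (P (p (2*j+b)))" for j
        using i(2)[of "2*j+b"] by (simp add: bs_def)
      show "\<rho> (2 * Suc j + b) = \<tau> (2*j+b) \<circ> \<rho> (2*j+b)" for j using \<tau>(2)[of "2*j+b"] by simp
      show "\<exists>J. \<forall>j\<ge>J. P (p (2*j+b)) r u = P z r u" for r u
      proof -
        obtain J where "\<forall>j\<ge>J. P (p j) r u \<longleftrightarrow> P z r u" using lim by blast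
        then show ?thesis by (intro exI[of _ J]) auto
      qed
    qed (use \<tau>(1) i(6,7) in auto)
    from this[of 0] this[of 1] show ?thesis
      using isoR_comp isoR_inv unfolding bs_def by fastforce
  qed
  show ?thesis using that[OF C(1)] main by blast
qed

end

section \<open>Multipliers and *-homomorphisms\<close>

locale cstar =
  fixes sc :: "complex \<Rightarrow> 'a::{banach,real_normed_algebra} \<Rightarrow> 'a" and st :: "'a \<Rightarrow> 'a"
  assumes cstar_alg: "cstar_alg sc st"
begin

lemma sc_of_real: "sc (complex_of_real r) x = r *\<^sub>R x"
  and sc_add_right: "sc c (x + y) = sc c x + sc c y"
  and sc_add_left: "sc (c + d) x = sc c x + sc d x"
  and sc_sc: "sc c (sc d x) = sc (c * d) x"
  and norm_sc: "norm (sc c x) = cmod c * norm x"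
  and sc_mult_left: "sc c x * y = sc c (x * y)"
  and sc_mult_right: "x * sc c y = sc c (x * y)"
  and st_add: "st (x + y) = st x + st y"
  and st_sc: "st (sc c x) = sc (cnj c) (st x)"
  and st_st [simp]: "st (st x) = x"
  and st_mult: "st (x * y) = st y * st x"
  and norm_st_mult: "norm (st x * x) = (norm x)\<^sup>2"
  using cstar_alg unfolding cstar_alg_def by metis+

lemma sc_one [simp]: "sc 1 x = x" using sc_of_real[of 1 x] by simp
lemma sc_zero_left [simp]: "sc 0 x = 0" using sc_of_real[of 0 x] by simp
lemma sc_zero [simp]: "sc c 0 = 0" using sc_add_right[of c 0 0] by simp
lemma sc_minus_right: "sc c (- x) = - sc c x" using sc_add_right[of c x "- x"] by (simp add: add_eq_0_iff2)
lemma sc_minus_left: "sc (- c) x = - sc c x" using sc_add_left[of c "- c" x] by (simp add: add_eq_0_iff2)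
lemma sc_diff_right: "sc c (x - y) = sc c x - sc c y" using sc_add_right[of c x "- y"] by (simp add: sc_minus_right)
lemma sc_diff_left: "sc (c - d) x = sc c x - sc d x" using sc_add_left[of c "- d" x] by (simp add: sc_minus_left)
lemma st_zero [simp]: "st 0 = 0" using st_add[of 0 0] by simp
lemma st_minus: "st (- x) = - st x" using st_add[of x "- x"] by (simp add: add_eq_0_iff2)
lemma st_diff: "st (x - y) = st x - st y" using st_add[of x "- y"] by (simp add: st_minus)
lemma st_scaleR: "st (r *\<^sub>R x) = r *\<^sub>R st x"
  using st_sc[of "complex_of_real r" x] by (simp add: sc_of_real)
lemma sc_scaleR: "sc c (r *\<^sub>R x) = r *\<^sub>R sc c x"
  unfolding sc_of_real[symmetric] by (simp add: sc_sc mult.commute)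

lemma norm_st [simp]: "norm (st x) = norm x"
proof -
  have le: "norm y \<le> norm (st y)" for y
  proof (cases "norm y = 0")
    case False
    have "norm y * norm y \<le> norm (st y) * norm y"
      using norm_mult_ineq[of "st y" y] norm_st_mult[of y] by (simp add: power2_eq_square)
    then show ?thesis using False by simp
  qed simp
  show ?thesis using le[of x] le[of "st x"] by simp
qed

lemma bounded_linear_st: "bounded_linear st"
  by (rule bounded_linear_intro[of _ 1]) (auto simp: st_add st_scaleR)
lemma bounded_linear_sc: "bounded_linear (sc c)"
  by (rule bounded_linear_intro[of _ "cmod c"]) (auto simp: sc_add_right sc_scaleR norm_sc)

lemmas continuous_on_st [continuous_intros] = bounded_linear.continuous_on[OF bounded_linear_st]
lemmas tendsto_st [tendsto_intros] = bounded_linear.tendsto[OF bounded_linear_st]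
lemmas tendsto_sc [tendsto_intros] = bounded_linear.tendsto[OF bounded_linear_sc]

lemma eq_left: fixes x y :: 'a assumes "\<And>z. z * x = z * y" shows "x = y"
proof -
  have "st (x - y) * (x - y) = 0" using assms by (simp add: right_diff_distrib)
  then show ?thesis using norm_st_mult[of "x - y"] by simp
qed

lemma eq_right: fixes x y :: 'a assumes "\<And>z. x * z = y * z" shows "x = y"
proof -
  have "st x = st y" by (rule eq_left) (metis assms st_mult st_st)
  then show ?thesis by (metis st_st)
qed

text \<open>Multipliers of \<open>A\<close> are described by their left action together with that of the adjoint.\<close>

definition adjp :: "('a \<Rightarrow> 'a) \<Rightarrow> ('a \<Rightarrow> 'a) \<Rightarrow> bool" where
  "adjp L M \<longleftrightarrow> (\<forall>x y. st (L x) * y = st x * M y)"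

lemma adjp_sym: assumes "adjp L M" shows "adjp M L"
  unfolding adjp_def
proof (intro allI)
  fix x y
  have "st (st (L y) * x) = st (st y * M x)" using assms by (simp add: adjp_def)
  then show "st (M x) * y = st x * L y" by (simp add: st_mult)
qed

lemma adjp_eq: "adjp L M \<Longrightarrow> z * L x = st (M (st z)) * x"
  using adjp_sym[of L M] unfolding adjp_def by (metis st_st)

text \<open>A map with an adjoint is automatically linear: multiply by an arbitrary \<open>z\<close>
  on the left, move the map to \<open>z\<close>, and cancel by \<open>eq_left\<close>.\<close>

lemma adjp_add: assumes "adjp L M" shows "L (x + y) = L x + L y"
  by (rule eq_left) (simp add: adjp_eq[OF assms] distrib_left)
lemma adjp_sc: assumes "adjp L M" shows "L (sc c x) = sc c (L x)"
  by (rule eq_left) (simp add: adjp_eq[OF assms] sc_mult_right)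
lemma adjp_scaleR: assumes "adjp L M" shows "L (r *\<^sub>R x) = r *\<^sub>R L x"
  using adjp_sc[OF assms] by (metis sc_of_real)
lemma adjp_diff: assumes "adjp L M" shows "L (x - y) = L x - L y"
  by (rule eq_left) (simp add: adjp_eq[OF assms] right_diff_distrib)
lemma adjp_mult: assumes "adjp L M" shows "L (x * y) = L x * y"
  by (rule eq_left) (metis adjp_eq[OF assms] mult.assoc)

lemma adjp_id: "adjp (\<lambda>x. x) (\<lambda>x. x)" by (simp add: adjp_def)
lemma adjp_comp: "adjp L M \<Longrightarrow> adjp L' M' \<Longrightarrow> adjp (\<lambda>x. L (L' x)) (\<lambda>x. M' (M x))"
  by (simp add: adjp_def)
lemma adjp_plus: "adjp L M \<Longrightarrow> adjp L' M' \<Longrightarrow> adjp (\<lambda>x. L x + L' x) (\<lambda>x. M x + M' x)"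
  by (simp add: adjp_def st_add distrib_left distrib_right)
lemma adjp_smult: "adjp L M \<Longrightarrow> adjp (\<lambda>x. sc c (L x)) (\<lambda>x. sc (cnj c) (M x))"
  by (simp add: adjp_def st_sc sc_mult_left sc_mult_right)
lemma adjp_lmult: "adjp (\<lambda>x. a * x) (\<lambda>x. st a * x)"
  by (simp add: adjp_def st_mult mult.assoc)

lemma adjp_isometry: assumes "adjp L M" "M (L x) = x" shows "norm (L x) = norm x"
proof -
  have "st (L x) * L x = st x * x" using assms by (simp add: adjp_def)
  then have "(norm (L x))\<^sup>2 = (norm x)\<^sup>2" using norm_st_mult by metis
  then show ?thesis by simp
qed

text \<open>The multiplier \<open>1 - k - \<i>h\<close> is unitary, and \<open>h\<close> is its imaginary part.\<close>

lemma norm_sa_le_1: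
  assumes h: "st h = h" and k: "st k = k" and c: "h * k = k * h" and e: "h * h = 2 *\<^sub>R k - k * k"
  shows "norm h \<le> 1"
proof -
  \<comment> \<open>\<open>V\<close> is the multiplier 1 - k - ih and \<open>W\<close> its adjoint,
    written as left multiplications because \<open>A\<close> may lack a unit. The hypotheses say
    that (1-k)^2 + h^2 = 1 with commuting terms, hence both are unitary.\<close>
  define V where "V x = (x + sc (- 1) (k * x)) + sc (- \<i>) (h * x)" for x
  define W where "W x = (x + sc (- 1) (k * x)) + sc \<i> (h * x)" for x
  have VW: "adjp V W" unfolding V_def W_def
    using adjp_plus[OF adjp_plus[OF adjp_id adjp_smult[OF adjp_lmult[of k], of "-1"]] adjp_smult[OF adjp_lmult[of h], of "-\<i>"]]
    by (simp add: h k)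
  have hkx: "h * (k * x) = k * (h * x)" for x using c by (metis mult.assoc)
  have hhx: "h * (h * x) = (k * x + k * x) - k * (k * x)" for x
  proof -
    have "h * (h * x) = (2 *\<^sub>R k - k * k) * x" using e by (metis mult.assoc)
    then show ?thesis by (simp add: left_diff_distrib distrib_right mult.assoc scaleR_2)
  qed
  have i: "sc (-\<i>) y = - sc \<i> y" "sc (-1) y = - y" for y using sc_minus_left[of \<i> y] sc_minus_left[of 1 y] by auto
  have ii: "sc \<i> (sc \<i> y) = - y" for y by (simp add: sc_sc i)
  have WV: "W (V x) = x" "V (W x) = x" for x
    unfolding W_def V_def
    by (simp_all add: i distrib_left right_diff_distrib sc_add_right sc_diff_right sc_mult_right ii hkx hhx sc_minus_right algebra_simps)
  have nV: "norm (V x) = norm x" and nW: "norm (W x) = norm x" for x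
    using adjp_isometry[OF VW WV(1)] adjp_isometry[OF adjp_sym[OF VW] WV(2)] by auto
  \<comment> \<open>The difference of the two unitaries is 2ih; evaluated at \<open>h\<close> itself
    it bounds the norm of \<open>h * h\<close>, which is the square of the norm of
    \<open>h\<close>.\<close>
  have "sc (2 * \<i>) (h * h) = W h - V h"
    by (simp add: W_def V_def i) (metis mult_2 sc_add_left)
  then have "2 * norm (h * h) = norm (W h - V h)" using norm_sc[of "2 * \<i>" "h * h"] by (simp add: norm_mult)
  also have "\<dots> \<le> 2 * norm h" using norm_triangle_ineq4[of "W h" "V h"] by (simp add: nV nW)
  finally have "norm h * norm h \<le> norm h" using norm_st_mult[of h] h by (simp add: power2_eq_square)
  then show ?thesis by (cases "norm h = 0") auto
qed

definition subalg :: "'a set \<Rightarrow> bool" where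
  "subalg B \<longleftrightarrow> closed B \<and> 0 \<in> B \<and> (\<forall>x\<in>B. \<forall>y\<in>B. x + y \<in> B \<and> x * y \<in> B) \<and> (\<forall>x\<in>B. st x \<in> B \<and> (\<forall>r. r *\<^sub>R x \<in> B))"

text \<open>The element \<open>1 - k\<close> is the positive square root of \<open>1 - h\<^sup>2\<close>.\<close>

lemma sqrt_exists:
  assumes B: "subalg B" and hB: "h \<in> B" and h: "st h = h" "norm h < 1"
  obtains k where "k \<in> B" "st k = k" "h * k = k * h" "h * h = 2 *\<^sub>R k - k * k"
proof -
  define S where "S = {k\<in>B. norm k \<le> norm h \<and> st k = k \<and> h * k = k * h}"
  \<comment> \<open>The equation \<open>h * h = 2 *\<^sub>R k - k * k\<close> says that
    \<open>k\<close> is a fixed point of \<open>f\<close>, a contraction with constant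
    \<open>norm h\<close> on the ball of radius \<open>norm h\<close>.\<close>
  define f where "f k = (1/2) *\<^sub>R (h * h + k * k)" for k
  have "S = B \<inter> {k. norm k \<le> norm h} \<inter> {k. st k = k} \<inter> {k. h * k = k * h}" unfolding S_def by auto
  moreover have "closed {k. norm k \<le> norm h}" by (intro closed_Collect_le continuous_intros)
  moreover have "closed {k. st k = k}" by (intro closed_Collect_eq continuous_intros)
  moreover have "closed {k. h * k = k * h}" by (intro closed_Collect_eq continuous_intros)
  ultimately have "complete S" using B unfolding subalg_def by (auto intro!: closed_Int simp: complete_eq_closed)
  moreover have "0 \<in> S" using B unfolding S_def subalg_def by auto
  moreover have "f ` S \<subseteq> S"
  proof clarify
    fix k assume "k \<in> S"
    then have k: "k \<in> B" "norm k \<le> norm h" "st k = k" "h * k = k * h" by (auto simp: S_def)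
    have "f k \<in> B" using B k(1) hB unfolding f_def subalg_def by blast
    moreover have "norm (f k) \<le> norm h"
    proof -
      have "norm (h * h + k * k) \<le> norm h * norm h + norm k * norm k"
        by (intro order_trans[OF norm_triangle_ineq] add_mono norm_mult_ineq)
      also have "\<dots> \<le> norm h * 1 + norm h * 1" using k(2) h(2) by (intro add_mono mult_mono) auto
      finally show ?thesis by (simp add: f_def)
    qed
    moreover have "st (f k) = f k" using k h by (simp add: f_def st_scaleR st_add st_mult)
    moreover have "h * f k = f k * h" using k(4) unfolding f_def by (simp add: distrib_left distrib_right) (metis mult.assoc)
    ultimately show "f k \<in> S" by (simp add: S_def)
  qed
  moreover have "dist (f k) (f k') \<le> norm h * dist k k'" if "k \<in> S" "k' \<in> S" for k k'
  proof -
    have "f k - f k' = (1/2) *\<^sub>R ((k - k') * k + k' * (k - k'))"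
      by (simp add: f_def algebra_simps)
    then have "norm (f k - f k') \<le> 1/2 * (norm (k - k') * norm k + norm k' * norm (k - k'))"
      by (auto intro!: order_trans[OF norm_triangle_ineq] add_mono norm_mult_ineq)
    also have "\<dots> \<le> 1/2 * (norm (k - k') * norm h + norm h * norm (k - k'))"
      using that by (intro mult_left_mono add_mono mult_right_mono) (auto simp: S_def)
    finally show ?thesis by (simp add: dist_norm mult.commute)
  qed
  ultimately have "\<exists>!k\<in>S. f k = k" using h(2)
    by (intro Banach_fix[of _ "norm h"]) auto
  then obtain k where k: "k \<in> S" "f k = k" by blast
  have "2 *\<^sub>R f k = h * h + k * k" by (simp add: f_def)
  then have "h * h = 2 *\<^sub>R k - k * k" using k(2) by simp
  then show ?thesis using that k(1) by (auto simp: S_def)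
qed

text \<open>The relation between \<open>h\<close> and its partner \<open>k\<close> is algebraic, so
  \<open>F\<close> carries it over, and \<open>F h\<close> inherits the norm bound 1 after
  rescaling. The C*-identity passes from self-adjoint to general elements.\<close>

lemma star_hom_contractive:
  assumes B: "subalg B"
    and F: "\<And>x y. x \<in> B \<Longrightarrow> y \<in> B \<Longrightarrow> F (x + y) = F x + F y" "\<And>x y. x \<in> B \<Longrightarrow> y \<in> B \<Longrightarrow> F (x * y) = F x * F y"
      "\<And>x. x \<in> B \<Longrightarrow> F (st x) = st (F x)" "\<And>r x. x \<in> B \<Longrightarrow> F (r *\<^sub>R x) = r *\<^sub>R F x"
    and x: "x \<in> B"
  shows "norm (F x) \<le> norm x"
proof -
  have sa: "norm (F h) \<le> norm h" if h: "h \<in> B" "st h = h" for h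
  proof (rule field_le_epsilon)
    fix e :: real assume "e > 0"
    define c where "c = norm h + e"
    have c: "c > 0" using \<open>e > 0\<close> by (simp add: c_def add_nonneg_pos)
    define g where "g = (1/c) *\<^sub>R h"
    have g: "g \<in> B" "st g = g" "norm g < 1"
      using h B c \<open>e > 0\<close> by (auto simp: g_def subalg_def st_scaleR c_def)
    obtain k where k: "k \<in> B" "st k = k" "g * k = k * g" "g * g = 2 *\<^sub>R k - k * k"
      using sqrt_exists[OF B g] by blast
    have B': "g * g \<in> B" "k * k \<in> B" using B g(1) k(1) unfolding subalg_def by blast+
    have "F g * F g + F k * F k = F (g * g + k * k)" by (simp only: F(1)[OF B'] F(2)[OF g(1) g(1)] F(2)[OF k(1) k(1)])
    also have "g * g + k * k = 2 *\<^sub>R k" using k(4) by simp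
    finally have "F g * F g = 2 *\<^sub>R F k - F k * F k" using F(4)[OF k(1)] by (simp add: algebra_simps)
    moreover have "F g * F k = F k * F g" using F(2) g(1) k(1,3) by metis
    moreover have "st (F g) = F g" "st (F k) = F k" using F(3) g k by metis+
    ultimately have "norm (F g) \<le> 1" by (intro norm_sa_le_1)
    moreover have "F g = (1/c) *\<^sub>R F h" using F(4) h(1) by (simp add: g_def)
    ultimately show "norm (F h) \<le> norm h + e" using c by (simp add: c_def[symmetric] divide_simps)
  qed
  have sx: "st x \<in> B" "st x * x \<in> B" using B x unfolding subalg_def by blast+
  have "(norm (F x))\<^sup>2 = norm (F (st x * x))" using norm_st_mult[of "F x"] F(2,3) x sx by simp
  also have "\<dots> \<le> norm (st x * x)" by (rule sa) (auto simp: sx st_mult)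
  also have "\<dots> = (norm x)\<^sup>2" by (rule norm_st_mult)
  finally show ?thesis by (simp add: power2_le_iff_abs_le)
qed

lemma cstar_aut_contractive: assumes "cstar_aut sc st \<gamma>" shows "norm (\<gamma> x) \<le> norm x"
  by (rule star_hom_contractive[of UNIV])
    (use assms in \<open>auto simp: cstar_aut_def subalg_def sc_of_real[symmetric]\<close>)

section \<open>Inner automorphisms given by unitary multipliers\<close>

definition umul :: "('a \<Rightarrow> 'a) \<Rightarrow> ('a \<Rightarrow> 'a) \<Rightarrow> bool" where
  "umul L M \<longleftrightarrow> adjp L M \<and> (\<forall>x. M (L x) = x) \<and> (\<forall>x. L (M x) = x)"

definition Ad :: "('a \<Rightarrow> 'a) \<Rightarrow> 'a \<Rightarrow> 'a" where
  "Ad L x = L (st (L (st x)))"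

lemma umul_id: "umul (\<lambda>x. x) (\<lambda>x. x)" by (simp add: umul_def adjp_id)

lemma umul_comp: "umul L M \<Longrightarrow> umul L' M' \<Longrightarrow> umul (\<lambda>x. L (L' x)) (\<lambda>x. M' (M x))"
  unfolding umul_def using adjp_comp by auto

lemma umul_norm: "umul L M \<Longrightarrow> norm (L x) = norm x"
  unfolding umul_def using adjp_isometry by blast

lemma Ad_Inn: assumes "umul L M" shows "Ad L \<in> Inn sc st"
proof -
  have "double_centralizer L (\<lambda>x. st (M (st x)))"
    using assms adjp_eq unfolding double_centralizer_def umul_def by blast
  then have "unitary_multiplier st L"
    unfolding unitary_multiplier_def using assms by (intro exI[of _ "\<lambda>x. st (M (st x))"]) (auto simp: umul_def)
  then show ?thesis unfolding Inn_def Ad_def by blast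
qed

lemma right_mult: assumes "adjp L M" shows "st (L (st x)) * y = x * M y"
  using assms unfolding adjp_def by (metis st_st)

text \<open>Conjugating \<open>M\<close> with \<open>st\<close> gives right multiplication by its
  adjoint \<open>M'\<close>, so this is associativity of left and right multiplication.\<close>

lemma left_right_commute: assumes L: "adjp L L'" and M: "adjp M M'" shows "L (st (M (st x))) = st (M (st (L x)))"
proof (rule eq_right)
  fix b
  have "L (st (M (st x))) * b = L (st (M (st x)) * b)" by (simp add: adjp_mult[OF L])
  also have "\<dots> = L x * M' b" by (simp add: right_mult[OF M] adjp_mult[OF L])
  also have "\<dots> = st (M (st (L x))) * b" by (simp add: right_mult[OF M])
  finally show "L (st (M (st x))) * b = st (M (st (L x))) * b" .
qed

lemma Ad_comp: assumes "adjp L L'" "adjp M M'" shows "Ad (\<lambda>x. L (M x)) x = Ad L (Ad M x)"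
  unfolding Ad_def using left_right_commute[OF assms(2,1), of "st (M (st x))"] by simp

lemma Ad_id: "Ad (\<lambda>x. x) x = x" by (simp add: Ad_def)

lemma Ad_st: assumes "adjp L M" shows "Ad L (st x) = st (Ad L x)"
  unfolding Ad_def using left_right_commute[OF assms assms, of x] left_right_commute[OF assms assms, of "st x"] by simp

lemma Ad_aut: assumes u: "umul L M" shows "cstar_aut sc st (Ad L)"
proof -
  have a: "adjp L M" and i: "\<And>x. M (L x) = x" "\<And>x. L (M x) = x" using u by (auto simp: umul_def)
  have inv: "Ad L (Ad M x) = x" "Ad M (Ad L x) = x" for x
    using Ad_comp[OF a adjp_sym[OF a]] Ad_comp[OF adjp_sym[OF a] a] i by (simp_all add: Ad_id)
  have "bij (Ad L)" by (rule o_bij[of "Ad M"]) (auto simp: inv)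
  moreover have "Ad L (x * y) = Ad L x * Ad L y" for x y
  proof -
    have "Ad L (x * y) = L (x * st (L (st y)))" by (simp add: Ad_def st_mult adjp_mult[OF a])
    also have "\<dots> = L (st (L (st x)) * L (st (L (st y))))" by (simp add: right_mult[OF a] i)
    also have "\<dots> = Ad L x * Ad L y" by (simp add: Ad_def adjp_mult[OF a])
    finally show ?thesis .
  qed
  moreover have "Ad L (x + y) = Ad L x + Ad L y" for x y by (simp add: Ad_def st_add adjp_add[OF a])
  moreover have "Ad L (sc c x) = sc c (Ad L x)" for c x by (simp add: Ad_def st_sc adjp_sc[OF a])
  ultimately show ?thesis unfolding cstar_aut_def using Ad_st[OF a] by blast
qed

lemma norm_Ad_diff:
  assumes u: "umul L M" and e: "\<And>x. norm (L x - x) \<le> e * norm x"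
  shows "norm (Ad L x - x) \<le> 2 * e * norm x"
proof -
  have a: "adjp L M" using u by (simp add: umul_def)
  have "Ad L x - x = L (st (L (st x) - st x)) + (L x - x)"
    by (simp add: Ad_def st_diff adjp_diff[OF a])
  also have "norm \<dots> \<le> norm (L (st x) - st x) + norm (L x - x)"
    using norm_triangle_ineq[of "L (st (L (st x) - st x))" "L x - x"] umul_norm[OF u] by simp
  also have "\<dots> \<le> 2 * e * norm x" using e[of x] e[of "st x"] by simp
  finally show ?thesis .
qed

end

section \<open>Stable algebras as matrix algebras\<close>

lemma power_two_power_le_imp_le:
  fixes a b :: real
  assumes a: "0 \<le> a" and b: "0 < b" and le: "\<And>n. a ^ (2 ^ n) \<le> C * b ^ (2 ^ n)"
  shows "a \<le> b"
proof (rule ccontr)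
  assume "\<not> a \<le> b"
  then have q: "1 < a / b" using b by simp
  obtain m where m: "C < (a / b) ^ m" using real_arch_pow[OF q] by blast
  have "(a / b) ^ m \<le> (a / b) ^ (2 ^ m)" using q by (intro power_increasing) (auto simp: less_imp_le)
  also have "\<dots> \<le> C" using le[of m] b by (simp add: power_divide divide_simps)
  finally show False using m by simp
qed

lemma suminf_vanish:
  fixes f :: "nat \<Rightarrow> 'b::{comm_monoid_add, t2_space}"
  assumes "\<And>j. j \<ge> N \<Longrightarrow> f j = 0" shows "suminf f = (\<Sum>j<N. f j)"
  by (rule suminf_finite) (use assms in auto)

locale stable_cstar = cstar sc st
  for sc :: "complex \<Rightarrow> 'a::{banach,real_normed_algebra} \<Rightarrow> 'a" and st :: "'a \<Rightarrow> 'a" +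
  fixes \<phi> :: "'a \<Rightarrow> nat \<Rightarrow> nat \<Rightarrow> 'a"
  assumes \<phi>_bij: "bij_betw \<phi> UNIV (stab_model st)"
    and \<phi>_add: "\<phi> (x + y) = (\<lambda>i j. \<phi> x i j + \<phi> y i j)"
    and \<phi>_sc: "\<phi> (sc c x) = (\<lambda>i j. sc c (\<phi> x i j))"
    and \<phi>_mult: "\<phi> (x * y) = matmul (\<phi> x) (\<phi> y)"
    and \<phi>_st: "\<phi> (st x) = matstar st (\<phi> x)"
begin

definition \<psi> :: "(nat \<Rightarrow> nat \<Rightarrow> 'a) \<Rightarrow> 'a" where "\<psi> m = inv_into UNIV \<phi> m"

lemma \<phi>_\<psi>: "m \<in> stab_model st \<Longrightarrow> \<phi> (\<psi> m) = m"
  unfolding \<psi>_def using \<phi>_bij by (metis bij_betw_def f_inv_into_f)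

lemma \<phi>_eqI: assumes "\<And>i j. \<phi> x i j = \<phi> y i j" shows "x = y"
proof -
  have "\<phi> x = \<phi> y" using assms by blast
  then show ?thesis using \<phi>_bij unfolding bij_betw_def by (metis UNIV_I inj_onD)
qed

lemma \<phi>_scaleR: "\<phi> (r *\<^sub>R x) i j = r *\<^sub>R \<phi> x i j"
  using \<phi>_sc[of "complex_of_real r" x] by (simp add: sc_of_real)
lemma \<phi>_zero [simp]: "\<phi> 0 i j = 0" using \<phi>_scaleR[of 0 0] by simp
lemma \<phi>_diff: "\<phi> (x - y) i j = \<phi> x i j - \<phi> y i j"
proof -
  have "\<phi> x i j = \<phi> ((x - y) + y) i j" by simp
  also have "\<dots> = \<phi> (x - y) i j + \<phi> y i j" by (simp only: \<phi>_add)
  finally show ?thesis by simp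
qed
lemma \<phi>_sum: "\<phi> (sum f I) i j = (\<Sum>k\<in>I. \<phi> (f k) i j)"
  by (induction I rule: infinite_finite_induct) (auto simp: \<phi>_add)
lemma \<phi>_st_entry: "\<phi> (st x) i j = st (\<phi> x j i)" by (simp add: \<phi>_st matstar_def)

lemma \<phi>_mult_finite:
  assumes "\<And>k. N \<le> k \<Longrightarrow> \<phi> x i k = 0 \<or> \<phi> y k j = 0"
  shows "\<phi> (x * y) i j = (\<Sum>k<N. \<phi> x i k * \<phi> y k j)"
proof -
  have "\<phi> x i k * \<phi> y k j = 0" if "N \<le> k" for k using assms[OF that] by auto
  then show ?thesis unfolding \<phi>_mult matmul_def by (rule suminf_vanish)
qed

lemma \<phi>_mult_single:
  assumes "\<And>k. k \<noteq> l \<Longrightarrow> \<phi> x i k = 0 \<or> \<phi> y k j = 0"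
  shows "\<phi> (x * y) i j = \<phi> x i l * \<phi> y l j"
proof -
  have "\<phi> (x * y) i j = (\<Sum>k<Suc l. \<phi> x i k * \<phi> y k j)"
    by (rule \<phi>_mult_finite) (rule assms, simp)
  also have "\<dots> = (\<Sum>k\<in>{l}. \<phi> x i k * \<phi> y k j)"
  proof (rule sum.mono_neutral_right)
    show "\<forall>k\<in>{..<Suc l} - {l}. \<phi> x i k * \<phi> y k j = 0"
    proof
      fix k assume "k \<in> {..<Suc l} - {l}"
      then have "\<phi> x i k = 0 \<or> \<phi> y k j = 0" by (intro assms) auto
      then show "\<phi> x i k * \<phi> y k j = 0" by auto
    qed
  qed auto
  finally show ?thesis by simp
qed

lemma zero_HA: "(\<lambda>_. 0) \<in> HA st" "hnorm st (\<lambda>_. 0) = 0"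
  by (simp_all add: HA_def hnorm_def)

lemma finmat_stab_model: assumes "finmat m" shows "m \<in> stab_model st"
proof -
  have "{hnorm st (matvec (\<lambda>i j. 0) \<xi>) | \<xi>. \<xi> \<in> HA st \<and> hnorm st \<xi> \<le> 1} = {0}"
    using zero_HA by (auto simp: matvec_def intro!: exI[of _ "\<lambda>_. 0"])
  then have "matnorm st (\<lambda>i j. 0) = 0" by (simp add: matnorm_def)
  then show ?thesis unfolding stab_model_def using assms by (auto intro!: exI[of _ "\<lambda>_. m"])
qed

lemma \<phi>_\<psi>_fin: "finmat m \<Longrightarrow> \<phi> (\<psi> m) = m"
  using \<phi>_\<psi> finmat_stab_model by blast

definition E :: "nat \<Rightarrow> nat \<Rightarrow> 'a \<Rightarrow> 'a" where
  "E i j a = \<psi> (\<lambda>k l. if k = i \<and> l = j then a else 0)"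

lemma \<phi>_E: "\<phi> (E i j a) k l = (if k = i \<and> l = j then a else 0)"
proof -
  have "finmat (\<lambda>k l. if k = i \<and> l = j then a else 0)"
    unfolding finmat_def by (rule exI[of _ "Suc (i + j)"]) auto
  then show ?thesis unfolding E_def by (simp add: \<phi>_\<psi>_fin)
qed

lemma \<phi>_E_mult: "\<phi> (E i j a * x) k l = (if k = i then a * \<phi> x j l else 0)"
  by (subst \<phi>_mult_single[of j]) (auto simp: \<phi>_E)

lemma \<phi>_mult_E: "\<phi> (x * E i j a) k l = (if l = j then \<phi> x k i * a else 0)"
  by (subst \<phi>_mult_single[of i]) (auto simp: \<phi>_E)

lemma E_mult_E: "E i j a * E j l b = E i l (a * b)"
  by (rule \<phi>_eqI) (simp add: \<phi>_E_mult \<phi>_E)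

lemma st_E: "st (E i j a) = E j i (st a)"
  by (rule \<phi>_eqI) (auto simp: \<phi>_E \<phi>_st_entry)

lemma E_add: "E i j (a + b) = E i j a + E i j b"
  by (rule \<phi>_eqI) (simp add: \<phi>_E \<phi>_add)

lemma E_scaleR: "E i j (r *\<^sub>R a) = r *\<^sub>R E i j a"
  by (rule \<phi>_eqI) (simp add: \<phi>_E \<phi>_scaleR)

text \<open>The corner at \<open>(j, j)\<close> is an annihilator, hence closed, and \<open>E j j\<close> is a *-isomorphism onto it;
  so contractivity of *-homomorphisms applies in both directions.\<close>

lemma norm_E_diag: "norm (E j j a) = norm a"
proof (rule antisym)
  show "norm (E j j a) \<le> norm a"
  proof (rule star_hom_contractive[of UNIV])
    show "subalg UNIV" by (auto simp: subalg_def)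
  qed (auto simp: E_add E_scaleR E_mult_E st_E)
  define B where "B = {y. \<forall>i l. i \<noteq> j \<or> l \<noteq> j \<longrightarrow> \<phi> y i l = 0}"
  have "B = {y. (\<forall>i a. i \<noteq> j \<longrightarrow> E 0 i a * y = 0) \<and> (\<forall>l a. l \<noteq> j \<longrightarrow> y * E l 0 a = 0)}" (is "B = ?C")
  proof (intro set_eqI iffI)
    fix y assume "y \<in> B"
    then have y: "\<phi> y i l = 0" if "i \<noteq> j \<or> l \<noteq> j" for i l using that by (auto simp: B_def)
    have "E 0 i a * y = 0" if "i \<noteq> j" for i a by (rule \<phi>_eqI) (simp add: \<phi>_E_mult y that)
    moreover have "y * E l 0 a = 0" if "l \<noteq> j" for l a by (rule \<phi>_eqI) (simp add: \<phi>_mult_E y that)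
    ultimately show "y \<in> ?C" by blast
  next
    fix y assume y: "y \<in> ?C"
    have "\<phi> y i l = 0" if "i \<noteq> j" for i l
    proof (rule eq_left)
      fix z
      have "\<phi> (E 0 i z * y) 0 l = 0" using y that by simp
      then show "z * \<phi> y i l = z * 0" by (simp add: \<phi>_E_mult)
    qed
    moreover have "\<phi> y i l = 0" if "l \<noteq> j" for i l
    proof (rule eq_right)
      fix z
      have "\<phi> (y * E l 0 z) i 0 = 0" using y that by simp
      then show "\<phi> y i l * z = 0 * z" by (simp add: \<phi>_mult_E)
    qed
    ultimately show "y \<in> B" by (auto simp: B_def)
  qed
  \<comment> \<open>Only multiplication in \<open>A\<close> is known to be continuous here;
    continuity of the entries will be derived from the norms of the elements
    \<open>E i j a\<close>.\<close>
  moreover have "closed ?C"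
    by (intro closed_Collect_conj closed_Collect_all closed_Collect_imp closed_Collect_eq open_Collect_const continuous_intros)
  ultimately have "closed B" by simp
  have Bm: "\<phi> (x * y) i l = (if i = j \<and> l = j then \<phi> x j j * \<phi> y j j else 0)" if "x \<in> B" "y \<in> B" for x y i l
    using that by (subst \<phi>_mult_single[of j]) (auto simp: B_def)
  have "subalg B" unfolding subalg_def using \<open>closed B\<close> Bm
    by (auto simp: B_def \<phi>_add \<phi>_st_entry \<phi>_scaleR)
  then have "norm (\<phi> y j j) \<le> norm y" if "y \<in> B" for y
    by (rule star_hom_contractive[where F = "\<lambda>y. \<phi> y j j"]) (use that in \<open>auto simp: Bm \<phi>_add \<phi>_st_entry \<phi>_scaleR\<close>)
  from this[of "E j j a"] show "norm a \<le> norm (E j j a)" by (simp add: B_def \<phi>_E)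
qed

lemma norm_E: "norm (E i j a) = norm a"
proof -
  have "(norm (E i j a))\<^sup>2 = norm (E j j (st a * a))"
    using norm_st_mult[of "E i j a"] by (simp add: st_E E_mult_E)
  also have "\<dots> = (norm a)\<^sup>2" by (simp add: norm_E_diag norm_st_mult)
  finally show ?thesis by simp
qed

lemma norm_entry_le: "norm (\<phi> x i j) \<le> norm x"
proof (cases "\<phi> x i j = 0")
  case False
  define e where "e = \<phi> x i j"
  \<comment> \<open>\<open>b\<close> stands in for a unit when \<open>x\<close> is compressed to its
    entry \<open>e\<close>. The estimate becomes ||e||^4 <= ||e||^3 ||x||.\<close>
  define b where "b = st e * e"
  have "E j i (st e) * x * E j j b = E j j (b * b)"
    by (rule \<phi>_eqI) (auto simp: \<phi>_mult_E \<phi>_E_mult \<phi>_E b_def e_def mult.assoc)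
  then have "norm (b * b) \<le> norm (E j i (st e) * x) * norm b"
    using norm_mult_ineq[of "E j i (st e) * x" "E j j b"] by (simp add: norm_E)
  also have "\<dots> \<le> (norm e * norm x) * norm b"
    using norm_mult_ineq[of "E j i (st e)" x] by (intro mult_right_mono) (auto simp: norm_E)
  finally have "norm (b * b) \<le> norm e * norm x * norm b" .
  moreover have "norm (b * b) = norm b * norm b"
    using norm_st_mult[of b] by (simp add: b_def st_mult power2_eq_square)
  moreover have "norm b = norm e * norm e" using norm_st_mult[of e] by (simp add: b_def power2_eq_square)
  moreover have "norm e > 0" using False by (simp add: e_def)
  ultimately have "norm e * norm e * (norm e * norm e) \<le> norm e * norm x * (norm e * norm e)" by simp
  then have "norm e \<le> norm x" using \<open>norm e > 0\<close> by (simp add: mult_le_cancel_left mult_le_cancel_right)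
  then show ?thesis by (simp add: e_def)
qed simp

lemma tendsto_entry: assumes "(y \<longlongrightarrow> z) F" shows "((\<lambda>k. \<phi> (y k) i j) \<longlongrightarrow> \<phi> z i j) F"
proof -
  have "bounded_linear (\<lambda>x. \<phi> x i j)"
    by (rule bounded_linear_intro[of _ 1]) (auto simp: \<phi>_add \<phi>_scaleR norm_entry_le)
  then show ?thesis by (rule bounded_linear.tendsto[OF _ assms])
qed

section \<open>Columns, truncations and comparison with the matrix norm\<close>

definition col :: "nat \<Rightarrow> (nat \<Rightarrow> 'a) \<Rightarrow> 'a" where
  "col j \<xi> = \<psi> (\<lambda>k l. if l = j then \<xi> k else 0)"

definition supp_below :: "nat \<Rightarrow> (nat \<Rightarrow> 'a) \<Rightarrow> bool" where
  "supp_below N \<xi> \<longleftrightarrow> (\<forall>k\<ge>N. \<xi> k = 0)"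

lemma \<phi>_col: assumes "supp_below N \<xi>" shows "\<phi> (col j \<xi>) k l = (if l = j then \<xi> k else 0)"
proof -
  have "finmat (\<lambda>k l. if l = j then \<xi> k else 0)"
    unfolding finmat_def using assms by (intro exI[of _ "Suc (N + j)"]) (auto simp: supp_below_def)
  then show ?thesis unfolding col_def by (simp add: \<phi>_\<psi>_fin)
qed

lemma st_col_mult_col:
  assumes "supp_below N \<xi>" "supp_below M \<eta>"
  shows "st (col j \<xi>) * col j \<eta> = E j j (\<Sum>k<N. st (\<xi> k) * \<eta> k)"
proof (rule \<phi>_eqI)
  fix i l
  have "\<phi> (st (col j \<xi>) * col j \<eta>) i l = (\<Sum>k<N. \<phi> (st (col j \<xi>)) i k * \<phi> (col j \<eta>) k l)"
    using assms by (intro \<phi>_mult_finite) (auto simp: \<phi>_st_entry \<phi>_col supp_below_def)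
  also have "\<dots> = \<phi> (E j j (\<Sum>k<N. st (\<xi> k) * \<eta> k)) i l"
    by (auto simp: \<phi>_st_entry \<phi>_col[OF assms(1)] \<phi>_col[OF assms(2)] \<phi>_E)
  finally show "\<phi> (st (col j \<xi>) * col j \<eta>) i l = \<phi> (E j j (\<Sum>k<N. st (\<xi> k) * \<eta> k)) i l" .
qed

lemma norm_col: assumes "supp_below N \<xi>" shows "norm (col j \<xi>) = hnorm st \<xi>"
proof -
  have "(\<Sum>i. st (\<xi> i) * \<xi> i) = (\<Sum>k<N. st (\<xi> k) * \<xi> k)"
    using assms by (intro suminf_vanish) (auto simp: supp_below_def)
  moreover have "(norm (col j \<xi>))\<^sup>2 = norm (\<Sum>k<N. st (\<xi> k) * \<xi> k)"
    using norm_st_mult[of "col j \<xi>"] st_col_mult_col[OF assms assms] by (simp add: norm_E)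
  ultimately show ?thesis unfolding hnorm_def by (metis norm_ge_zero real_sqrt_unique)
qed

definition trunc :: "nat \<Rightarrow> (nat \<Rightarrow> 'a) \<Rightarrow> nat \<Rightarrow> 'a" where
  "trunc N \<xi> k = (if k < N then \<xi> k else 0)"

lemma supp_trunc: "supp_below N (trunc N \<xi>)" by (simp add: supp_below_def trunc_def)

lemma hnorm_trunc_sum: "(hnorm st (trunc N \<xi>))\<^sup>2 = norm (\<Sum>k<N. st (\<xi> k) * \<xi> k)"
proof -
  have "(\<Sum>i. st (trunc N \<xi> i) * trunc N \<xi> i) = (\<Sum>k<N. st (\<xi> k) * \<xi> k)"
    using suminf_vanish[of N "\<lambda>i. st (trunc N \<xi> i) * trunc N \<xi> i"] by (simp add: trunc_def)
  then show ?thesis by (simp add: hnorm_def)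
qed

text \<open>The shorter column \<open>c\<close> is cut out of the longer \<open>d\<close>, so
  \<open>st c * c = st c * d\<close>, and the C*-identity gives ||c||^2 <= ||c|| ||d||.\<close>

lemma hnorm_trunc_mono: assumes "N \<le> M" shows "hnorm st (trunc N \<xi>) \<le> hnorm st (trunc M \<xi>)"
proof -
  define c d where "c = col 0 (trunc N \<xi>)" and "d = col 0 (trunc M \<xi>)"
  have "st c * c = st c * d" unfolding c_def d_def st_col_mult_col[OF supp_trunc supp_trunc]
    using assms by (intro arg_cong[of _ _ "E 0 0"] sum.cong) (auto simp: trunc_def)
  then have "norm c * norm c \<le> norm c * norm d"
    using norm_mult_ineq[of "st c" d] norm_st_mult[of c] by (simp add: power2_eq_square)
  then have "norm c \<le> norm d" by (cases "norm c = 0") auto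
  then show ?thesis by (simp add: c_def d_def norm_col[OF supp_trunc])
qed

lemma hnorm_trunc_le: assumes "\<xi> \<in> HA st" shows "hnorm st (trunc N \<xi>) \<le> hnorm st \<xi>"
proof -
  have "(\<lambda>M. \<Sum>k<M. st (\<xi> k) * \<xi> k) \<longlonglongrightarrow> (\<Sum>k. st (\<xi> k) * \<xi> k)"
    using assms by (intro summable_LIMSEQ) (simp add: HA_def)
  then have "(\<lambda>M. norm (\<Sum>k<M. st (\<xi> k) * \<xi> k)) \<longlonglongrightarrow> (hnorm st \<xi>)\<^sup>2"
    by (simp add: hnorm_def tendsto_norm)
  moreover have "\<forall>\<^sub>F M in sequentially. (hnorm st (trunc N \<xi>))\<^sup>2 \<le> norm (\<Sum>k<M. st (\<xi> k) * \<xi> k)"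
    using eventually_ge_at_top[of N]
  proof eventually_elim
    case (elim M)
    have "0 \<le> hnorm st (trunc N \<xi>)" by (simp add: hnorm_def)
    then show ?case using hnorm_trunc_mono[OF elim, of \<xi>] unfolding hnorm_trunc_sum[of M, symmetric]
      by (intro power_mono)
  qed
  ultimately have "(hnorm st (trunc N \<xi>))\<^sup>2 \<le> (hnorm st \<xi>)\<^sup>2"
    by (intro tendsto_lowerbound) auto
  then show ?thesis by (rule power2_le_imp_le) (simp add: hnorm_def)
qed

definition fin_below :: "nat \<Rightarrow> 'a \<Rightarrow> bool" where
  "fin_below N x \<longleftrightarrow> (\<forall>i j. N \<le> i \<or> N \<le> j \<longrightarrow> \<phi> x i j = 0)"

lemma fin_below_mono: "fin_below N x \<Longrightarrow> N \<le> M \<Longrightarrow> fin_below M x"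
  unfolding fin_below_def by (meson order_trans)

lemma mult_col:
  assumes x: "fin_below N x" and \<xi>: "supp_below M \<xi>"
  shows "supp_below N (matvec (\<phi> x) \<xi>)" "x * col j \<xi> = col j (matvec (\<phi> x) \<xi>)"
proof -
  have mv: "matvec (\<phi> x) \<xi> i = (\<Sum>k<N. \<phi> x i k * \<xi> k)" for i
    unfolding matvec_def using x by (intro suminf_vanish) (auto simp: fin_below_def)
  show s: "supp_below N (matvec (\<phi> x) \<xi>)" unfolding supp_below_def mv using x by (auto simp: fin_below_def)
  show "x * col j \<xi> = col j (matvec (\<phi> x) \<xi>)"
  proof (rule \<phi>_eqI)
    fix i l
    have "\<phi> (x * col j \<xi>) i l = (\<Sum>k<N. \<phi> x i k * \<phi> (col j \<xi>) k l)"
      using x by (intro \<phi>_mult_finite) (auto simp: fin_below_def)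
    then show "\<phi> (x * col j \<xi>) i l = \<phi> (col j (matvec (\<phi> x) \<xi>)) i l"
      unfolding \<phi>_col[OF s] \<phi>_col[OF \<xi>] by (auto simp: mv)
  qed
qed

text \<open>This bounds the set whose supremum is \<open>matnorm\<close>; on an unbounded set of
  reals the supremum would carry no information.\<close>

lemma hnorm_matvec_le:
  assumes x: "fin_below N x" and \<xi>: "\<xi> \<in> HA st" "hnorm st \<xi> \<le> 1"
  shows "hnorm st (matvec (\<phi> x) \<xi>) \<le> norm x"
proof -
  have "\<phi> x i k * \<xi> k = \<phi> x i k * trunc N \<xi> k" for i k
    using x by (auto simp: fin_below_def trunc_def)
  then have eq: "matvec (\<phi> x) \<xi> = matvec (\<phi> x) (trunc N \<xi>)" by (simp add: matvec_def)
  have "hnorm st (matvec (\<phi> x) \<xi>) = norm (x * col 0 (trunc N \<xi>))"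
    unfolding eq mult_col(2)[OF x supp_trunc] norm_col[OF mult_col(1)[OF x supp_trunc]] ..
  also have "\<dots> \<le> norm x * norm (col 0 (trunc N \<xi>))" by (rule norm_mult_ineq)
  also have "\<dots> \<le> norm x * 1"
    using hnorm_trunc_le[OF \<xi>(1), of N] \<xi>(2) by (intro mult_left_mono) (auto simp: norm_col[OF supp_trunc])
  finally show ?thesis by simp
qed

lemma norm_mult_col_le:
  assumes x: "fin_below N x" and \<xi>: "supp_below M \<xi>"
  shows "norm (x * col j \<xi>) \<le> matnorm st (\<phi> x) * norm (col j \<xi>)"
proof (cases "col j \<xi> = 0")
  case False
  define r where "r = 1 / norm (col j \<xi>)"
  define \<eta> where "\<eta> k = r *\<^sub>R \<xi> k" for k
  have \<eta>: "supp_below M \<eta>" using \<xi> by (auto simp: \<eta>_def supp_below_def)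
  have c: "col j \<eta> = r *\<^sub>R col j \<xi>"
    by (rule \<phi>_eqI) (simp add: \<phi>_col[OF \<eta>] \<phi>_col[OF \<xi>] \<phi>_scaleR \<eta>_def)
  have r: "r > 0" "r * norm (col j \<xi>) = 1" using False by (auto simp: r_def)
  have "hnorm st \<eta> = 1" using norm_col[OF \<eta>, of j] r by (simp add: c)
  moreover have "st (\<eta> n) * \<eta> n = 0" if "n \<notin> {..<M}" for n using \<eta> that by (simp add: supp_below_def)
  then have "summable (\<lambda>n. st (\<eta> n) * \<eta> n)" by (intro summable_finite[of "{..<M}"]) auto
  then have "\<eta> \<in> HA st" by (simp add: HA_def)
  ultimately have "hnorm st (matvec (\<phi> x) \<eta>) \<le> matnorm st (\<phi> x)"
    unfolding matnorm_def using hnorm_matvec_le[OF x]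
    by (intro cSup_upper bdd_aboveI[of _ "norm x"]) auto
  then have "norm (x * col j \<eta>) \<le> matnorm st (\<phi> x)"
    unfolding mult_col(2)[OF x \<eta>] norm_col[OF mult_col(1)[OF x \<eta>]] .
  then have "r * norm (x * col j \<xi>) \<le> matnorm st (\<phi> x) * (r * norm (col j \<xi>))" using r by (simp add: c)
  then show ?thesis using r(1) by (simp add: mult.left_commute)
qed simp

text \<open>The matrix norm controls \<open>h = x\<^sup>* x\<close> only up to a constant depending on the size of the matrix;
  applying this to \<open>h\<^bsup>2\<^sup>n\<^esup>\<close>, whose norm is \<open>\<parallel>h\<parallel>\<^bsup>2\<^sup>n\<^esup>\<close>, removes the constant.\<close>

lemma norm_le_matnorm:
  assumes x: "fin_below N x" shows "norm x \<le> matnorm st (\<phi> x)"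
proof -
  define h where "h = st x * x"
  have st_h: "st h = h" by (simp add: h_def st_mult)
  have \<rho>: "0 \<le> matnorm st (\<phi> x)"
  proof -
    have "hnorm st (matvec (\<phi> x) (\<lambda>_. 0)) \<le> matnorm st (\<phi> x)"
      unfolding matnorm_def using hnorm_matvec_le[OF x] zero_HA
      by (intro cSup_upper bdd_aboveI[of _ "norm x"]) auto
    then show ?thesis by (simp add: matvec_def zero_HA)
  qed
  have "(norm x)\<^sup>2 \<le> norm x * matnorm st (\<phi> x)"
  proof (rule field_le_epsilon)
    fix e :: real assume e: "e > 0"
    \<comment> \<open>Adding \<open>e\<close> keeps \<open>q\<close> positive, as needed for the
      division in \<open>C\<close> and for comparing powers.\<close>
    define q where "q = norm x * matnorm st (\<phi> x) + e"
    have q: "q > 0" using e \<rho> by (simp add: q_def add_nonneg_pos)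
    define w where "w = rec_nat h (\<lambda>_ y. y * y)"
    have w0: "w 0 = h" and wS: "w (Suc n) = w n * w n" for n by (auto simp: w_def)
    have fin_mult: "fin_below N (y * z)" if "fin_below N y" "fin_below N z" for y z
      unfolding fin_below_def
    proof (intro allI impI)
      fix i j assume "N \<le> i \<or> N \<le> j"
      moreover have "\<phi> (y * z) i j = (\<Sum>k<N. \<phi> y i k * \<phi> z k j)"
        using that by (intro \<phi>_mult_finite) (auto simp: fin_below_def)
      ultimately show "\<phi> (y * z) i j = 0" using that by (auto simp: fin_below_def)
    qed
    have sx: "fin_below N (st x)" using x by (auto simp: fin_below_def \<phi>_st_entry)
    have fh: "fin_below N h" unfolding h_def by (rule fin_mult[OF sx x])
    have fw: "fin_below N (w n)" for n by (induction n) (auto simp: w0 wS fh fin_mult)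
    have sw: "st (w n) = w n" for n by (induction n) (auto simp: w0 wS st_h st_mult)
    have nw: "norm (w n) = norm h ^ (2 ^ n)" for n
    proof (induction n)
      case (Suc n)
      have "norm (w (Suc n)) = (norm (w n))\<^sup>2" using norm_st_mult[of "w n"] by (simp add: wS sw)
      then show ?case by (simp add: Suc.IH power_mult[symmetric] mult.commute)
    qed (simp add: w0)
    have col_bound: "norm (w n * col j \<xi>) \<le> q ^ (2 ^ n) * norm (col j \<xi>)" if "supp_below M \<xi>" for n j M \<xi>
      using that
    proof (induction n arbitrary: M \<xi>)
      case 0
      have "norm (w 0 * col j \<xi>) \<le> norm x * norm (x * col j \<xi>)"
        using norm_mult_ineq[of "st x" "x * col j \<xi>"] by (simp add: w0 h_def mult.assoc)
      also have "\<dots> \<le> norm x * (matnorm st (\<phi> x) * norm (col j \<xi>))"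
        by (intro mult_left_mono norm_mult_col_le[OF x 0]) auto
      also have "\<dots> \<le> q * norm (col j \<xi>)" using e by (simp add: q_def algebra_simps)
      finally show ?case by simp
    next
      case (Suc n)
      note m = mult_col[OF fw Suc.prems, of n]
      have "norm (w (Suc n) * col j \<xi>) = norm (w n * col j (matvec (\<phi> (w n)) \<xi>))"
        by (simp add: wS mult.assoc m(2))
      also have "\<dots> \<le> q ^ (2 ^ n) * norm (w n * col j \<xi>)" using Suc.IH[OF m(1)] by (simp add: m(2))
      also have "\<dots> \<le> q ^ (2 ^ n) * (q ^ (2 ^ n) * norm (col j \<xi>))"
        using q by (intro mult_left_mono Suc.IH[OF Suc.prems]) auto
      also have "\<dots> = q ^ (2 ^ Suc n) * norm (col j \<xi>)" by (simp add: mult.assoc[symmetric] power_add[symmetric] mult_2)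
      finally show ?case .
    qed
    \<comment> \<open>The sum of the column norms is the price of passing from columns to the whole
      matrix. The division by \<open>q\<close> adjusts the exponent, because \<open>w 0\<close> is
      already \<open>h\<close> and is matched with \<open>q ^ (2 ^ 0)\<close>.\<close>
    define C where "C = (\<Sum>j<N. norm (col j (\<lambda>k. \<phi> h k j))) / q"
    have wcol: "supp_below N (\<lambda>k. \<phi> (w n) k j)" for n j using fw[of n] by (auto simp: supp_below_def fin_below_def)
    have colw: "norm (col j (\<lambda>k. \<phi> (w n) k j)) \<le> q ^ (2 ^ n) * (norm (col j (\<lambda>k. \<phi> h k j)) / q)" for n j
    proof (induction n)
      case (Suc n)
      have mv: "matvec (\<phi> (w n)) (\<lambda>k. \<phi> (w n) k j) = (\<lambda>k. \<phi> (w (Suc n)) k j)"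
        by (simp add: matvec_def wS \<phi>_mult matmul_def)
      have "norm (col j (\<lambda>k. \<phi> (w (Suc n)) k j)) = norm (w n * col j (\<lambda>k. \<phi> (w n) k j))"
        by (simp add: mult_col(2)[OF fw wcol] mv)
      also have "\<dots> \<le> q ^ (2 ^ n) * norm (col j (\<lambda>k. \<phi> (w n) k j))" by (rule col_bound[OF wcol])
      also have "\<dots> \<le> q ^ (2 ^ n) * (q ^ (2 ^ n) * (norm (col j (\<lambda>k. \<phi> h k j)) / q))"
        using q Suc.IH by (intro mult_left_mono) auto
      also have "\<dots> = q ^ (2 ^ Suc n) * (norm (col j (\<lambda>k. \<phi> h k j)) / q)"
        by (simp add: mult.assoc[symmetric] power_add[symmetric] mult_2)
      finally show ?case .
    qed (use q in \<open>simp add: w0\<close>)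
    have "norm h ^ (2 ^ n) \<le> C * q ^ (2 ^ n)" for n
    proof -
      have "w n = (\<Sum>j<N. col j (\<lambda>k. \<phi> (w n) k j))"
      proof (rule \<phi>_eqI)
        fix i l
        have "\<phi> (\<Sum>j<N. col j (\<lambda>k. \<phi> (w n) k j)) i l = (\<Sum>j<N. if l = j then \<phi> (w n) i j else 0)"
          by (simp add: \<phi>_sum \<phi>_col[OF wcol])
        also have "\<dots> = \<phi> (w n) i l" using fw[of n] by (auto simp: fin_below_def)
        finally show "\<phi> (w n) i l = \<phi> (\<Sum>j<N. col j (\<lambda>k. \<phi> (w n) k j)) i l" by simp
      qed
      then have "norm (w n) \<le> (\<Sum>j<N. norm (col j (\<lambda>k. \<phi> (w n) k j)))" by (metis norm_sum)
      also have "\<dots> \<le> (\<Sum>j<N. q ^ (2 ^ n) * (norm (col j (\<lambda>k. \<phi> h k j)) / q))"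
        by (intro sum_mono colw)
      also have "\<dots> = C * q ^ (2 ^ n)" by (simp add: C_def sum_distrib_left[symmetric] sum_divide_distrib[symmetric] mult.commute)
      finally show ?thesis by (simp add: nw)
    qed
    then have "norm h \<le> q" by (rule power_two_power_le_imp_le[OF norm_ge_zero q])
    then show "(norm x)\<^sup>2 \<le> norm x * matnorm st (\<phi> x) + e" by (simp add: h_def norm_st_mult q_def)
  qed
  then show ?thesis using \<rho> by (cases "norm x = 0") (auto simp: power2_eq_square)
qed

text \<open>The model demands a Cauchy sequence for \<open>matnorm\<close>;
  \<open>norm_le_matnorm\<close> turns it into a Cauchy sequence of \<open>A\<close>, and continuity
  of the entries identifies its limit.\<close>

lemma finite_matrices_dense:
  obtains y N where "\<And>k::nat. fin_below (N k) (y k)" "y \<longlonglongrightarrow> x"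
proof -
  have "\<phi> x \<in> stab_model st" using \<phi>_bij unfolding bij_betw_def by blast
  then obtain ms where fin: "\<And>k. finmat (ms k)"
    and cau: "\<And>e. e > 0 \<Longrightarrow> \<exists>K. \<forall>k\<ge>K. \<forall>l\<ge>K. matnorm st (\<lambda>i j. ms k i j - ms l i j) < e"
    and lim: "\<And>i j. (\<lambda>k. ms k i j) \<longlonglongrightarrow> \<phi> x i j"
    unfolding stab_model_def by blast
  define y where "y k = \<psi> (ms k)" for k
  have \<phi>y: "\<phi> (y k) = ms k" for k by (simp add: y_def \<phi>_\<psi>_fin fin)
  obtain N where N: "\<And>k. fin_below (N k) (y k)" using fin unfolding finmat_def fin_below_def \<phi>y by metis
  have "Cauchy y" unfolding Cauchy_def
  proof (intro allI impI)
    fix e :: real assume "e > 0"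
    then obtain K where K: "\<forall>k\<ge>K. \<forall>l\<ge>K. matnorm st (\<lambda>i j. ms k i j - ms l i j) < e" using cau by blast
    have "dist (y k) (y l) < e" if "k \<ge> K" "l \<ge> K" for k l
    proof -
      have "fin_below (max (N k) (N l)) (y k - y l)"
        using N[of k] N[of l] unfolding fin_below_def by (auto simp: \<phi>_diff)
      then have "norm (y k - y l) \<le> matnorm st (\<phi> (y k - y l))" by (rule norm_le_matnorm)
      also have "\<phi> (y k - y l) = (\<lambda>i j. ms k i j - ms l i j)" by (intro ext) (simp add: \<phi>_diff \<phi>y)
      finally show ?thesis using K that by (force simp: dist_norm)
    qed
    then show "\<exists>K. \<forall>k\<ge>K. \<forall>l\<ge>K. dist (y k) (y l) < e" by blast
  qed
  then obtain z where z: "y \<longlonglongrightarrow> z" using Cauchy_convergent convergent_def by blast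
  have "x = z"
  proof (rule \<phi>_eqI)
    fix i j
    have "(\<lambda>k. \<phi> (y k) i j) \<longlonglongrightarrow> \<phi> z i j"
      using tendsto_entry[OF z] .
    then show "\<phi> x i j = \<phi> z i j" using lim[of i j] by (simp add: \<phi>y LIMSEQ_unique)
  qed
  then show ?thesis using that[of N y] N z by blast
qed

end

section \<open>Scalar unitaries on tensor factors\<close>

context stable_cstar begin

text \<open>That the permuted matrix again belongs to the model is the point. On finite matrices the
  map is self-adjoint with square the identity, hence isometric, so it carries approximating Cauchy
  sequences to Cauchy sequences.\<close>

lemma row_involution:
  fixes \<sigma> :: "nat \<Rightarrow> real" and \<pi> :: "nat \<Rightarrow> nat"
  assumes \<pi>: "\<And>i. \<pi> (\<pi> i) = i" and \<sigma>: "\<And>i. \<sigma> i * \<sigma> i = 1" "\<And>i. \<sigma> (\<pi> i) = \<sigma> i"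
  obtains T where "\<And>x i j. \<phi> (T x) i j = \<sigma> i *\<^sub>R \<phi> x (\<pi> i) j" "adjp T T"
proof -
  define T where "T x = \<psi> (\<lambda>i j. \<sigma> i *\<^sub>R \<phi> x (\<pi> i) j)" for x
  have bound: "\<exists>M. \<forall>i j. M \<le> i \<or> M \<le> j \<longrightarrow> \<sigma> i *\<^sub>R \<phi> x (\<pi> i) j = 0" if x: "fin_below N x" for x N
  proof (intro exI[of _ "N + Suc (Max (insert 0 (\<pi> ` {..<N})))"] allI impI)
    fix i j assume ij: "N + Suc (Max (insert 0 (\<pi> ` {..<N}))) \<le> i \<or> N + Suc (Max (insert 0 (\<pi> ` {..<N}))) \<le> j"
    have "N \<le> \<pi> i \<or> N \<le> j"
    proof (rule ccontr)
      assume c: "\<not> (N \<le> \<pi> i \<or> N \<le> j)"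
      then have "i \<in> \<pi> ` {..<N}" using \<pi>[of i] by (intro image_eqI[of _ _ "\<pi> i"]) auto
      then have "i \<le> Max (insert 0 (\<pi> ` {..<N}))" by (intro Max_ge) auto
      then show False using ij c by auto
    qed
    then show "\<sigma> i *\<^sub>R \<phi> x (\<pi> i) j = 0" using x unfolding fin_below_def by auto
  qed
  have fin: "\<phi> (T x) i j = \<sigma> i *\<^sub>R \<phi> x (\<pi> i) j" if x: "fin_below N x" for x N i j
  proof -
    have "finmat (\<lambda>i j. \<sigma> i *\<^sub>R \<phi> x (\<pi> i) j)" using bound[OF x] unfolding finmat_def .
    then show ?thesis unfolding T_def by (simp add: \<phi>_\<psi>_fin)
  qed
  have fin_adj: "st (T x) * y = st x * T y" if x: "fin_below N x" and y: "fin_below M y" for x y N M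
  proof (rule \<phi>_eqI)
    fix i j
    \<comment> \<open>A finite set of indices that contains both supports and is closed under
      \<open>\<pi>\<close>, so that the sum can be reindexed by \<open>\<pi>\<close>.\<close>
    define K where "K = {..<max N M} \<union> \<pi> ` {..<max N M}"
    have K: "finite K" "\<And>k. k \<in> K \<Longrightarrow> \<pi> k \<in> K" unfolding K_def using \<pi> by auto
    have out: "\<phi> x k l = 0" "\<phi> y k l = 0" "\<phi> x (\<pi> k) l = 0" "\<phi> y (\<pi> k) l = 0" if "k \<notin> K" for k l
    proof -
      have "k \<ge> max N M" using that unfolding K_def by auto
      moreover have "\<pi> k \<ge> max N M"
      proof (rule ccontr)
        assume "\<not> \<pi> k \<ge> max N M"
        then have "k \<in> \<pi> ` {..<max N M}" using \<pi>[of k] by (intro image_eqI[of _ _ "\<pi> k"]) auto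
        then show False using that by (simp add: K_def)
      qed
      ultimately show "\<phi> x k l = 0" "\<phi> y k l = 0" "\<phi> x (\<pi> k) l = 0" "\<phi> y (\<pi> k) l = 0"
        using x y by (auto simp: fin_below_def)
    qed
    have "\<phi> (st (T x) * y) i j = (\<Sum>k\<in>K. \<phi> (st (T x)) i k * \<phi> y k j)"
      unfolding \<phi>_mult matmul_def using out by (intro suminf_finite K) auto
    also have "\<dots> = (\<Sum>k\<in>K. \<phi> (st x) i k * \<phi> (T y) k j)"
      by (rule sum.reindex_bij_witness[of _ \<pi> \<pi>])
        (auto simp: K \<pi> \<phi>_st_entry fin[OF x] fin[OF y] st_scaleR \<sigma>)
    also have "\<dots> = \<phi> (st x * T y) i j"
      unfolding \<phi>_mult matmul_def using out by (intro suminf_finite[symmetric] K) (auto simp: \<phi>_st_entry)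
    finally show "\<phi> (st (T x) * y) i j = \<phi> (st x * T y) i j" .
  qed
  have fin_T: "\<exists>M. fin_below M (T x)" if x: "fin_below N x" for x N
    using bound[OF x] unfolding fin_below_def fin[OF x] .
  have fin_norm: "norm (T x) = norm x" if x: "fin_below N x" for x N
  proof -
    obtain M where M: "fin_below M (T x)" using fin_T[OF x] by blast
    have "T (T x) = x" by (rule \<phi>_eqI) (simp add: fin[OF M] fin[OF x] \<pi> \<sigma>)
    then have "(norm (T x))\<^sup>2 = (norm x)\<^sup>2" using fin_adj[OF x M] norm_st_mult by metis
    then show ?thesis by simp
  qed
  have fin_diff: "T x - T y = T (x - y)" "fin_below (max N M) (x - y)"
    if x: "fin_below N x" and y: "fin_below M y" for x y N M
  proof -
    show f: "fin_below (max N M) (x - y)" using x y by (auto simp: fin_below_def \<phi>_diff)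
    show "T x - T y = T (x - y)"
      by (rule \<phi>_eqI) (simp add: fin[OF f] fin[OF x] fin[OF y] \<phi>_diff scaleR_diff_right)
  qed
  have conv: "(\<forall>i j. \<phi> (T x) i j = \<sigma> i *\<^sub>R \<phi> x (\<pi> i) j) \<and> (\<lambda>k. T (y k)) \<longlonglongrightarrow> T x"
    if y: "\<And>k. fin_below (N k) (y k)" "y \<longlonglongrightarrow> x" for x y and N :: "nat \<Rightarrow> nat"
  proof -
    have "Cauchy y" using y(2) LIMSEQ_imp_Cauchy by blast
    moreover have "dist (T (y k)) (T (y l)) = dist (y k) (y l)" for k l
      unfolding dist_norm fin_diff(1)[OF y(1) y(1)] fin_norm[OF fin_diff(2)[OF y(1) y(1)]] ..
    ultimately have "Cauchy (\<lambda>k. T (y k))" by (simp add: Cauchy_def)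
    then obtain z where z: "(\<lambda>k. T (y k)) \<longlonglongrightarrow> z" using Cauchy_convergent convergent_def by blast
    have zij: "\<phi> z i j = \<sigma> i *\<^sub>R \<phi> x (\<pi> i) j" for i j
    proof (rule LIMSEQ_unique[OF tendsto_entry[OF z]])
      show "(\<lambda>k. \<phi> (T (y k)) i j) \<longlonglongrightarrow> \<sigma> i *\<^sub>R \<phi> x (\<pi> i) j"
        unfolding fin[OF y(1)] by (intro tendsto_intros tendsto_entry y)
    qed
    have "T x = \<psi> (\<phi> z)" unfolding T_def zij[symmetric] by simp
    also have "\<dots> = z" unfolding \<psi>_def using \<phi>_bij by (simp add: bij_betw_def)
    finally show ?thesis using z zij by simp
  qed
  show ?thesis
  proof (rule that)
    show "\<phi> (T x) i j = \<sigma> i *\<^sub>R \<phi> x (\<pi> i) j" for x i j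
      using finite_matrices_dense[of x] conv by metis
    show "adjp T T" unfolding adjp_def
    proof (intro allI)
      fix x y
      obtain N x' where x': "\<And>k. fin_below (N k) (x' k)" "x' \<longlonglongrightarrow> x" using finite_matrices_dense by blast
      obtain M y' where y': "\<And>k. fin_below (M k) (y' k)" "y' \<longlonglongrightarrow> y" using finite_matrices_dense by blast
      have "(\<lambda>k. st (T (x' k)) * y' k) \<longlonglongrightarrow> st (T x) * y"
        using conv[OF x'] y' by (intro tendsto_intros) auto
      moreover have "(\<lambda>k. st (T (x' k)) * y' k) \<longlonglongrightarrow> st x * T y"
        unfolding fin_adj[OF x'(1) y'(1)] using conv[OF y'] x' by (intro tendsto_intros) auto
      ultimately show "st (T x) * y = st x * T y" by (rule LIMSEQ_unique)
    qed
  qed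
qed

text \<open>Reading the row index in binary identifies the row space with an infinite tensor product of copies
  of the plane; \<open>S n\<close> and \<open>F n\<close> are the Pauli matrices \<open>diag(1, - 1)\<close> and \<open>antidiag(1, 1)\<close> on the factor \<open>n\<close>.\<close>

definition S :: "nat \<Rightarrow> 'a \<Rightarrow> 'a" where
  "S n = (SOME T. (\<forall>x i j. \<phi> (T x) i j = (if bit i n then - 1 else 1::real) *\<^sub>R \<phi> x i j) \<and> adjp T T)"

definition F :: "nat \<Rightarrow> 'a \<Rightarrow> 'a" where
  "F n = (SOME T. (\<forall>x i j. \<phi> (T x) i j = \<phi> x (flip_bit n i) j) \<and> adjp T T)"

lemma bit_flip: "bit (flip_bit n (i::nat)) m \<longleftrightarrow> (if m = n then \<not> bit i m else bit i m)"
  by (auto simp: bit_flip_bit_iff)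

lemma flip_bit_flip_bit [simp]: "flip_bit n (flip_bit n (i::nat)) = i"
  by (rule bit_eqI) (simp add: bit_flip)

lemma flip_bit_commute: "flip_bit n (flip_bit m (i::nat)) = flip_bit m (flip_bit n i)"
  by (rule bit_eqI) (simp add: bit_flip)

lemma S_props: "(\<forall>x i j. \<phi> (S n x) i j = (if bit i n then - 1 else 1::real) *\<^sub>R \<phi> x i j) \<and> adjp (S n) (S n)"
proof -
  have "\<exists>T. (\<forall>x i j. \<phi> (T x) i j = (if bit i n then - 1 else 1::real) *\<^sub>R \<phi> x i j) \<and> adjp T T"
    by (rule row_involution[of "\<lambda>i. i" "\<lambda>i. if bit i n then - 1 else 1"]) (simp, simp, simp, blast)
  from someI_ex[OF this] show ?thesis unfolding S_def .
qed

lemma F_props: "(\<forall>x i j. \<phi> (F n x) i j = \<phi> x (flip_bit n i) j) \<and> adjp (F n) (F n)"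
proof -
  have "\<exists>T. (\<forall>x i j. \<phi> (T x) i j = \<phi> x (flip_bit n i) j) \<and> adjp T T"
    by (rule row_involution[of "flip_bit n" "\<lambda>i. 1"]) (simp, simp, simp, metis scaleR_one)
  from someI_ex[OF this] show ?thesis unfolding F_def .
qed

lemma \<phi>_S: "\<phi> (S n x) i j = (if bit i n then - \<phi> x i j else \<phi> x i j)"
  using S_props[of n] by simp
lemma \<phi>_F: "\<phi> (F n x) i j = \<phi> x (flip_bit n i) j"
  using F_props[of n] by simp
lemma adjp_S: "adjp (S n) (S n)" and adjp_F: "adjp (F n) (F n)"
  using S_props F_props by blast+

lemma S_S [simp]: "S n (S n x) = x" by (rule \<phi>_eqI) (simp add: \<phi>_S)
lemma F_F [simp]: "F n (F n x) = x" by (rule \<phi>_eqI) (simp add: \<phi>_F)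
lemma \<phi>_minus: "\<phi> (- y) i j = - \<phi> y i j" using \<phi>_diff[of 0 y] by simp
lemma S_F: "S n (F n x) = - F n (S n x)" by (rule \<phi>_eqI) (simp add: \<phi>_S \<phi>_F \<phi>_minus bit_flip)
lemma S_S_commute: "S n (S m x) = S m (S n x)" by (rule \<phi>_eqI) (simp add: \<phi>_S)
lemma F_F_commute: "F n (F m x) = F m (F n x)" by (rule \<phi>_eqI) (simp add: \<phi>_F flip_bit_commute)
lemma S_F_commute: "n \<noteq> m \<Longrightarrow> S n (F m x) = F m (S n x)"
  by (rule \<phi>_eqI) (simp add: \<phi>_S \<phi>_F bit_flip)

lemma adjp_scaleR_op: assumes "adjp L M" shows "adjp (\<lambda>x. r *\<^sub>R L x) (\<lambda>x. r *\<^sub>R M x)"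
  using adjp_smult[OF assms, of "complex_of_real r"] by (simp add: sc_of_real)

text \<open>On factor \<open>n\<close> this is the reflection of the plane in the line of angle
  \<theta>/2, whereas \<open>Ro n \<theta>\<close> is the rotation through \<theta>. Hence rotating
  by \<theta> raises the parameter of a reflection by 2\<theta>.\<close>

definition Rf :: "nat \<Rightarrow> real \<Rightarrow> 'a \<Rightarrow> 'a" where
  "Rf n \<theta> x = cos \<theta> *\<^sub>R S n x + sin \<theta> *\<^sub>R F n x"

definition Ro :: "nat \<Rightarrow> real \<Rightarrow> 'a \<Rightarrow> 'a" where
  "Ro n \<theta> x = cos \<theta> *\<^sub>R x + sin \<theta> *\<^sub>R F n (S n x)"

lemmas S_lin = adjp_add[OF adjp_S] adjp_scaleR[OF adjp_S] adjp_diff[OF adjp_S] adjp_sc[OF adjp_S]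
lemmas F_lin = adjp_add[OF adjp_F] adjp_scaleR[OF adjp_F] adjp_diff[OF adjp_F] adjp_sc[OF adjp_F]

lemma F_minus: "F n (- x) = - F n x" using F_lin(2)[of n "- 1" x] by simp
lemma S_minus: "S n (- x) = - S n x" using S_lin(2)[of n "- 1" x] by simp

lemma adjp_Rf: "adjp (Rf n \<theta>) (Rf n \<theta>)"
  unfolding Rf_def[abs_def] by (intro adjp_plus adjp_scaleR_op adjp_S adjp_F)

lemma Rf_Rf [simp]: "Rf n \<theta> (Rf n \<theta> x) = x"
proof -
  have "Rf n \<theta> (Rf n \<theta> x) = (cos \<theta> * cos \<theta>) *\<^sub>R x + (sin \<theta> * sin \<theta>) *\<^sub>R x"
    by (simp add: Rf_def S_lin F_lin S_F scaleR_add_left scaleR_add_right algebra_simps)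
  also have "\<dots> = (cos \<theta> * cos \<theta> + sin \<theta> * sin \<theta>) *\<^sub>R x" by (simp only: scaleR_add_left)
  finally show ?thesis by simp
qed

lemma adjp_Ro: "adjp (Ro n \<theta>) (Ro n (- \<theta>))"
proof -
  have "adjp (\<lambda>x. cos \<theta> *\<^sub>R x + sin \<theta> *\<^sub>R F n (S n x)) (\<lambda>x. cos \<theta> *\<^sub>R x + sin \<theta> *\<^sub>R S n (F n x))"
    by (intro adjp_plus adjp_scaleR_op adjp_id adjp_comp[OF adjp_F adjp_S])
  then show ?thesis by (simp add: Ro_def[abs_def] S_F)
qed

lemma Ro_Ro: "Ro n \<theta> (Ro n (- \<theta>) x) = x"
proof -
  have "Ro n \<theta> (Ro n (- \<theta>) x) = (cos \<theta> * cos \<theta>) *\<^sub>R x + (sin \<theta> * sin \<theta>) *\<^sub>R x"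
    by (simp add: Ro_def S_lin F_lin S_F F_minus S_minus scaleR_add_left scaleR_add_right algebra_simps)
  also have "\<dots> = (cos \<theta> * cos \<theta> + sin \<theta> * sin \<theta>) *\<^sub>R x" by (simp only: scaleR_add_left)
  finally show ?thesis by simp
qed

lemma umul_Ro: "umul (Ro n \<theta>) (Ro n (- \<theta>))"
  unfolding umul_def using adjp_Ro Ro_Ro[of n \<theta>] Ro_Ro[of n "- \<theta>"] by simp

lemma Ro_Rf: "Ro n \<theta> (Rf n \<eta> x) = Rf n (\<eta> + 2 * \<theta>) (Ro n \<theta> x)"
proof -
  have l: "Ro n \<theta> (Rf n \<eta> x) = Rf n (\<eta> + \<theta>) x"
    by (simp add: Ro_def Rf_def S_lin F_lin S_F F_minus cos_add sin_add algebra_simps)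
  have "Rf n \<zeta> (Ro n \<theta> x) = Rf n (\<zeta> - \<theta>) x" for \<zeta>
    by (simp add: Ro_def Rf_def S_lin F_lin S_F F_minus cos_diff sin_diff algebra_simps)
  then show ?thesis using l by (simp add: add.commute)
qed

lemma Rf_Rf_commute: "n \<noteq> m \<Longrightarrow> Rf n \<theta> (Rf m \<eta> x) = Rf m \<eta> (Rf n \<theta> x)"
  by (simp add: Rf_def S_lin F_lin S_S_commute[of n m] F_F_commute[of n m] S_F_commute[of n m] S_F_commute[of m n] algebra_simps)

lemma Ro_Rf_commute: "n \<noteq> m \<Longrightarrow> Ro n \<theta> (Rf m \<eta> x) = Rf m \<eta> (Ro n \<theta> x)"
  by (simp add: Ro_def Rf_def S_lin F_lin S_S_commute[of n m] F_F_commute[of n m] S_F_commute[of n m] S_F_commute[of m n] algebra_simps)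

lemma Ro_Ro_commute: "n \<noteq> m \<Longrightarrow> Ro n \<theta> (Ro m \<eta> x) = Ro m \<eta> (Ro n \<theta> x)"
  by (simp add: Ro_def S_lin F_lin S_S_commute[of n m] F_F_commute[of n m] S_F_commute[of n m] S_F_commute[of m n] algebra_simps)

lemma norm_Ro_diff: "norm (Ro n \<theta> x - x) \<le> 2 * \<bar>\<theta>\<bar> * norm x"
proof -
  have "Ro n \<theta> x - x = (cos \<theta> - 1) *\<^sub>R x + sin \<theta> *\<^sub>R F n (S n x)"
    by (simp add: Ro_def algebra_simps)
  also have "norm \<dots> \<le> \<bar>cos \<theta> - 1\<bar> * norm x + \<bar>sin \<theta>\<bar> * norm (F n (S n x))"
    by (rule order_trans[OF norm_triangle_ineq]) simp
  also have "norm (F n (S n x)) = norm x"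
    by (simp add: adjp_isometry[OF adjp_F] adjp_isometry[OF adjp_S])
  also have "\<bar>cos \<theta> - 1\<bar> * norm x + \<bar>sin \<theta>\<bar> * norm x \<le> \<bar>\<theta>\<bar> * norm x + \<bar>\<theta>\<bar> * norm x"
  proof (intro add_mono mult_right_mono norm_ge_zero)
    have "cos \<theta> - 1 = - 2 * (sin (\<theta>/2) * sin (\<theta>/2))"
      using cos_double_sin[of "\<theta>/2"] by (simp add: power2_eq_square)
    then have "\<bar>cos \<theta> - 1\<bar> = 2 * (\<bar>sin (\<theta>/2)\<bar> * \<bar>sin (\<theta>/2)\<bar>)" by (simp add: abs_mult)
    also have "\<dots> \<le> 2 * (\<bar>\<theta>/2\<bar> * 1)"
      by (intro mult_left_mono mult_mono abs_sin_x_le_abs_x abs_sin_le_one) auto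
    finally show "\<bar>cos \<theta> - 1\<bar> \<le> \<bar>\<theta>\<bar>" by simp
    show "\<bar>sin \<theta>\<bar> \<le> \<bar>\<theta>\<bar>" by (rule abs_sin_x_le_abs_x)
  qed
  finally show ?thesis by simp
qed

text \<open>The unitary with eigenvalues \<open>1\<close> and \<open>l\<close> whose spectral symmetry is \<open>Rf n \<theta>\<close>.\<close>

definition W :: "nat \<Rightarrow> real \<Rightarrow> complex \<Rightarrow> 'a \<Rightarrow> 'a" where
  "W n \<theta> l x = sc ((1 + l) / 2) x + sc ((1 - l) / 2) (Rf n \<theta> x)"

lemma W_one [simp]: "W n \<theta> 1 x = x" by (simp add: W_def)
lemma W_minus_one: "W n \<theta> (- 1) x = Rf n \<theta> x" by (simp add: W_def)

lemmas Rf_lin = adjp_add[OF adjp_Rf] adjp_sc[OF adjp_Rf] adjp_scaleR[OF adjp_Rf]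

lemma W_W: "W n \<theta> l (W n \<theta> m x) = W n \<theta> (l * m) x"
proof -
  have "W n \<theta> l (W n \<theta> m x) = sc ((1+l)/2 * ((1+m)/2) + (1-l)/2 * ((1-m)/2)) x
      + sc ((1+l)/2 * ((1-m)/2) + (1-l)/2 * ((1+m)/2)) (Rf n \<theta> x)"
    by (simp add: W_def Rf_lin sc_add_right sc_sc sc_add_left add.assoc add.left_commute)
  also have "(1+l)/2 * ((1+m)/2) + (1-l)/2 * ((1-m)/2) = (1 + l * m) / 2" by (simp add: field_simps)
  also have "(1+l)/2 * ((1-m)/2) + (1-l)/2 * ((1+m)/2) = (1 - l * m) / 2" by (simp add: field_simps)
  finally show ?thesis by (simp add: W_def)
qed

lemma umul_W: assumes "cmod l = 1" shows "umul (W n \<theta> l) (W n \<theta> (cnj l))"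
proof -
  have "adjp (W n \<theta> l) (W n \<theta> (cnj l))"
    unfolding W_def[abs_def] using adjp_plus[OF adjp_smult[OF adjp_id, of "(1+l)/2"] adjp_smult[OF adjp_Rf[of n \<theta>], of "(1-l)/2"]]
    by simp
  moreover have "l * cnj l = 1" using assms by (simp add: complex_norm_square[symmetric])
  ultimately show ?thesis by (simp add: umul_def W_W mult.commute[of "cnj l"])
qed

lemma norm_W_diff: "norm (W n \<theta> l x - x) \<le> cmod (1 - l) * norm x"
proof -
  have "W n \<theta> l x - x = sc ((1 + l) / 2 - 1) x + sc ((1 - l) / 2) (Rf n \<theta> x)"
    by (simp add: W_def sc_diff_left)
  also have "norm \<dots> \<le> cmod ((1 + l) / 2 - 1) * norm x + cmod ((1 - l) / 2) * norm (Rf n \<theta> x)"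
    by (rule order_trans[OF norm_triangle_ineq]) (simp add: norm_sc)
  also have "norm (Rf n \<theta> x) = norm x" by (simp add: adjp_isometry[OF adjp_Rf])
  also have "(1 + l) / 2 - 1 = - ((1 - l) / 2)" by (simp add: field_simps)
  also have "cmod (- ((1 - l) / 2)) * norm x + cmod ((1 - l) / 2) * norm x = cmod (1 - l) * norm x"
    by (simp add: norm_divide)
  finally show ?thesis .
qed

lemma W_W_commute: "n \<noteq> m \<Longrightarrow> W n \<theta> l (W m \<eta> k x) = W m \<eta> k (W n \<theta> l x)"
  by (simp add: W_def Rf_lin sc_add_right sc_sc Rf_Rf_commute[of n m] mult.commute add.assoc add.left_commute)

lemma Ro_W_commute: "n \<noteq> m \<Longrightarrow> Ro n \<theta> (W m \<eta> k x) = W m \<eta> k (Ro n \<theta> x)"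
  by (simp add: W_def adjp_add[OF adjp_Ro] adjp_sc[OF adjp_Ro] Ro_Rf_commute)

lemma Ro_W: "Ro n \<theta> (W n \<eta> l x) = W n (\<eta> + 2 * \<theta>) l (Ro n \<theta> x)"
  by (simp add: W_def adjp_add[OF adjp_Ro] adjp_sc[OF adjp_Ro] Ro_Rf)

end

section \<open>Infinite products of automorphisms\<close>

text \<open>The type class topology on functions is the product topology, so closure in it is
  closure for pointwise norm convergence.\<close>

lemma tendsto_fun:
  fixes f :: "'c \<Rightarrow> 'i \<Rightarrow> 'b::topological_space"
  assumes "\<And>i. ((\<lambda>c. f c i) \<longlongrightarrow> l i) F" shows "(f \<longlongrightarrow> l) F"
proof -
  have "limitin (product_topology (\<lambda>_. euclidean) UNIV) f l F"
    unfolding limitin_componentwise using assms by auto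
  then show ?thesis unfolding euclidean_product_topology by simp
qed

context cstar begin

lemma cstar_aut_inv: assumes "cstar_aut sc st \<gamma>" shows "cstar_aut sc st (inv \<gamma>)"
proof -
  have b: "bij \<gamma>" using assms cstar_aut_def by blast
  have i: "inv \<gamma> x = y \<longleftrightarrow> x = \<gamma> y" for x y using b by (metis bij_inv_eq_iff)
  have g: "\<gamma> (inv \<gamma> x) = x" for x using b by (simp add: bij_is_surj surj_f_inv_f)
  show ?thesis using assms unfolding cstar_aut_def by (simp add: i g bij_imp_bij_inv)
qed

lemma cstar_aut_norm: assumes "cstar_aut sc st \<gamma>" shows "norm (\<gamma> x) = norm x"
proof (rule antisym)
  have "inv \<gamma> (\<gamma> x) = x" using assms unfolding cstar_aut_def by (simp add: bij_is_inj)
  then show "norm x \<le> norm (\<gamma> x)" using cstar_aut_contractive[OF cstar_aut_inv[OF assms], of "\<gamma> x"] by simp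
qed (rule cstar_aut_contractive[OF assms])

lemma cstar_aut_diff: assumes "cstar_aut sc st \<gamma>" shows "\<gamma> (x - y) = \<gamma> x - \<gamma> y"
proof -
  have "\<gamma> (x - y) + \<gamma> y = \<gamma> x" using assms unfolding cstar_aut_def by (metis diff_add_cancel)
  then show ?thesis by (simp add: algebra_simps)
qed

lemma cstar_aut_id: "cstar_aut sc st (\<lambda>x. x)"
  using bij_id unfolding cstar_aut_def id_def by auto

lemma cstar_aut_comp: assumes "cstar_aut sc st \<gamma>" "cstar_aut sc st \<delta>" shows "cstar_aut sc st (\<lambda>x. \<gamma> (\<delta> x))"
  using assms bij_comp[of \<delta> \<gamma>] unfolding cstar_aut_def comp_def by auto

primrec pprod :: "(nat \<Rightarrow> 'a \<Rightarrow> 'a) \<Rightarrow> nat \<Rightarrow> 'a \<Rightarrow> 'a" where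
  "pprod g 0 x = x"
| "pprod g (Suc n) x = g n (pprod g n x)"

definition Lm :: "(nat \<Rightarrow> 'a \<Rightarrow> 'a) \<Rightarrow> 'a \<Rightarrow> 'a" where
  "Lm g x = lim (\<lambda>n. pprod g n x)"

definition near_id :: "(nat \<Rightarrow> 'a \<Rightarrow> 'a) \<Rightarrow> (nat \<Rightarrow> real) \<Rightarrow> bool" where
  "near_id g \<epsilon> \<longleftrightarrow> (\<forall>n. cstar_aut sc st (g n)) \<and> (\<forall>n x. norm (g n x - x) \<le> \<epsilon> n * norm x) \<and> summable \<epsilon>"

lemma pprod_aut: assumes "near_id g \<epsilon>" shows "cstar_aut sc st (pprod g n)"
proof (induction n)
  case 0
  have "pprod g 0 = (\<lambda>x. x)" by auto
  then show ?case using cstar_aut_id by simp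
next
  case (Suc n)
  have "pprod g (Suc n) = (\<lambda>x. g n (pprod g n x))" by auto
  then show ?case using cstar_aut_comp Suc assms unfolding near_id_def by simp
qed

lemma pprod_conv:
  assumes g: "near_id g \<epsilon>"
  shows "(\<lambda>n. pprod g n x) \<longlonglongrightarrow> Lm g x"
    and "norm (Lm g x - pprod g n x) \<le> (\<Sum>k. \<epsilon> (k + n)) * norm x"
proof -
  define f where "f k = pprod g (Suc k) x - pprod g k x" for k
  have f: "norm (f k) \<le> \<epsilon> k * norm x" for k
    using g cstar_aut_norm[OF pprod_aut[OF g], of k x] unfolding near_id_def f_def by (metis pprod.simps(2))
  have s: "summable (\<lambda>k. \<epsilon> k * norm x)" using g unfolding near_id_def by (intro summable_mult2) auto
  have sf: "summable f" by (rule summable_comparison_test'[OF s]) (use f in auto)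
  have tel: "(\<Sum>k<n. f k) = pprod g n x - x" for n unfolding f_def by (subst sum_lessThan_telescope) simp
  have "(\<lambda>n. x + (\<Sum>k<n. f k)) \<longlonglongrightarrow> x + suminf f" using sf by (intro tendsto_intros summable_LIMSEQ)
  then have c: "(\<lambda>n. pprod g n x) \<longlonglongrightarrow> x + suminf f" by (simp add: tel)
  then have L: "Lm g x = x + suminf f" unfolding Lm_def by (rule limI)
  show "(\<lambda>n. pprod g n x) \<longlonglongrightarrow> Lm g x" using c L by simp
  have "Lm g x - pprod g n x = (\<Sum>k. f (k + n))" using suminf_minus_initial_segment[OF sf, of n] by (simp add: L tel)
  also have "norm \<dots> \<le> (\<Sum>k. \<epsilon> (k + n) * norm x)"
    using s f by (intro norm_suminf_le summable_ignore_initial_segment[where f = "\<lambda>k. \<epsilon> k * norm x"]) auto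
  also have "\<dots> = (\<Sum>k. \<epsilon> (k + n)) * norm x"
    using g unfolding near_id_def by (intro suminf_mult2[symmetric] summable_ignore_initial_segment) auto
  finally show "norm (Lm g x - pprod g n x) \<le> (\<Sum>k. \<epsilon> (k + n)) * norm x" .
qed

text \<open>Earlier factors of \<open>g\<close> have to move past later factors of \<open>h\<close>
  only. Factors of equal index are never interchanged, so the lemma also applies to rotations and
  the unitaries which they turn.\<close>

lemma Lm_comp:
  assumes g: "near_id g \<epsilon>" and h: "near_id h \<delta>"
    and c: "\<And>m n x. m < n \<Longrightarrow> g m (h n x) = h n (g m x)"
  shows "Lm g (Lm h x) = Lm (\<lambda>n x. g n (h n x)) x"
proof -
  have "pprod g m (h n x) = h n (pprod g m x)" if "m \<le> n" for m n x
    using that by (induction m) (auto simp: c)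
  then have eq: "pprod (\<lambda>n x. g n (h n x)) n x = pprod g n (pprod h n x)" for n x
    by (induction n) auto
  have "(\<lambda>n. pprod g n (pprod h n x) - pprod g n (Lm h x)) \<longlonglongrightarrow> 0"
  proof (rule tendsto_norm_zero_cancel)
    have "norm (pprod g n (pprod h n x) - pprod g n (Lm h x)) = norm (pprod h n x - Lm h x)" for n
      using cstar_aut_diff[OF pprod_aut[OF g]] cstar_aut_norm[OF pprod_aut[OF g]] by metis
    then show "(\<lambda>n. norm (pprod g n (pprod h n x) - pprod g n (Lm h x))) \<longlonglongrightarrow> 0"
      using pprod_conv(1)[OF h, of x] by (simp add: LIM_zero tendsto_norm_zero)
  qed
  from tendsto_add[OF this pprod_conv(1)[OF g, of "Lm h x"]]
  have "(\<lambda>n. pprod (\<lambda>n x. g n (h n x)) n x) \<longlonglongrightarrow> Lm g (Lm h x)" by (simp add: eq)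
  then show ?thesis unfolding Lm_def[of "\<lambda>n x. g n (h n x)"] by (simp add: limI)
qed

lemma Lm_id: "Lm (\<lambda>n x. x) x = x"
proof -
  have "pprod (\<lambda>n x. x) n x = x" for n by (induction n) auto
  then show ?thesis by (simp add: Lm_def limI)
qed

text \<open>Algebraic identities survive pointwise limits, but surjectivity does not; the inverse is
  therefore produced as the infinite product of the inverse factors.\<close>

lemma Lm_aut:
  assumes g: "near_id g \<epsilon>" and h: "near_id h \<delta>"
    and c: "\<And>m n x. m \<noteq> n \<Longrightarrow> g m (h n x) = h n (g m x)" and i: "\<And>n x. g n (h n x) = x" "\<And>n x. h n (g n x) = x"
  shows "cstar_aut sc st (Lm g)"
proof -
  have "Lm g (Lm h x) = x" for x using Lm_comp[OF g h c, of x] by (simp add: i Lm_id)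
  moreover have "Lm h (Lm g x) = x" for x using Lm_comp[OF h g, of x] c by (simp add: i Lm_id)
  ultimately have "bij (Lm g)" by (intro o_bij[of "Lm h"]) auto
  moreover
  note t = pprod_conv(1)[OF g]
  have a: "cstar_aut sc st (pprod g n)" for n by (rule pprod_aut[OF g])
  have "Lm g (x + y) = Lm g x + Lm g y" for x y
    by (rule LIMSEQ_unique[OF t]) (use a tendsto_add[OF t[of x] t[of y]] in \<open>simp add: cstar_aut_def\<close>)
  moreover have "Lm g (sc c x) = sc c (Lm g x)" for c x
    by (rule LIMSEQ_unique[OF t]) (use a tendsto_sc[OF t[of x], of c] in \<open>simp add: cstar_aut_def\<close>)
  moreover have "Lm g (x * y) = Lm g x * Lm g y" for x y
    by (rule LIMSEQ_unique[OF t]) (use a tendsto_mult[OF t[of x] t[of y]] in \<open>simp add: cstar_aut_def\<close>)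
  moreover have "Lm g (st x) = st (Lm g x)" for x
    by (rule LIMSEQ_unique[OF t]) (use a tendsto_st[OF t[of x]] in \<open>simp add: cstar_aut_def\<close>)
  ultimately show ?thesis unfolding cstar_aut_def by blast
qed

lemma Lm_eventually_id:
  assumes "\<And>n x. N \<le> n \<Longrightarrow> g n x = x" shows "Lm g x = pprod g N x"
proof -
  have "pprod g n x = pprod g N x" if "N \<le> n" for n
    using that by (induction n rule: dec_induct) (auto simp: assms)
  then have "\<forall>\<^sub>F n in sequentially. pprod g n x = pprod g N x"
    unfolding eventually_sequentially by blast
  then have "(\<lambda>n. pprod g n x) \<longlonglongrightarrow> pprod g N x" by (rule tendsto_eventually)
  then show ?thesis unfolding Lm_def by (rule limI)
qed

end

text \<open>These angles make the product of \<open>cos\<^sup>2 (2 * tt n)\<close> telescope.\<close>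

definition tt :: "nat \<Rightarrow> real" where "tt n = arcsin (sqrt (1 / (real n + 2))) / 2"

lemma sqrt_arg: "0 < sqrt (1 / (real n + 2))" "sqrt (1 / (real n + 2)) < 1"
  by auto

lemma tt_pos: "0 < tt n"
  using arcsin_less_arcsin[of 0 "sqrt (1 / (real n + 2))"] sqrt_arg[of n] by (simp add: tt_def)

lemma tt_lim: "tt \<longlonglongrightarrow> 0"
proof -
  have "(\<lambda>n. 1 / (real n + 2)) \<longlonglongrightarrow> 0"
    using LIMSEQ_ignore_initial_segment[OF lim_1_over_n, of 2, where 'a1 = real] by (simp add: add.commute)
  then have "(\<lambda>n. sqrt (1 / (real n + 2))) \<longlonglongrightarrow> sqrt 0" by (rule tendsto_real_sqrt)
  then have "(\<lambda>n. arcsin (sqrt (1 / (real n + 2)))) \<longlonglongrightarrow> arcsin 0" 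
    using isCont_tendsto_compose[OF isCont_arcsin[of 0]] by auto
  then have "(\<lambda>n. arcsin (sqrt (1 / (real n + 2))) / 2) \<longlonglongrightarrow> 0 / 2" by (intro tendsto_divide) auto
  then show ?thesis by (simp add: tt_def[abs_def])
qed

lemma cos_tt: "(cos (2 * tt n))\<^sup>2 = (real n + 1) / (real n + 2)"
proof -
  have "cos (2 * tt n) = sqrt (1 - (sqrt (1 / (real n + 2)))\<^sup>2)"
  proof -
    have "2 * tt n = arcsin (sqrt (1 / (real n + 2)))" by (simp add: tt_def)
    moreover have "- 1 \<le> sqrt (1 / (real n + 2))" "sqrt (1 / (real n + 2)) \<le> 1" using sqrt_arg[of n] by linarith+
    ultimately show ?thesis by (simp only: cos_arcsin)
  qed
  then have "(cos (2 * tt n))\<^sup>2 = 1 - 1 / (real n + 2)" by simp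
  then show ?thesis by (simp add: field_simps)
qed

text \<open>The product telescopes to (a+1)/(2a+2). Blocks from \<open>a\<close> to
  \<open>2*a\<close> are chosen to make this the same constant for every \<open>a\<close>.\<close>

lemma prod_cos_tt: "(\<Prod>n\<in>{a..2*a}. (cos (2 * tt n))\<^sup>2) = 1/2"
proof -
  have "a \<le> b \<Longrightarrow> (\<Prod>n\<in>{a..<b}. (real n + 1) / (real n + 2)) = (real a + 1) / (real b + 1)" for b
    by (induction b rule: dec_induct) (auto simp: prod.atLeastLessThan_Suc divide_simps)
  from this[of "2*a+1"] have "(\<Prod>n\<in>{a..<2*a+1}. (cos (2 * tt n))\<^sup>2) = (real a + 1) / (real (2*a+1) + 1)"
    by (simp only: cos_tt)
  also have "\<dots> = 1/2" by (simp add: field_simps)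
  finally show ?thesis by (simp add: atLeastLessThanSuc_atLeastAtMost)
qed

text \<open>The factor 2 makes a rotation by \<open>tt n\<close> carry the reflection of parameter 0
  to the one of parameter \<open>ang x n\<close>.\<close>

definition ang :: "(nat \<Rightarrow> bool) \<Rightarrow> nat \<Rightarrow> real" where
  "ang x n = (if x n then 2 * tt n else 0)"

definition unit_summable :: "(nat \<Rightarrow> complex) \<Rightarrow> bool" where
  "unit_summable l \<longleftrightarrow> (\<forall>n. cmod (l n) = 1) \<and> summable (\<lambda>n. cmod (1 - l n))"

lemma unit_summable_mult: assumes "unit_summable l" "unit_summable m" shows "unit_summable (\<lambda>n. l n * m n)"
proof -
  have "cmod (1 - l n * m n) \<le> cmod (1 - l n) + cmod (1 - m n)" for n
  proof -
    have "1 - l n * m n = (1 - l n) + l n * (1 - m n)" by (simp add: algebra_simps)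
    also have "cmod \<dots> \<le> cmod (1 - l n) + cmod (l n * (1 - m n))" by (rule norm_triangle_ineq)
    finally show ?thesis using assms by (simp add: unit_summable_def norm_mult)
  qed
  then have le: "norm (cmod (1 - l n * m n)) \<le> cmod (1 - l n) + cmod (1 - m n)" for n by simp
  have "summable (\<lambda>n. cmod (1 - l n) + cmod (1 - m n))" using assms unfolding unit_summable_def by (intro summable_add) auto
  then have "summable (\<lambda>n. cmod (1 - l n * m n))" by (rule summable_comparison_test') (rule le)
  then show ?thesis using assms by (auto simp: unit_summable_def norm_mult)
qed

lemma unit_summable_one: "unit_summable (\<lambda>_. 1)" by (simp add: unit_summable_def)

lemma unit_summable_power: "unit_summable l \<Longrightarrow> unit_summable (\<lambda>n. l n ^ p)"
  by (induction p) (auto simp: unit_summable_one unit_summable_mult)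

lemma unit_summable_cnj: assumes "unit_summable l" shows "unit_summable (\<lambda>n. cnj (l n))"
proof -
  have "cmod (1 - cnj z) = cmod (1 - z)" for z using complex_mod_cnj[of "1 - z"] by simp
  then show ?thesis using assms by (simp add: unit_summable_def)
qed

section \<open>The automorphisms attached to points of Cantor space\<close>

context stable_cstar begin

definition bet :: "(nat \<Rightarrow> bool) \<Rightarrow> (nat \<Rightarrow> complex) \<Rightarrow> nat \<Rightarrow> 'a \<Rightarrow> 'a" where
  "bet x l n = Ad (W n (ang x n) (l n))"

definition Al :: "(nat \<Rightarrow> bool) \<Rightarrow> (nat \<Rightarrow> complex) \<Rightarrow> 'a \<Rightarrow> 'a" where
  "Al x l = Lm (bet x l)"

lemma adjp_W: "cmod l = 1 \<Longrightarrow> adjp (W n \<theta> l) (W n \<theta> (cnj l))"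
  using umul_W by (simp add: umul_def)

lemma bet_near_id: assumes "unit_summable l" shows "near_id (bet x l) (\<lambda>n. 2 * cmod (1 - l n))"
  unfolding near_id_def
proof (intro conjI allI)
  fix n b
  have u: "umul (W n (ang x n) (l n)) (W n (ang x n) (cnj (l n)))" using assms by (intro umul_W) (simp add: unit_summable_def)
  show "cstar_aut sc st (bet x l n)" unfolding bet_def by (rule Ad_aut[OF u])
  show "norm (bet x l n b - b) \<le> 2 * cmod (1 - l n) * norm b" unfolding bet_def
    by (rule norm_Ad_diff[OF u norm_W_diff])
  show "summable (\<lambda>n. 2 * cmod (1 - l n))" using assms by (intro summable_mult) (simp add: unit_summable_def)
qed

lemma bet_bet: assumes "unit_summable l" "unit_summable m" shows "bet x l n (bet x m n b) = bet x (\<lambda>n. l n * m n) n b"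
proof -
  have "Ad (W n (ang x n) (l n)) (Ad (W n (ang x n) (m n)) b)
      = Ad (\<lambda>b. W n (ang x n) (l n) (W n (ang x n) (m n) b)) b"
    using assms by (subst Ad_comp[OF adjp_W adjp_W]) (auto simp: unit_summable_def)
  then show ?thesis by (simp add: bet_def W_W)
qed

lemma Ad_commute:
  assumes "adjp L L'" "adjp M M'" "\<And>x. L (M x) = M (L x)"
  shows "Ad L (Ad M x) = Ad M (Ad L x)"
  unfolding Ad_comp[OF assms(1,2), symmetric] Ad_comp[OF assms(2,1), symmetric] assms(3) ..

lemma bet_commute:
  assumes "unit_summable l" "unit_summable m" "k \<noteq> n" shows "bet x l k (bet y m n b) = bet y m n (bet x l k b)"
proof -
  have c: "cmod (l k) = 1" "cmod (m n) = 1" using assms by (auto simp: unit_summable_def)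
  show ?thesis unfolding bet_def
    by (rule Ad_commute, rule adjp_W[OF c(1)], rule adjp_W[OF c(2)], rule W_W_commute[OF assms(3)])
qed

lemma Al_Al: assumes "unit_summable l" "unit_summable m" shows "Al x l (Al x m b) = Al x (\<lambda>n. l n * m n) b"
proof -
  have "Al x l (Al x m b) = Lm (\<lambda>n b. bet x l n (bet x m n b)) b"
    unfolding Al_def by (rule Lm_comp[OF bet_near_id[OF assms(1)] bet_near_id[OF assms(2)]])
      (simp add: bet_commute assms)
  then show ?thesis by (simp add: bet_bet[OF assms] Al_def)
qed

lemma bet_one: "bet x (\<lambda>_. 1) n b = b"
  by (simp add: bet_def Ad_def)

lemma Al_one: "Al x (\<lambda>_. 1) b = b"
  unfolding Al_def using Lm_eventually_id[of 0 "bet x (\<lambda>_. 1)" b] by (simp add: bet_one)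

lemma Al_aut: assumes "unit_summable l" shows "cstar_aut sc st (Al x l)"
proof -
  have c: "l n * cnj (l n) = 1" for n using assms by (simp add: unit_summable_def complex_norm_square[symmetric])
  show ?thesis unfolding Al_def
  proof (rule Lm_aut[OF bet_near_id[OF assms] bet_near_id[OF unit_summable_cnj[OF assms]]])
    show "bet x l m (bet x (\<lambda>n. cnj (l n)) n b) = bet x (\<lambda>n. cnj (l n)) n (bet x l m b)" if "m \<noteq> n" for m n b
      using bet_commute[OF assms unit_summable_cnj[OF assms] that] .
    show "bet x l n (bet x (\<lambda>n. cnj (l n)) n b) = b" "bet x (\<lambda>n. cnj (l n)) n (bet x l n b) = b" for n b
      using bet_bet[OF assms unit_summable_cnj[OF assms]] bet_bet[OF unit_summable_cnj[OF assms] assms]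
      by (simp_all add: c mult.commute[of "cnj _"] bet_one)
  qed
qed

lemma Al_funpow: assumes "unit_summable l" shows "(Al x l ^^ p) b = Al x (\<lambda>n. l n ^ p) b"
proof (induction p)
  case (Suc p) then show ?case by (simp add: Al_Al[OF assms unit_summable_power[OF assms]])
qed (simp add: Al_one)

primrec wprod :: "(nat \<Rightarrow> bool) \<Rightarrow> (nat \<Rightarrow> complex) \<Rightarrow> nat \<Rightarrow> 'a \<Rightarrow> 'a" where
  "wprod x l 0 b = b"
| "wprod x l (Suc n) b = W n (ang x n) (l n) (wprod x l n b)"

lemma umul_wprod: assumes "unit_summable l" shows "\<exists>M. umul (wprod x l n) M"
proof (induction n)
  case 0
  have "wprod x l 0 = (\<lambda>b. b)" by auto
  then show ?case using umul_id by metis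
next
  case (Suc n)
  then obtain M where "umul (wprod x l n) M" by blast
  moreover have "wprod x l (Suc n) = (\<lambda>b. W n (ang x n) (l n) (wprod x l n b))" by auto
  ultimately show ?case using umul_comp[OF umul_W] assms unfolding unit_summable_def by metis
qed

lemma pprod_bet: assumes "unit_summable l" shows "pprod (bet x l) n b = Ad (wprod x l n) b"
proof (induction n)
  case 0
  have "wprod x l 0 = (\<lambda>b. b)" by auto
  then show ?case by (simp add: Ad_id)
next
  case (Suc n)
  obtain M where "umul (wprod x l n) M" using umul_wprod[OF assms] by blast
  then have "adjp (wprod x l n) M" by (simp add: umul_def)
  moreover have "wprod x l (Suc n) = (\<lambda>b. W n (ang x n) (l n) (wprod x l n b))" by auto
  moreover have "cmod (l n) = 1" using assms by (simp add: unit_summable_def)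
  ultimately show ?case using Ad_comp[OF adjp_W] Suc by (simp add: bet_def)
qed

lemma Al_closure_Inn: assumes "unit_summable l" shows "Al x l \<in> closure (Inn sc st)"
proof -
  have "(\<lambda>n. pprod (bet x l) n) \<longlonglongrightarrow> Al x l"
    unfolding Al_def by (rule tendsto_fun) (rule pprod_conv(1)[OF bet_near_id[OF assms]])
  moreover have "pprod (bet x l) n \<in> closure (Inn sc st)" for n
  proof -
    obtain M where "umul (wprod x l n) M" using umul_wprod[OF assms] by blast
    then have "Ad (wprod x l n) \<in> Inn sc st" by (rule Ad_Inn)
    moreover have "pprod (bet x l) n = Ad (wprod x l n)" using pprod_bet[OF assms] by blast
    ultimately show ?thesis using closure_subset by auto
  qed
  ultimately show ?thesis by (intro Lim_in_closed_set[OF closed_closure]) auto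
qed

text \<open>Finite partial products depend on finitely many coordinates of \<open>x\<close>, and the
  tail estimate involves \<open>l\<close> but not \<open>x\<close>, so the convergence is
  uniform.\<close>

lemma continuous_Al: assumes "unit_summable l" shows "continuous_on UNIV (\<lambda>x. Al x l)"
proof (rule continuous_on_coordinatewise_then_product)
  fix b
  define \<epsilon> where "\<epsilon> n = 2 * cmod (1 - l n)" for n
  have s: "summable \<epsilon>" using bet_near_id[OF assms] unfolding near_id_def \<epsilon>_def by blast
  show "continuous_on UNIV (\<lambda>x. Al x l b)"
  proof (rule uniform_limit_theorem)
    show "uniform_limit UNIV (\<lambda>n x. pprod (bet x l) n b) (\<lambda>x. Al x l b) sequentially"
      unfolding uniform_limit_sequentially_iff
    proof (intro allI impI)
      fix e :: real assume "e > 0"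
      have "(\<lambda>n. (\<Sum>k. \<epsilon> (k + n)) * norm b) \<longlonglongrightarrow> 0 * norm b"
        using suminf_exist_split2[OF s] by (intro tendsto_intros)
      then have "\<forall>\<^sub>F n in sequentially. (\<Sum>k. \<epsilon> (k + n)) * norm b < e" using \<open>e > 0\<close> by (intro order_tendstoD) auto
      then obtain N where N: "\<And>n. N \<le> n \<Longrightarrow> (\<Sum>k. \<epsilon> (k + n)) * norm b < e" by (auto simp: eventually_sequentially)
      have "dist (pprod (bet x l) n b) (Al x l b) < e" if "N \<le> n" for n x
        using pprod_conv(2)[OF bet_near_id[OF assms], of x b n] N[OF that]
        unfolding Al_def dist_norm \<epsilon>_def by (simp add: norm_minus_commute)
      then show "\<exists>N. \<forall>n\<ge>N. \<forall>x\<in>UNIV. dist (pprod (bet x l) n b) (Al x l b) < e" by blast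
    qed
    have "continuous_on UNIV (\<lambda>x. pprod (bet x l) n b)" for n
    proof -
      have dep: "pprod (bet x l) n c = pprod (bet y l) n c" if "\<And>k. k < n \<Longrightarrow> x k = y k" for x y c
        using that by (induction n) (auto simp: bet_def ang_def)
      have "open ((\<lambda>x. pprod (bet x l) n b) -` B)" for B
      proof (subst open_subopen, intro ballI)
        fix x assume x: "x \<in> (\<lambda>x. pprod (bet x l) n b) -` B"
        define T where "T = (\<Inter>k\<in>{..<n}. (\<lambda>y. y k) -` {x k})"
        have "open T" unfolding T_def
          by (intro open_INT) (auto intro!: open_vimage continuous_on_product_coordinates simp: open_discrete)
        moreover have "T \<subseteq> (\<lambda>x. pprod (bet x l) n b) -` B"
        proof
          fix y assume "y \<in> T"
          then have "pprod (bet y l) n b = pprod (bet x l) n b" by (intro dep) (auto simp: T_def)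
          then show "y \<in> (\<lambda>x. pprod (bet x l) n b) -` B" using x by simp
        qed
        ultimately show "\<exists>T. open T \<and> x \<in> T \<and> T \<subseteq> (\<lambda>x. pprod (bet x l) n b) -` B" by (auto simp: T_def)
      qed
      then show ?thesis by (simp add: continuous_on_open_vimage)
    qed
    then show "\<forall>\<^sub>F n in sequentially. continuous_on UNIV (\<lambda>x. pprod (bet x l) n b)" by simp
  qed simp
qed

text \<open>Rotating factor \<open>n\<close> by half the difference of the angles turns the
  reflection for \<open>x\<close> into that for \<open>y\<close>. The sign \<open>\<sigma>\<close>
  treats the product of rotations and its inverse together.\<close>

lemma Al_conjugate:
  assumes l: "unit_summable l" and s: "summable (\<lambda>n. if x n \<noteq> y n then tt n else 0)"
  shows "\<exists>\<gamma>\<in>Aut sc st. Al y l = \<gamma> \<circ> Al x l \<circ> inv \<gamma>"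
proof -
  define \<theta> where "\<theta> n = (ang y n - ang x n) / 2" for n
  define g where "g \<sigma> n = Ad (Ro n (\<sigma> * \<theta> n))" for \<sigma> n
  have \<theta>: "\<bar>\<theta> n\<bar> = (if x n \<noteq> y n then tt n else 0)" for n
    using tt_pos[of n] by (auto simp: \<theta>_def ang_def)
  have ab: "\<bar>\<sigma> * \<theta> n\<bar> = \<bar>\<theta> n\<bar>" if "\<bar>\<sigma>\<bar> = 1" for \<sigma> n using that by (simp add: abs_mult)
  have near: "near_id (g \<sigma>) (\<lambda>n. 2 * (2 * \<bar>\<theta> n\<bar>))" if "\<bar>\<sigma>\<bar> = 1" for \<sigma>
    unfolding near_id_def
  proof (intro conjI allI)
    fix n b
    show "cstar_aut sc st (g \<sigma> n)" unfolding g_def by (rule Ad_aut[OF umul_Ro])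
    show "norm (g \<sigma> n b - b) \<le> 2 * (2 * \<bar>\<theta> n\<bar>) * norm b" unfolding g_def
      using norm_Ro_diff[of n "\<sigma> * \<theta> n"] by (intro norm_Ad_diff[OF umul_Ro]) (simp add: ab[OF that])
    show "summable (\<lambda>n. 2 * (2 * \<bar>\<theta> n\<bar>))" using s unfolding \<theta> by (intro summable_mult)
  qed
  note n1 = near[of 1, simplified] and n2 = near[of "-1", simplified]
  have aut: "cstar_aut sc st (Lm (g 1))"
  proof (rule Lm_aut[OF n1 n2])
    show "g 1 m (g (- 1) n b) = g (- 1) n (g 1 m b)" if "m \<noteq> n" for m n b
      unfolding g_def by (rule Ad_commute, rule adjp_Ro, rule adjp_Ro, rule Ro_Ro_commute[OF that])
    show "g 1 n (g (- 1) n b) = b" "g (- 1) n (g 1 n b) = b" for n b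
      unfolding g_def using Ro_Ro[of n "\<theta> n"] Ro_Ro[of n "- \<theta> n"]
      by (simp_all add: Ad_comp[OF adjp_Ro adjp_Ro, symmetric] Ad_id)
  qed
  have sw: "g 1 n (bet x l n b) = bet y l n (g 1 n b)" for n b
  proof -
    have cm: "cmod (l n) = 1" using l by (simp add: unit_summable_def)
    have "Ro n (\<theta> n) (W n (ang x n) (l n) c) = W n (ang y n) (l n) (Ro n (\<theta> n) c)" for c
    proof -
      have "ang x n + 2 * \<theta> n = ang y n" by (simp add: \<theta>_def field_simps)
      then show ?thesis using Ro_W[of n "\<theta> n" "ang x n" "l n" c] by simp
    qed
    then show ?thesis unfolding g_def bet_def
      by (simp add: Ad_comp[OF adjp_Ro adjp_W[OF cm], symmetric] Ad_comp[OF adjp_W[OF cm] adjp_Ro, symmetric])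
  qed
  have cm: "g 1 k (bet z l n b) = bet z l n (g 1 k b)" if "k \<noteq> n" for k n z b
  proof -
    have c: "cmod (l n) = 1" using l by (simp add: unit_summable_def)
    show ?thesis unfolding g_def bet_def 
      by (rule Ad_commute, rule adjp_Ro, rule adjp_W[OF c], rule Ro_W_commute[OF that])
  qed
  have "Lm (g 1) (Al x l b) = Al y l (Lm (g 1) b)" for b
  proof -
    have "Lm (g 1) (Al x l b) = Lm (\<lambda>n b. g 1 n (bet x l n b)) b"
      unfolding Al_def by (rule Lm_comp[OF n1 bet_near_id[OF l]]) (simp add: cm)
    also have "\<dots> = Lm (\<lambda>n b. bet y l n (g 1 n b)) b" by (simp add: sw)
    also have "\<dots> = Al y l (Lm (g 1) b)"
      unfolding Al_def by (rule Lm_comp[OF bet_near_id[OF l] n1, symmetric]) (simp add: cm)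
    finally show ?thesis .
  qed
  moreover have "Lm (g 1) (inv (Lm (g 1)) b) = b" for b
    using aut unfolding cstar_aut_def by (simp add: bij_is_surj surj_f_inv_f)
  ultimately have "Al y l = Lm (g 1) \<circ> Al x l \<circ> inv (Lm (g 1))" by auto
  then show ?thesis using aut unfolding Aut_def by blast
qed

end

section \<open>Powers of the automorphisms\<close>

text \<open>The power \<open>kk a\<close> of \<open>lam n\<close> is close to \<open>- 1\<close> for \<open>n\<close> in the block \<open>{a..2*a}\<close> and close to \<open>1\<close> for all
  other \<open>n\<close>, because \<open>NN m / NN n\<close> is an even integer for \<open>n < m\<close> and tiny for \<open>m < n\<close>.\<close>

definition NN :: "nat \<Rightarrow> nat" where "NN n = 2 ^ (n * n)"

definition lam :: "nat \<Rightarrow> complex" where "lam n = cis (pi / real (NN n))"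

lemma cmod_cis_diff: "cmod (cis a - 1) \<le> \<bar>a\<bar>"
proof -
  have "(cmod (cis a - 1))\<^sup>2 = (cos a - 1)\<^sup>2 + (sin a)\<^sup>2" by (simp add: cmod_power2)
  also have "\<dots> = 2 - 2 * cos a" using sin_cos_squared_add[of a] by (simp add: power2_eq_square algebra_simps)
  also have "\<dots> = (2 * sin (a/2))\<^sup>2" using cos_double_sin[of "a/2"] by (simp add: power_mult_distrib)
  also have "\<dots> \<le> \<bar>a\<bar>\<^sup>2"
    using abs_sin_x_le_abs_x[of "a/2"] by (intro power2_le_iff_abs_le[THEN iffD2]) (auto simp: abs_mult)
  finally show ?thesis by (rule power2_le_imp_le) simp
qed

lemma NN_pos: "0 < NN n" by (simp add: NN_def)

lemma unit_summable_lam: "unit_summable lam"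
  unfolding unit_summable_def
proof
  show "\<forall>n. cmod (lam n) = 1" by (simp add: lam_def)
  have le: "norm (cmod (1 - lam n)) \<le> 4 * (1/2) ^ n" for n
  proof -
    have "cmod (1 - lam n) \<le> pi / real (NN n)"
      using cmod_cis_diff[of "pi / real (NN n)"] by (simp add: lam_def norm_minus_commute)
    also have "\<dots> \<le> 4 / 2 ^ n"
    proof (rule frac_le)
      show "pi \<le> 4" using pi_less_4 by simp
      have "(2::real) ^ n \<le> 2 ^ (n * n)" by (intro power_increasing) (auto simp: le_square)
      then show "2 ^ n \<le> real (NN n)" by (simp add: NN_def)
    qed auto
    finally show ?thesis by (simp add: power_one_over)
  qed
  have "summable (\<lambda>n. 4 * (1/2::real) ^ n)" by (intro summable_mult summable_geometric) auto
  then show "summable (\<lambda>n. cmod (1 - lam n))" by (rule summable_comparison_test') (rule le)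
qed

definition kk :: "nat \<Rightarrow> nat" where "kk a = (\<Sum>m\<in>{a..2*a}. NN m)"

definition mu :: "nat \<Rightarrow> nat \<Rightarrow> complex" where "mu a n = (if n \<in> {a..2*a} then - 1 else 1)"

text \<open>The exponent is a power of 2 times the half turn: exactly one half turn for
  \<open>m = n\<close>, an even number of them for \<open>m > n\<close>. For \<open>m < n\<close>
  one has n^2 - m^2 >= m + n, and 4 is a bound for pi.\<close>

lemma lam_power: "m \<ge> n \<Longrightarrow> lam n ^ NN m = (if m = n then - 1 else 1)"
  and lam_power_le: "m < n \<Longrightarrow> cmod (lam n ^ NN m - 1) \<le> 4 * (1/2) ^ n * (1/2) ^ m"
proof -
  have p: "lam n ^ NN m = cis (real (NN m) * (pi / real (NN n)))" unfolding lam_def by (rule Complex.DeMoivre)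
  show "lam n ^ NN m = (if m = n then - 1 else 1)" if mn: "m \<ge> n"
  proof (cases "m = n")
    case True
    then have "real (NN m) * (pi / real (NN n)) = pi" using NN_pos[of n] by simp
    then show ?thesis using True p by simp
  next
    case False
    then have "n * n < m * m" using mn by (simp add: mult_strict_mono)
    then obtain d where d: "m * m = n * n + Suc d" using less_iff_Suc_add by auto
    have "real (NN m) / real (NN n) = 2 * 2 ^ d" by (simp add: NN_def d power_add)
    then have "pi * (real (NN m) / real (NN n)) = pi * (2 * 2 ^ d)" by simp
    then have "real (NN m) * (pi / real (NN n)) = 2 * pi * real (2 ^ d)" by (simp add: mult.commute mult.left_commute)
    moreover have "cis (2 * pi * real (2 ^ d)) = 1" by (rule cis_multiple_2pi) simp
    ultimately show ?thesis using False by (simp add: p)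
  qed
  show "cmod (lam n ^ NN m - 1) \<le> 4 * (1/2) ^ n * (1/2) ^ m" if mn: "m < n"
  proof -
    obtain d where d: "n = m + 1 + d" using mn less_iff_Suc_add[of m n] by auto
    have "m * m + m + n \<le> n * n" unfolding d by (simp add: algebra_simps)
    then have "(2::real) ^ (m * m + m + n) \<le> 2 ^ (n * n)" by (intro power_increasing) auto
    then have le: "real (NN m) / real (NN n) \<le> (1/2) ^ n * (1/2) ^ m"
      by (simp add: NN_def power_add field_simps)
    have "cmod (lam n ^ NN m - 1) \<le> \<bar>real (NN m) * (pi / real (NN n))\<bar>" unfolding p by (rule cmod_cis_diff)
    also have "\<dots> = pi * (real (NN m) / real (NN n))" by simp
    also have "\<dots> \<le> 4 * ((1/2) ^ n * (1/2) ^ m)" using pi_less_4 le by (intro mult_mono) auto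
    finally show ?thesis by simp
  qed
qed

text \<open>For factors of modulus 1 the error of a product is at most the sum of the errors. When
  \<open>n \<le> a\<close>, every exponent occurring in \<open>kk a\<close> has
  \<open>m \<ge> n\<close> and contributes no error.\<close>

lemma lam_kk: "cmod (lam n ^ kk a - mu a n) \<le> (if n \<le> a then 0 else 8 * (1/2) ^ n)"
proof -
  have mu: "mu a n = (\<Prod>m\<in>{a..2*a}. if m = n then - 1 else 1)"
    unfolding mu_def by (simp add: prod.delta)
  have "cmod (lam n ^ kk a - mu a n) = cmod ((\<Prod>m\<in>{a..2*a}. lam n ^ NN m) - (\<Prod>m\<in>{a..2*a}. if m = n then - 1 else 1))"
    by (simp add: kk_def power_sum mu)
  also have "\<dots> \<le> (\<Sum>m\<in>{a..2*a}. cmod (lam n ^ NN m - (if m = n then - 1 else 1)))"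
    by (rule norm_prod_diff) (auto simp: norm_power lam_def)
  also have "\<dots> \<le> (\<Sum>m\<in>{a..2*a}. if m < n then 4 * (1/2) ^ n * (1/2) ^ m else 0)"
    using lam_power lam_power_le by (intro sum_mono) auto
  also have "\<dots> \<le> (if n \<le> a then 0 else 8 * (1/2) ^ n)"
  proof (cases "n \<le> a")
    case True
    then show ?thesis by (simp add: sum.neutral)
  next
    case False
    have "(\<Sum>m\<in>{a..2*a}. if m < n then 4 * (1/2::real) ^ n * (1/2) ^ m else 0)
        \<le> (\<Sum>m\<in>{a..2*a}. 4 * (1/2) ^ n * (1/2) ^ m)" by (intro sum_mono) auto
    also have "\<dots> = 4 * (1/2) ^ n * (\<Sum>m\<in>{a..2*a}. (1/2) ^ m)" by (simp add: sum_distrib_left)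
    also have "\<dots> \<le> 4 * (1/2) ^ n * (\<Sum>m. (1/2::real) ^ m)"
      by (intro mult_left_mono sum_le_suminf summable_geometric) auto
    also have "\<dots> = 8 * (1/2) ^ n" by (simp add: suminf_geometric)
    finally show ?thesis using False by simp
  qed
  finally show ?thesis .
qed

text \<open>As \<open>mu a n\<close> is its own inverse, this is the power of \<open>lam n\<close>
  divided by the sign approximating it.\<close>

definition nu :: "nat \<Rightarrow> nat \<Rightarrow> complex" where "nu a n = mu a n * lam n ^ kk a"

lemma mu_sq: "mu a n * mu a n = 1" "cmod (mu a n) = 1" by (auto simp: mu_def)

lemma unit_summable_mu: "unit_summable (mu a)"
  unfolding unit_summable_def
proof
  show "summable (\<lambda>n. cmod (1 - mu a n))" by (rule summable_finite[of "{a..2*a}"]) (auto simp: mu_def)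
qed (simp add: mu_sq)

lemma unit_summable_nu: "unit_summable (nu a)"
  unfolding nu_def[abs_def] by (intro unit_summable_mult unit_summable_mu unit_summable_power unit_summable_lam)

lemma nu_diff: "cmod (1 - nu a n) \<le> (if n \<le> a then 0 else 8 * (1/2) ^ n)"
proof -
  have "1 - nu a n = mu a n * (mu a n - lam n ^ kk a)" by (simp add: nu_def mu_sq right_diff_distrib)
  then have "cmod (1 - nu a n) = cmod (mu a n - lam n ^ kk a)" by (simp add: norm_mult mu_sq)
  then show ?thesis using lam_kk[of n a] by (simp add: norm_minus_commute)
qed

lemma suminf_nu: "(\<Sum>n. 2 * cmod (1 - nu a n)) \<le> 16 * (1/2) ^ a"
proof -
  define f where "f n = (if n \<le> a then 0 else 16 * (1/2::real) ^ n)" for n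
  have g: "summable (\<lambda>n. 16 * (1/2::real) ^ n)" by (intro summable_mult summable_geometric) auto
  have sf: "summable f" by (rule summable_comparison_test'[OF g]) (auto simp: f_def)
  have sn: "summable (\<lambda>n. 2 * cmod (1 - nu a n))" using unit_summable_nu unfolding unit_summable_def by (intro summable_mult) auto
  have "(\<Sum>n. 2 * cmod (1 - nu a n)) \<le> suminf f"
  proof (intro suminf_le sn sf)
    show "2 * cmod (1 - nu a n) \<le> f n" for n using nu_diff[of a n] by (cases "n \<le> a") (simp_all add: f_def)
  qed
  also have "suminf f = (\<Sum>n. f (n + Suc a)) + (\<Sum>n<Suc a. f n)" by (rule suminf_split_initial_segment[OF sf])
  also have "(\<Sum>n<Suc a. f n) = 0" by (rule sum.neutral) (auto simp: f_def)
  also have "(\<Sum>n. f (n + Suc a)) = (\<Sum>n. 8 * (1/2) ^ a * (1/2::real) ^ n)"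
    by (rule arg_cong[of _ _ suminf]) (auto simp: f_def power_add)
  also have "\<dots> = 8 * (1/2) ^ a * (\<Sum>n. (1/2::real) ^ n)" by (rule suminf_mult) (auto intro: summable_geometric)
  also have "(\<Sum>n. (1/2::real) ^ n) = 2" by (simp add: suminf_geometric)
  finally show ?thesis by simp
qed

section \<open>Displacement of elements by the powers\<close>

context stable_cstar begin

text \<open>The power splits as \<open>Al x (mu a)\<close> after \<open>Al x (nu a)\<close>. The
  first is isometric, so the error is the displacement by the second, whose factors up to index
  \<open>a\<close> are trivial.\<close>

lemma Al_kk: "norm ((Al x lam ^^ kk a) b - Al x (mu a) b) \<le> 16 * (1/2) ^ a * norm b"
proof -
  have "lam n ^ kk a = mu a n * nu a n" for n by (simp add: nu_def mu_sq mult.assoc[symmetric])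
  then have "(Al x lam ^^ kk a) b = Al x (mu a) (Al x (nu a) b)"
    by (simp add: Al_funpow[OF unit_summable_lam] Al_Al[OF unit_summable_mu unit_summable_nu])
  then have "norm ((Al x lam ^^ kk a) b - Al x (mu a) b) = norm (Al x (nu a) b - b)"
    using cstar_aut_diff[OF Al_aut[OF unit_summable_mu]] cstar_aut_norm[OF Al_aut[OF unit_summable_mu]] by metis
  also have "\<dots> \<le> (\<Sum>n. 2 * cmod (1 - nu a n)) * norm b"
    using pprod_conv(2)[OF bet_near_id[OF unit_summable_nu], of x a b 0] by (simp add: Al_def)
  also have "\<dots> \<le> 16 * (1/2) ^ a * norm b" by (intro mult_right_mono suminf_nu) auto
  finally show ?thesis .
qed

lemma Al_mu: "Al x (mu a) b = Ad (wprod x (mu a) (2*a+1)) b"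
proof -
  have "bet x (mu a) n c = c" if "2*a+1 \<le> n" for n c
    using that by (simp add: bet_def Ad_def mu_def)
  then show ?thesis unfolding Al_def pprod_bet[OF unit_summable_mu, symmetric] by (rule Lm_eventually_id)
qed

lemma S_fixes: assumes "fin_below (2 ^ M) b" "M \<le> n" shows "S n b = b"
proof (rule \<phi>_eqI)
  fix i j
  show "\<phi> (S n b) i j = \<phi> b i j"
  proof (cases "i < 2 ^ M")
    case True
    also have "(2::nat) ^ M \<le> 2 ^ n" using assms(2) by (intro power_increasing) auto
    finally have "\<not> bit i n" by (simp add: bit_iff_odd)
    then show ?thesis by (simp add: \<phi>_S)
  qed (use assms(1) in \<open>auto simp: \<phi>_S fin_below_def\<close>)
qed

text \<open>Where \<open>x\<close> is false, the active factors are the signs \<open>S n\<close>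
  with \<open>n \<ge> a\<close>, and row indices below \<open>2 ^ M\<close> do not contain these
  bits. The same holds for \<open>st b\<close>, which covers multiplication from the right.\<close>

lemma Al_mu_false:
  assumes b: "fin_below (2 ^ M) b" "M \<le> a" and x: "\<And>n. n \<in> {a..2*a} \<Longrightarrow> \<not> x n"
  shows "Al x (mu a) b = b"
proof -
  have w: "wprod x (mu a) n c = c" if "fin_below (2 ^ M) c" for n c
  proof (induction n)
    case (Suc n)
    have "Rf n 0 c = c" if "a \<le> n" using S_fixes[OF \<open>fin_below (2 ^ M) c\<close>, of n] b(2) that by (simp add: Rf_def)
    then show ?case using Suc x[of n] by (auto simp: mu_def ang_def W_minus_one)
  qed simp
  have "fin_below (2 ^ M) (st b)" using b(1) by (auto simp: fin_below_def \<phi>_st_entry)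
  then show ?thesis unfolding Al_mu Ad_def using b(1) by (simp only: w st_st)
qed

lemma \<phi>_Rf: "\<phi> (Rf n \<theta> x) i j = cos \<theta> *\<^sub>R (if bit i n then - \<phi> x i j else \<phi> x i j) + sin \<theta> *\<^sub>R \<phi> x (flip_bit n i) j"
  by (simp add: Rf_def \<phi>_add \<phi>_scaleR \<phi>_S \<phi>_F)

text \<open>Starting in row 0, each active factor keeps the cosine part there and sends the sine
  part to a row containing its bit. Later factors act on other bits, so nothing returns to row 0.
  The second claim says that no bit from \<open>N\<close> on has yet been switched on.\<close>

lemma wprod_row:
  assumes y: "\<And>n. n \<in> {a..2*a} \<Longrightarrow> y n" and c: "\<And>i j. i \<noteq> 0 \<Longrightarrow> \<phi> c i j = 0"
  shows "\<phi> (wprod y (mu a) N c) 0 j = (\<Prod>n\<in>{a..2*a} \<inter> {..<N}. cos (2 * tt n)) *\<^sub>R \<phi> c 0 j"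
    and "\<exists>n\<ge>N. bit i n \<Longrightarrow> \<phi> (wprod y (mu a) N c) i j = 0"
proof (induction N arbitrary: i)
  case 0
  { case 1 show ?case by simp }
  { case 2 then have "i \<noteq> 0" by (metis bit_0_eq bot_apply bot_bool_def) then show ?case using c by simp }
next
  case (Suc N)
  have IH1: "\<phi> (wprod y (mu a) N c) 0 j = (\<Prod>n\<in>{a..2*a} \<inter> {..<N}. cos (2 * tt n)) *\<^sub>R \<phi> c 0 j"
    using Suc by blast
  have IH2: "\<phi> (wprod y (mu a) N c) i j = 0" if "\<exists>n\<ge>N. bit i n" for i
    using Suc that by blast
  { case 1
    show ?case
    proof (cases "N \<in> {a..2*a}")
      case True
      have "\<phi> (wprod y (mu a) N c) (flip_bit N 0) j = 0" 
        using IH2[of "flip_bit N 0"] bit_flip[of N 0 N] by (metis bit_0_eq bot_apply bot_bool_def order_refl)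
      moreover have "{a..2*a} \<inter> {..<Suc N} = insert N ({a..2*a} \<inter> {..<N})" using True by auto
      moreover have "wprod y (mu a) (Suc N) c = Rf N (2 * tt N) (wprod y (mu a) N c)"
        using True y[OF True] by (simp add: mu_def ang_def W_minus_one)
      ultimately show ?thesis by (simp add: \<phi>_Rf IH1)
    next
      case False
      then have "{a..2*a} \<inter> {..<Suc N} = {a..2*a} \<inter> {..<N}" by (auto simp: less_Suc_eq)
      moreover have "wprod y (mu a) (Suc N) c = wprod y (mu a) N c" using False by (auto simp: mu_def)
      ultimately show ?thesis using IH1 by metis
    qed }
  { case 2
    then obtain n where n: "Suc N \<le> n" "bit i n" by blast
    have z: "\<phi> (wprod y (mu a) N c) i j = 0" using IH2 n by (meson Suc_leD)
    have z': "\<phi> (wprod y (mu a) N c) (flip_bit N i) j = 0"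
      using IH2[of "flip_bit N i"] n bit_flip[of N i n] by (metis Suc_leD not_less_eq_eq order_refl)
    show ?case
    proof (cases "N \<in> {a..2*a}")
      case True
      then have "wprod y (mu a) (Suc N) c = Rf N (2 * tt N) (wprod y (mu a) N c)"
        using y[OF True] by (simp add: mu_def ang_def W_minus_one)
      then show ?thesis by (simp add: \<phi>_Rf z z')
    next
      case False
      then have "wprod y (mu a) (Suc N) c = wprod y (mu a) N c" by (auto simp: mu_def)
      then show ?thesis using z by metis
    qed }
qed

lemma \<phi>_W: "\<phi> (W n \<theta> l x) i j = sc ((1 + l) / 2) (\<phi> x i j) + sc ((1 - l) / 2) (\<phi> (Rf n \<theta> x) i j)"
  by (simp add: W_def \<phi>_add \<phi>_sc)

lemma wprod_column: assumes "\<And>i. \<phi> c i j = 0" shows "\<phi> (wprod y l N c) i j = 0"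
  by (induction N arbitrary: i) (auto simp: assms \<phi>_W \<phi>_Rf)

text \<open>Left and right multiplication each contribute the factor \<open>D\<close> to the corner
  entry, and \<open>D * D\<close> is the product of squared cosines, 1/2. The corner of the
  difference has therefore half the norm of \<open>b\<close>.\<close>

lemma Al_mu_true:
  assumes y: "\<And>n. n \<in> {a..2*a} \<Longrightarrow> y n"
  shows "norm (Al y (mu a) (E 0 0 b) - E 0 0 b) \<ge> norm b / 2"
proof -
  define D where "D = (\<Prod>n\<in>{a..2*a} \<inter> {..<2*a+1}. cos (2 * tt n))"
  define L where "L = wprod y (mu a) (2*a+1)"
  define c where "c = st (L (E 0 0 (st b)))"
  have "\<phi> (L (E 0 0 (st b))) 0 0 = D *\<^sub>R st b"
    unfolding L_def D_def by (subst wprod_row(1)[OF y]) (auto simp: \<phi>_E)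
  then have c00: "\<phi> c 0 0 = D *\<^sub>R b" by (simp add: c_def \<phi>_st_entry st_scaleR)
  have crow: "\<phi> c i j = 0" if "i \<noteq> 0" for i j
  proof -
    have "\<phi> (L (E 0 0 (st b))) j i = 0" unfolding L_def by (rule wprod_column) (use that in \<open>simp add: \<phi>_E\<close>)
    then show ?thesis by (simp add: c_def \<phi>_st_entry)
  qed
  have "Al y (mu a) (E 0 0 b) = L c" unfolding Al_mu Ad_def L_def c_def by (simp add: st_E)
  moreover have "\<phi> (L c) 0 0 = D *\<^sub>R \<phi> c 0 0" unfolding L_def D_def by (rule wprod_row(1)[OF y crow])
  moreover have "D * D = 1/2"
  proof -
    have "{a..2*a} \<inter> {..<2*a+1} = {a..2*a}" by auto
    then show ?thesis using prod_cos_tt[of a] unfolding D_def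
      by (simp add: power2_eq_square prod.distrib)
  qed
  ultimately have "\<phi> (Al y (mu a) (E 0 0 b)) 0 0 = (1/2) *\<^sub>R b" by (simp add: c00)
  then have "\<phi> (Al y (mu a) (E 0 0 b) - E 0 0 b) 0 0 = (1/2) *\<^sub>R b - b" by (simp add: \<phi>_diff \<phi>_E)
  also have "\<dots> = (- 1/2) *\<^sub>R b"
    using scaleR_left_diff_distrib[of "1/2" 1 b] by simp
  finally have "norm (\<phi> (Al y (mu a) (E 0 0 b) - E 0 0 b) 0 0) = norm b / 2" by simp
  then show ?thesis using norm_entry_le[of "Al y (mu a) (E 0 0 b) - E 0 0 b" 0 0] by simp
qed

lemma not_conjugate:
  fixes b :: 'a
  assumes b: "b \<noteq> 0"
    and inf: "\<And>N. \<exists>a\<ge>N. \<forall>n\<in>{a..2*a}. \<not> x n \<and> y n"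
  shows "\<not> (\<exists>\<gamma>\<in>Aut sc st. Al y lam = \<gamma> \<circ> Al x lam \<circ> inv \<gamma>)"
proof
  assume "\<exists>\<gamma>\<in>Aut sc st. Al y lam = \<gamma> \<circ> Al x lam \<circ> inv \<gamma>"
  then obtain \<gamma> where \<gamma>: "cstar_aut sc st \<gamma>" and eq: "Al y lam = \<gamma> \<circ> Al x lam \<circ> inv \<gamma>"
    unfolding Aut_def by blast
  have bij: "\<gamma> (inv \<gamma> z) = z" "inv \<gamma> (\<gamma> z) = z" for z
    using \<gamma> unfolding cstar_aut_def by (auto simp: bij_is_surj surj_f_inv_f bij_is_inj)
  have pow: "(Al y lam ^^ k) z = \<gamma> ((Al x lam ^^ k) (inv \<gamma> z))" for k z
    by (induction k) (auto simp: eq bij)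
  define e where "e = E 0 0 b"
  define c where "c = inv \<gamma> e"
  obtain N' y' where y': "\<And>k::nat. fin_below (N' k) (y' k)" "y' \<longlonglongrightarrow> c" using finite_matrices_dense by blast
  \<comment> \<open>Replacing \<open>c\<close> by a finite matrix costs twice
    \<open>norm b / 16\<close>, the errors of both powers together one more; 3/16 stays below the
    displacement 1/2.\<close>
  have "norm b / 16 > 0" using b by simp
  then obtain k where k: "norm (y' k - c) < norm b / 16" using LIMSEQ_D[OF y'(2)] by blast
  define c0 where "c0 = y' k"
  have c0: "fin_below (2 ^ N' k) c0" unfolding c0_def using less_exp[of "N' k"] by (intro fin_below_mono[OF y'(1)]) simp
  have "(\<lambda>a. 16 * (1/2::real) ^ a * (norm c0 + norm b)) \<longlonglongrightarrow> 16 * 0 * (norm c0 + norm b)"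
    by (intro tendsto_intros LIMSEQ_realpow_zero) auto
  then have "\<forall>\<^sub>F a in sequentially. 16 * (1/2::real) ^ a * (norm c0 + norm b) < norm b / 16"
    using b by (intro order_tendstoD) auto
  then obtain N where N: "\<And>a. a \<ge> N \<Longrightarrow> 16 * (1/2::real) ^ a * (norm c0 + norm b) < norm b / 16"
    by (auto simp: eventually_sequentially)
  \<comment> \<open>Beyond \<open>N' k\<close> the block uses only bits that do not occur in the row
    indices of \<open>c0\<close>.\<close>
  obtain a where a: "a \<ge> max N (N' k)" "\<And>n. n \<in> {a..2*a} \<Longrightarrow> \<not> x n \<and> y n" using inf by blast
  define d where "d = 16 * (1/2::real) ^ a"
  have d: "d \<ge> 0" "d * norm c0 + d * norm b < norm b / 16" using N[of a] a(1) by (auto simp: d_def algebra_simps)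
  define \<alpha> where "\<alpha> = Al x lam ^^ kk a"
  have \<alpha>_eq: "\<alpha> z = Al x (\<lambda>n. lam n ^ kk a) z" for z by (simp add: \<alpha>_def Al_funpow[OF unit_summable_lam])
  have "Al x (mu a) c0 = c0" by (rule Al_mu_false[OF c0]) (use a in auto)
  then have 1: "norm (\<alpha> c0 - c0) \<le> d * norm c0" using Al_kk[where x = x and a = a and b = c0] by (simp add: \<alpha>_def d_def)
  have 2: "norm (\<alpha> c - \<alpha> c0) = norm (c - c0)"
    unfolding \<alpha>_eq using cstar_aut_diff[OF Al_aut[OF unit_summable_power[OF unit_summable_lam]]] cstar_aut_norm[OF Al_aut[OF unit_summable_power[OF unit_summable_lam]]]
    by metis
  have "norm (\<alpha> c - c) = norm ((\<alpha> c - \<alpha> c0) + (\<alpha> c0 - c0) + (c0 - c))" by simp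
  also have "\<dots> \<le> norm (\<alpha> c - \<alpha> c0) + norm (\<alpha> c0 - c0) + norm (c0 - c)"
    by (intro order_trans[OF norm_triangle_ineq] add_mono norm_triangle_ineq order_refl)
  also have "\<dots> \<le> norm b / 16 + d * norm c0 + norm b / 16"
    using 1 2 k by (simp add: c0_def norm_minus_commute)
  finally have up: "norm (\<alpha> c - c) \<le> norm b / 16 + d * norm c0 + norm b / 16" .
  have "norm ((Al y lam ^^ kk a) e - e) = norm (\<gamma> (\<alpha> c - c))"
    using cstar_aut_diff[OF \<gamma>] by (simp add: pow \<alpha>_def c_def bij)
  then have up': "norm ((Al y lam ^^ kk a) e - e) \<le> norm b / 16 + d * norm c0 + norm b / 16"
    using up cstar_aut_norm[OF \<gamma>] by simp
  have "norm b / 2 \<le> norm (Al y (mu a) e - e)" unfolding e_def by (rule Al_mu_true) (use a in auto)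
  also have "\<dots> \<le> norm ((Al y lam ^^ kk a) e - Al y (mu a) e) + norm ((Al y lam ^^ kk a) e - e)"
    using norm_triangle_ineq4[of "(Al y lam ^^ kk a) e - e" "(Al y lam ^^ kk a) e - Al y (mu a) e"] by (simp add: add.commute)
  also have "\<dots> \<le> d * norm b + (norm b / 16 + d * norm c0 + norm b / 16)"
    using up' Al_kk[where x = y and a = a and b = e] by (simp add: d_def e_def norm_E)
  finally have "norm b / 2 \<le> d * norm b + (norm b / 16 + d * norm c0 + norm b / 16)" .
  moreover have "norm b > 0" using b by simp
  ultimately show False using d(2) by linarith
qed

end

section \<open>Non-classifiability\<close>

text \<open>Even indices code the relation symbols and odd indices the graphs of the function symbols, the
  value being the first argument.\<close>

definition rel_of :: "nat set \<Rightarrow> nat set \<Rightarrow> (nat \<Rightarrow> nat) \<Rightarrow> lstruct \<Rightarrow> nat \<Rightarrow> nat list \<Rightarrow> bool" where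
  "rel_of Rs Fs ar M r u = (if even r then r div 2 \<in> Rs \<and> length u = ar (r div 2) \<and> fst M (r div 2) u
     else r div 2 \<in> Fs \<and> u \<noteq> [] \<and> length (tl u) = ar (r div 2) \<and> snd M (r div 2) (tl u) = hd u)"

text \<open>A bijection commutes with a function exactly if it preserves its graph; injectivity
  gives one direction, and the tuple headed by the value of the function gives the other.\<close>

lemma struct_iso_iff_isoR:
  "struct_iso Rs Fs ar M N \<longleftrightarrow> (\<exists>\<pi>. isoR \<pi> (rel_of Rs Fs ar M) (rel_of Rs Fs ar N))"
proof
  assume "struct_iso Rs Fs ar M N"
  then obtain \<pi> where \<pi>: "bij \<pi>"
    "\<And>r t. r \<in> Rs \<Longrightarrow> length t = ar r \<Longrightarrow> fst M r t \<longleftrightarrow> fst N r (map \<pi> t)"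
    "\<And>f t. f \<in> Fs \<Longrightarrow> length t = ar f \<Longrightarrow> \<pi> (snd M f t) = snd N f (map \<pi> t)"
    unfolding struct_iso_def by blast
  have "rel_of Rs Fs ar M r u \<longleftrightarrow> rel_of Rs Fs ar N r (map \<pi> u)" for r u
  proof (cases "even r")
    case True then show ?thesis using \<pi>(2) by (auto simp: rel_of_def)
  next
    case False
    show ?thesis
    proof (cases u)
      case Nil then show ?thesis using False by (simp add: rel_of_def)
    next
      case (Cons k t)
      have "snd N f (map \<pi> t) = \<pi> k \<longleftrightarrow> snd M f t = k" if "f \<in> Fs" "length t = ar f" for f
        using \<pi>(3)[OF that] \<pi>(1) by (metis bij_pointE)
      then show ?thesis using False Cons by (auto simp: rel_of_def)
    qed
  qed
  then show "\<exists>\<pi>. isoR \<pi> (rel_of Rs Fs ar M) (rel_of Rs Fs ar N)" using \<pi>(1) unfolding isoR_def by blast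
next
  assume "\<exists>\<pi>. isoR \<pi> (rel_of Rs Fs ar M) (rel_of Rs Fs ar N)"
  then obtain \<pi> where \<pi>: "bij \<pi>" "\<And>r u. rel_of Rs Fs ar M r u \<longleftrightarrow> rel_of Rs Fs ar N r (map \<pi> u)"
    unfolding isoR_def by blast
  have "fst M r t \<longleftrightarrow> fst N r (map \<pi> t)" if "r \<in> Rs" "length t = ar r" for r t
    using \<pi>(2)[of "2*r" t] that by (simp add: rel_of_def)
  moreover have "\<pi> (snd M f t) = snd N f (map \<pi> t)" if "f \<in> Fs" "length t = ar f" for f t
    using \<pi>(2)[of "2*f+1" "snd M f t # t"] that by (simp add: rel_of_def)
  ultimately show "struct_iso Rs Fs ar M N" unfolding struct_iso_def using \<pi>(1) by blast
qed

lemma vimage_sigma_sets_borel: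
  fixes f :: "'b::topological_space \<Rightarrow> 'c::topological_space"
  assumes f: "continuous_on UNIV f" "\<And>x. f x \<in> X" and T: "T \<in> sigma_sets X {X \<inter> U | U. open U}"
  shows "f -` T \<in> sets borel"
  using T
proof induction
  case (Basic a)
  then obtain U where "a = X \<inter> U" "open U" by blast
  then have "f -` a = f -` U" using f(2) by auto
  then show ?case using f(1) \<open>open U\<close> by (simp add: open_vimage)
next
  case (Compl a)
  have "f -` (X - a) = UNIV - f -` a" using f(2) by auto
  then show ?case using sets.compl_sets[OF Compl.IH] by simp
next
  case (Union a)
  then show ?case by (simp add: vimage_Union sets.countable_UN)
qed simp

text \<open>A finite initial segment says nothing about a block that starts later, so a constant
  block with left end in \<open>Y\<close> can always be added.\<close>

lemma meager_not_infinitely_often_constant: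
  assumes Y: "\<And>N. \<exists>a\<ge>N. a \<in> Y"
  shows "meager (- {x :: nat \<Rightarrow> bool. \<forall>N. \<exists>a\<ge>N. a \<in> Y \<and> (\<forall>n\<in>{a..2*a}. x n = v)})"
proof -
  define G where "G N = (\<Union>a\<in>{a\<in>Y. N \<le> a}. \<Inter>n\<in>{a..2*a}. (\<lambda>x :: nat \<Rightarrow> bool. x n) -` {v})" for N
  have "meager (- G N)" for N
  proof (rule meager_closed)
    have "open ((\<lambda>x :: nat \<Rightarrow> bool. x n) -` {v})" for n
      by (rule open_vimage[OF open_discrete continuous_on_product_coordinates])
    then have "open (G N)" unfolding G_def by (intro open_UN ballI open_INT) auto
    then show "closed (- G N)" by (simp add: closed_Compl)
    show "interior (- G N) = {}"
    proof (rule ccontr)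
      assume "interior (- G N) \<noteq> {}"
      then obtain x where "x \<in> interior (- G N)" by blast
      then obtain K where K: "cyl x K \<subseteq> interior (- G N)" using open_contains_cyl open_interior by blast
      obtain a where a: "a \<ge> max N K" "a \<in> Y" using Y by blast
      define z where "z n = (if n < K then x n else v)" for n
      have "z \<in> cyl x K" by (simp add: z_def cyl_def)
      then have "z \<notin> G N" using K interior_subset by blast
      moreover have "z \<in> G N" unfolding G_def using a by (auto simp: z_def intro!: bexI[of _ a])
      ultimately show False by blast
    qed
  qed
  then have "meager (\<Union>N. - G N)" by (rule meager_UN_nat)
  then show ?thesis
  proof (rule meager_subset, intro subsetI)
    fix x assume "x \<in> - {x. \<forall>N. \<exists>a\<ge>N. a \<in> Y \<and> (\<forall>n\<in>{a..2*a}. x n = v)}"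
    then obtain N where "\<forall>a\<ge>N. a \<in> Y \<longrightarrow> \<not> (\<forall>n\<in>{a..2*a}. x n = v)" by blast
    then have "x \<notin> G N" unfolding G_def by auto
    then show "x \<in> (\<Union>N. - G N)" by blast
  qed
qed

lemma comeager_meet:
  fixes C D :: "(nat \<Rightarrow> bool) set"
  assumes "meager (- C)" "meager (- D)" shows "\<exists>x. x \<in> C \<inter> D"
proof (rule ccontr)
  assume "\<nexists>x. x \<in> C \<inter> D"
  then have "UNIV \<subseteq> - C \<union> - D" by blast
  then have "meager (UNIV :: (nat \<Rightarrow> bool) set)" using meager_subset[OF meager_Un[OF assms]] by blast
  then show False using not_meager_open_fun[of "UNIV :: (nat \<Rightarrow> bool) set"] by simp
qed

theorem theorem5p2:
  fixes sc :: "complex \<Rightarrow> 'a::{banach,real_normed_algebra} \<Rightarrow> 'a" and st :: "'a \<Rightarrow> 'a"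
  assumes "cstar_alg sc st"
    and "separable_space TYPE('a)"
    and "stable sc st"
    and "\<exists>x::'a. x \<noteq> 0"
  shows "\<not> classifiable_ctbl (Aut sc st \<inter> closure (Inn sc st))
           (\<lambda>\<alpha> \<beta>. \<exists>\<gamma>\<in>Aut sc st. \<beta> = \<gamma> \<circ> \<alpha> \<circ> inv \<gamma>)"
proof
  define X where "X = Aut sc st \<inter> closure (Inn sc st)"
  assume "classifiable_ctbl (Aut sc st \<inter> closure (Inn sc st))
           (\<lambda>\<alpha> \<beta>. \<exists>\<gamma>\<in>Aut sc st. \<beta> = \<gamma> \<circ> \<alpha> \<circ> inv \<gamma>)"
  then obtain Rs Fs ar \<theta> where *: "\<forall>\<alpha>\<in>X. \<theta> \<alpha> \<in> Mod Rs Fs ar"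
    "\<forall>T\<in>cyl_gens Rs Fs ar. {\<alpha> \<in> X. \<theta> \<alpha> \<in> T} \<in> sigma_sets X {X \<inter> U | U. open U}"
    "\<forall>\<alpha>\<in>X. \<forall>\<beta>\<in>X. (\<exists>\<gamma>\<in>Aut sc st. \<beta> = \<gamma> \<circ> \<alpha> \<circ> inv \<gamma>) \<longleftrightarrow> struct_iso Rs Fs ar (\<theta> \<alpha>) (\<theta> \<beta>)"
    unfolding classifiable_ctbl_def X_def[symmetric] by (elim exE conjE)
  note \<theta> = *(1)[rule_format] and Bor = *(2)[rule_format] and red = *(3)[rule_format]
  obtain \<phi> where \<phi>: "bij_betw \<phi> UNIV (stab_model st)"
     "\<forall>x y. \<phi> (x + y) = (\<lambda>i j. \<phi> x i j + \<phi> y i j)"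
     "\<forall>c x. \<phi> (sc c x) = (\<lambda>i j. sc c (\<phi> x i j))"
     "\<forall>x y. \<phi> (x * y) = matmul (\<phi> x) (\<phi> y)"
     "\<forall>x. \<phi> (st x) = matstar st (\<phi> x)"
    using assms(3) unfolding stable_def by (elim exE conjE)
  interpret stable_cstar sc st \<phi>
    by (intro stable_cstar.intro cstar.intro stable_cstar_axioms.intro assms(1) \<phi>(1) \<phi>(2-5)[rule_format])
  define f where "f x = Al x lam" for x
  have fX: "f x \<in> X" for x
    unfolding X_def f_def Aut_def using Al_aut[OF unit_summable_lam] Al_closure_Inn[OF unit_summable_lam] by blast
  have fc: "continuous_on UNIV f" unfolding f_def[abs_def] by (rule continuous_Al[OF unit_summable_lam])
  define P where "P x = rel_of Rs Fs ar (\<theta> (f x))" for x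
  have cyl: "{x. \<theta> (f x) \<in> T} \<in> sets borel" if "T \<in> cyl_gens Rs Fs ar" for T
  proof -
    have "{x. \<theta> (f x) \<in> T} = f -` {\<alpha> \<in> X. \<theta> \<alpha> \<in> T}" using fX by auto
    then show ?thesis using vimage_sigma_sets_borel[OF fc fX Bor[OF that]] by simp
  qed
  have "generic_ergodicity tt P"
  proof
    show "0 < tt n" for n by (rule tt_pos)
    show "tt \<longlonglongrightarrow> 0" by (rule tt_lim)
    show "{x. P x r u} \<in> sets borel" for r u
    proof (cases "even r")
      case True
      show ?thesis
      proof (cases "r div 2 \<in> Rs \<and> length u = ar (r div 2)")
        case c: True
        have "{x. P x r u} = {x. \<theta> (f x) \<in> {M \<in> Mod Rs Fs ar. fst M (r div 2) u}}"
          using True c \<theta>[OF fX] by (auto simp: P_def rel_of_def)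
        also have "\<dots> \<in> sets borel" 
          using c unfolding cyl_gens_def by (intro cyl[unfolded cyl_gens_def]) blast
        finally show ?thesis .
      next
        case False
        then have "{x. P x r u} = {}" using True by (auto simp: P_def rel_of_def)
        then show ?thesis by simp
      qed
    next
      case odd: False
      show ?thesis
      proof (cases "r div 2 \<in> Fs \<and> u \<noteq> [] \<and> length (tl u) = ar (r div 2)")
        case c: True
        have "{x. P x r u} = {x. \<theta> (f x) \<in> {M \<in> Mod Rs Fs ar. snd M (r div 2) (tl u) = hd u}}"
          using odd c \<theta>[OF fX] by (auto simp: P_def rel_of_def)
        also have "\<dots> \<in> sets borel" 
          using c unfolding cyl_gens_def by (intro cyl[unfolded cyl_gens_def]) blast
        finally show ?thesis .
      next
        case False
        then have "{x. P x r u} = {}" using odd by (auto simp: P_def rel_of_def)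
        then show ?thesis by simp
      qed
    qed
    show "\<exists>\<pi>. isoR \<pi> (P x) (P y)" if "summable (\<lambda>n. if x n \<noteq> y n then tt n else 0)" for x y
      using Al_conjugate[OF unit_summable_lam that] red[OF fX[of x] fX[of y]] unfolding struct_iso_iff_isoR P_def f_def by blast
  qed
  then obtain C where C: "meager (- C)" "\<And>x y. x \<in> C \<Longrightarrow> y \<in> C \<Longrightarrow> \<exists>\<pi>. isoR \<pi> (P x) (P y)"
    using generic_ergodicity.generically_ergodic by blast
  \<comment> \<open>\<open>y\<close> is fixed before \<open>x\<close>: the blocks on which
    \<open>y\<close> is true form the infinite set of admissible left ends for \<open>x\<close>, so
    the same blocks serve both points.\<close>
  obtain y where y: "y \<in> C" "\<And>N. \<exists>a\<ge>N. \<forall>n\<in>{a..2*a}. y n"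
    using comeager_meet[OF C(1) meager_not_infinitely_often_constant[of UNIV True]] by auto
  obtain x where x: "x \<in> C" "\<And>N. \<exists>a\<ge>N. a \<in> {a. \<forall>n\<in>{a..2*a}. y n} \<and> (\<forall>n\<in>{a..2*a}. x n = False)"
    using comeager_meet[OF C(1) meager_not_infinitely_often_constant[of "{a. \<forall>n\<in>{a..2*a}. y n}" False]] y(2) by auto
  obtain b :: 'a where "b \<noteq> 0" using assms(4) by blast
  then have "\<not> (\<exists>\<gamma>\<in>Aut sc st. f y = \<gamma> \<circ> f x \<circ> inv \<gamma>)"
    unfolding f_def using x(2) by (intro not_conjugate) blast+
  moreover have "struct_iso Rs Fs ar (\<theta> (f x)) (\<theta> (f y))"
    using C(2)[OF x(1) y(1)] unfolding P_def struct_iso_iff_isoR .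
  ultimately show False using red[OF fX[of x] fX[of y]] by blast
qed

end
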